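(* Let $r\ge3$ be an integer. Suppose $\operatorname{rank}\mathbb L_\omega=n-1$, $\widehat H\in\mathcal A^\rho\cap\mathcal F_\diamond$, and the normal form of $H_2+\widehat H$ is of order $O_r(\mathbf z)$, i.e. $N_\diamond=O_r(\mathbf z)$. Let $q_1,\dots,q_n,p$ be integers and $\lambda>0$ a real number such that $p>0$, $\gcd(|q_1|,\dots,|q_n|,p)=1$ and $\omega=\lambda q/p$, $q=(q_1,\dots,q_n)$. Then there are positive constants $C_z,C_H$, depending on $\rho,\|\widehat H\|_\rho,\{\Omega_j\}$ and $n$, such that for any $\delta\ge0$ there exists a canonical change of variables $\mathbf w\mapsto\mathbf z$ which transforms the Hamiltonian $H_2+\widehat H$ to $H_2(\mathbf w)+G(\mathbf w)$, $G=O_r(\mathbf w)$, where $$G=G^0+G^*,\qquad G^0\in\mathcal N_\diamond,$$ and in the domain $$\Big\{\mathbf w\in\mathbb C^{2n}:|\mathbf w|\le\frac{C_z}{1+\delta^{1/(r-2)}}\Big\}$$ the following estimates hold: $$|G^0|\le\frac{C_H}{1+\delta^{r/(r-2)}}\quad\text{and}\quad|G^*|\le e^{-\lambda\delta/p}\,\frac{C_H}{1+\delta^{r/(r-2)}}.$$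
   Context: Fix $n\ge1$ and a vector $\omega\in\mathbb R^n$. $\mathbb Z_+=\{0,1,2,\dots\}$. For $\mathbf k=(k,\overline k)\in\mathbb Z_+^{2n}$, with $k,\overline k\in\mathbb Z_+^n$, put $|\mathbf k|=\sum_j(k_j+\overline k_j)$ and $\mathbf k'=\overline k-k\in\mathbb Z^n$. Put $\mathbb Z^{2n}_\diamond=\{\mathbf k\in\mathbb Z_+^{2n}:|\mathbf k|\ge3\}$. $\mathbb L_\omega=\{q\in\mathbb Z^n:\langle\omega,q\rangle=0\}$, and $\operatorname{rank}\mathbb L_\omega$ is its rank as an abelian group. For $q\in\mathbb Z^n$ put $|q|=\sum_j|q_j|$ and $\sigma_q=\operatorname{sign}\langle\omega,q\rangle\in\{-1,0,1\}$. Put $\Omega_s=\max\{1/|\langle\omega,q\rangle|:q\in\mathbb Z^n\setminus\mathbb L_\omega,\ |q|\le s\}$. The variables $\mathbf z=(z,\overline z)=(z_1,\dots,z_n,\overline z_1,\dots,\overline z_n)$ are $2n$ independent complex variables (the bar is not conjugation), and similarly for $\mathbf w$; $\mathbf z^{\mathbf k}=z^k\overline z^{\overline k}$; $|\mathbf w|$ is the $l^1$-norm. $\mathcal F=\mathbb C[[z,\overline z]]$ is the space of formal power series $H=\sum_{\mathbf k}H_{\mathbf k}\mathbf z^{\mathbf k}$; $\mathcal F_\diamond\subset\mathcal F$ is the subspace of series with $H_{\mathbf k}=0$ for $|\mathbf k|\le2$; $\mathcal N_\diamond$ is the subspace of those $H\in\mathcal F_\diamond$ such that $H_{\mathbf k}\ne0$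 implies $\mathbf k'\in\mathbb L_\omega$; $H=O_r(\mathbf z)$ means $H_{\mathbf k}=0$ for $|\mathbf k|<r$. For $\rho>0$ put $D_\rho=\{\mathbf z\in\mathbb C^{2n}:|z_j|<\rho,\ |\overline z_j|<\rho,\ j=1,\dots,n\}$ and let $\mathcal A^\rho$ be the Banach space of power series in $\mathcal F$ that define bounded analytic functions on $D_\rho$, with norm $\|H\|_\rho=\sup_{D_\rho}|H|$. The Poisson bracket is $\{F,G\}=i\sum_{j=1}^n(\partial_{\overline z_j}F\,\partial_{z_j}G-\partial_{z_j}F\,\partial_{\overline z_j}G)$; a change of variables is canonical if it preserves this bracket. $H_2(\mathbf z)=\sum_{j=1}^n\omega_jz_j\overline z_j$. The operator $\xi_*$ on $\mathcal F_\diamond$ is $\xi_*H=-i\sum_{\mathbf k\in\mathbb Z^{2n}_\diamond}\sigma_{\mathbf k'}H_{\mathbf k}\mathbf z^{\mathbf k}$. For $\widehat H\in\mathcal F_\diamond$, $\phi^\delta_{\xi_*}(\widehat H)$ is the (unique, existing for all $\delta\in\mathbb R$) solution $H(\cdot,\delta)$ of the initial value problem, understood coefficientwise, $\partial_\delta H=-\{\xi_*H,H_2+H\}$, $H|_{\delta=0}=\widehat H$. The coefficientwise limit $N_\diamond=\lim_{\delta\to+\infty}\phi^\delta_{\xi_*}(\widehat H)\in\mathcal N_\diamond$ exists, and $H_2+N_\diamond$ is called the normal form of $H_2+\widehat H$. *)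

theory Defs
  imports "HOL-Analysis.Analysis" "HOL-Library.Function_Algebras"
begin

text \<open>
  Points and multi-indices are pairs \<open>(z, zbar)\<close>, \<open>(k, kbar)\<close>; the two components are independent
  of each other. A formal power series is its family of coefficients. From
  \<open>HOL-Library.Function_Algebras\<close> only the pointwise \<open>+\<close> and \<open>-\<close> on coefficient families are used:
  the pointwise \<open>*\<close> on functions is not the product of power series, which is \<open>ser_mult\<close>.
\<close>

type_synonym 'n pt = "(complex ^ 'n) \<times> (complex ^ 'n)"
type_synonym 'n midx = "(nat ^ 'n) \<times> (nat ^ 'n)"
type_synonym 'n ser = "'n midx \<Rightarrow> complex"


subsection \<open>Resonances and small denominators\<close>

definition freq :: "real ^ 'n \<Rightarrow> int ^ 'n \<Rightarrow> real" where
  "freq \<omega> q = (\<Sum>j\<in>UNIV. \<omega> $ j * real_of_int (q $ j))"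

definition res_lattice :: "real ^ 'n \<Rightarrow> (int ^ 'n) set" where
  "res_lattice \<omega> = {q. freq \<omega> q = 0}"

definition int_norm1 :: "int ^ 'n \<Rightarrow> int" where
  "int_norm1 q = (\<Sum>j\<in>UNIV. \<bar>q $ j\<bar>)"

text \<open>The library predicate for linear dependence is stated for arbitrary modules; here it is
  used over the integers.\<close>

lemma module_int_vec: "module ((*s) :: int \<Rightarrow> int ^ 'n \<Rightarrow> int ^ 'n)"
  by unfold_locales (simp_all add: vector_add_ldistrib vector_sadd_rdistrib vector_smult_assoc)

definition ab_rank :: "(int ^ 'n) set \<Rightarrow> nat" where
  "ab_rank L = Max {card B | B. finite B \<and> B \<subseteq> L \<and>
     \<not> module.dependent ((*s) :: int \<Rightarrow> int ^ 'n \<Rightarrow> int ^ 'n) B}"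

text \<open>For \<open>s = 0\<close> (and for \<open>\<omega> = 0\<close>) the set is empty and \<open>Omega \<omega> s\<close> is the constant \<open>Max {}\<close>,
  which carries no information about \<open>\<omega>\<close>.\<close>

definition Omega :: "real ^ 'n \<Rightarrow> nat \<Rightarrow> real" where
  "Omega \<omega> s = Max {1 / \<bar>freq \<omega> q\<bar> | q. q \<notin> res_lattice \<omega> \<and> int_norm1 q \<le> int s}"


subsection \<open>Formal power series\<close>

definition deg :: "'n::finite midx \<Rightarrow> nat" where
  "deg k = (\<Sum>j\<in>UNIV. fst k $ j + snd k $ j)"

definition kprime :: "'n midx \<Rightarrow> int ^ 'n" where
  "kprime k = (\<chi> j. int (snd k $ j) - int (fst k $ j))"

definition O_ord :: "nat \<Rightarrow> 'n::finite ser \<Rightarrow> bool" where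
  "O_ord r H \<longleftrightarrow> (\<forall>k. deg k < r \<longrightarrow> H k = 0)"

definition F_diamond :: "('n::finite ser) set" where
  "F_diamond = {H. \<forall>k. deg k \<le> 2 \<longrightarrow> H k = 0}"

definition N_diamond :: "real ^ 'n \<Rightarrow> ('n ser) set" where
  "N_diamond \<omega> = {H \<in> F_diamond. \<forall>k. H k \<noteq> 0 \<longrightarrow> kprime k \<in> res_lattice \<omega>}"

definition ser_mult :: "'n::finite ser \<Rightarrow> 'n ser \<Rightarrow> 'n ser" where
  "ser_mult F G k = (\<Sum>(a, b) \<in> {(a, b). a + b = k}. F a * G b)"

definition ser_dz :: "'n::finite \<Rightarrow> 'n ser \<Rightarrow> 'n ser" where
  "ser_dz j F k = of_nat (fst k $ j + 1) * F (fst k + axis j 1, snd k)"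

definition ser_dzb :: "'n::finite \<Rightarrow> 'n ser \<Rightarrow> 'n ser" where
  "ser_dzb j F k = of_nat (snd k $ j + 1) * F (fst k, snd k + axis j 1)"

definition ser_bracket :: "'n::finite ser \<Rightarrow> 'n ser \<Rightarrow> 'n ser" where
  "ser_bracket F G k = \<i> * (\<Sum>j\<in>UNIV.
     ser_mult (ser_dzb j F) (ser_dz j G) k - ser_mult (ser_dz j F) (ser_dzb j G) k)"

definition H2 :: "real ^ 'n \<Rightarrow> 'n ser" where
  "H2 \<omega> k = (\<Sum>j\<in>UNIV. if k = (axis j 1, axis j 1) then of_real (\<omega> $ j) else 0)"


subsection \<open>The normalization flow and the normal form\<close>

definition xi :: "real ^ 'n \<Rightarrow> 'n ser \<Rightarrow> 'n ser" where
  "xi \<omega> H k = (if 3 \<le> deg k then - \<i> * of_real (sgn (freq \<omega> (kprime k))) * H k else 0)"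

definition norm_flow :: "real ^ 'n \<Rightarrow> 'n ser \<Rightarrow> (real \<Rightarrow> 'n ser) \<Rightarrow> bool" where
  "norm_flow \<omega> H0 H \<longleftrightarrow>
     H 0 = H0 \<and> (\<forall>\<delta>. H \<delta> \<in> F_diamond) \<and>
     (\<forall>k \<delta>. ((\<lambda>t. H t k) has_vector_derivative
        - ser_bracket (xi \<omega> (H \<delta>)) (H2 \<omega> + H \<delta>) k) (at \<delta>))"

text \<open>The flow of \<open>H0 \<in> F_diamond\<close> exists and is unique, hence there is exactly one such \<open>N\<close>;
  the normal form of \<open>H2 \<omega> + H0\<close> is \<open>H2 \<omega> + N\<close>.\<close>

definition is_normal_form :: "real ^ 'n \<Rightarrow> 'n ser \<Rightarrow> 'n ser \<Rightarrow> bool" where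
  "is_normal_form \<omega> H0 N \<longleftrightarrow>
     (\<exists>H. norm_flow \<omega> H0 H \<and> (\<forall>k. ((\<lambda>\<delta>. H \<delta> k) \<longlongrightarrow> N k) at_top))"


subsection \<open>Convergent power series\<close>

definition monomial :: "'n::finite midx \<Rightarrow> 'n pt \<Rightarrow> complex" where
  "monomial k z = (\<Prod>j\<in>UNIV. (fst z $ j) ^ (fst k $ j) * (snd z $ j) ^ (snd k $ j))"

definition converges_on :: "'n::finite ser \<Rightarrow> 'n pt set \<Rightarrow> bool" where
  "converges_on H U \<longleftrightarrow> (\<forall>z\<in>U. (\<lambda>k. H k * monomial k z) summable_on UNIV)"

definition ser_eval :: "'n::finite ser \<Rightarrow> 'n pt \<Rightarrow> complex" where
  "ser_eval H z = (\<Sum>\<^sub>\<infinity>k. H k * monomial k z)"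

definition polydisc :: "real \<Rightarrow> 'n::finite pt set" where
  "polydisc \<rho> = {z. \<forall>j. cmod (fst z $ j) < \<rho> \<and> cmod (snd z $ j) < \<rho>}"

definition A_space :: "real \<Rightarrow> ('n::finite ser) set" where
  "A_space \<rho> = {H. converges_on H (polydisc \<rho>) \<and> bounded (ser_eval H ` polydisc \<rho>)}"

definition A_norm :: "real \<Rightarrow> 'n::finite ser \<Rightarrow> real" where
  "A_norm \<rho> H = (SUP z\<in>polydisc \<rho>. cmod (ser_eval H z))"

definition pt_norm1 :: "'n::finite pt \<Rightarrow> real" where
  "pt_norm1 w = (\<Sum>j\<in>UNIV. cmod (fst w $ j) + cmod (snd w $ j))"


subsection \<open>Canonical changes of variables\<close>

text \<open>Holomorphy in several variables: real differentiable with complex-linear derivative.\<close>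

definition holo_on :: "('n::finite pt \<Rightarrow> complex) \<Rightarrow> 'n pt set \<Rightarrow> bool" where
  "holo_on f U \<longleftrightarrow> (\<forall>z\<in>U. \<exists>f'. (f has_derivative f') (at z) \<and>
     (\<forall>c v. f' (c *s fst v, c *s snd v) = c * f' v))"

definition pd_z :: "'n::finite \<Rightarrow> ('n pt \<Rightarrow> complex) \<Rightarrow> 'n pt \<Rightarrow> complex" where
  "pd_z j F z = deriv (\<lambda>t. F (fst z + axis j t, snd z)) 0"

definition pd_zb :: "'n::finite \<Rightarrow> ('n pt \<Rightarrow> complex) \<Rightarrow> 'n pt \<Rightarrow> complex" where
  "pd_zb j F z = deriv (\<lambda>t. F (fst z, snd z + axis j t)) 0"

definition bracket :: "('n::finite pt \<Rightarrow> complex) \<Rightarrow> ('n pt \<Rightarrow> complex) \<Rightarrow> 'n pt \<Rightarrow> complex" where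
  "bracket F G z = \<i> * (\<Sum>j\<in>UNIV. pd_zb j F z * pd_z j G z - pd_z j F z * pd_zb j G z)"

text \<open>A change of variables is an injective holomorphic map of a neighbourhood of the origin that
  fixes the origin (the Hamiltonians are power series at the origin).\<close>

definition canonical_change :: "'n::finite pt set \<Rightarrow> ('n pt \<Rightarrow> 'n pt) \<Rightarrow> bool" where
  "canonical_change U \<Phi> \<longleftrightarrow>
     open U \<and> 0 \<in> U \<and> \<Phi> 0 = 0 \<and> inj_on \<Phi> U \<and>
     (\<forall>j. holo_on (\<lambda>w. fst (\<Phi> w) $ j) U \<and> holo_on (\<lambda>w. snd (\<Phi> w) $ j) U) \<and>
     (\<forall>F G. holo_on F (\<Phi> ` U) \<and> holo_on G (\<Phi> ` U) \<longrightarrow>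
        (\<forall>w\<in>U. bracket (F \<circ> \<Phi>) (G \<circ> \<Phi>) w = bracket F G (\<Phi> w)))"

end

(*
  Since omega is a multiple of an integer vector, the nonzero frequencies are bounded away from 0
  by some nu, so there are no small divisors.  The change of variables is a composition of maps
  exp(ad X) given by Lie series; each step removes the whole nonresonant part P of the current
  perturbation by solving {X, H2} = - P.

  Up to order r a Newton iteration works: if the perturbation has order s and its resonant part
  has order 2 s - 2, one step leads to order 2 s - 2, and s - 2 doubles, so the radius shrinks by a
  bounded factor independent of r.  That the resonant parts vanish is a spectral fact.  Let P(L) be
  the product of L - mu over the eigenvalues mu of L = {H2, -} in degrees 1, ..., r - 2.  The property
  that P({H, -}) maps series without constant term to order r - 1 is invariant under canonical
  transformations, holds for H2 + N with N = O_r, is inherited backwards by the normalization flow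
  because the leading graded part of P({H, -}) is constant along it, and forces the resonant part of
  a perturbation of order s to vanish below degree min(2 s - 2, r).

  On a polydisc of radius of order delta^(-1/(r-2)) the remaining perturbation of order r is
  relatively of size 1/delta, and about nu delta further steps, each contracting the nonresonant part
  by a fixed factor, make it exponentially small.
*)
theory Submission
  imports Defs
begin

section \<open>Multi-indices\<close>

text \<open>The order of quantifiers shapes the estimates: \<open>C_z\<close> and \<open>C_H\<close>
  see only \<rho>, the norm and the sequence \<open>Omega\<close>, so no bound may depend on
  \<open>r\<close>, \<open>p\<close> or \<open>lam\<close>, and the spectral gap has to be recovered
  from \<open>Omega\<close> itself.

  The hypothesis on the normal form is purely formal. It concerns a flow whose analyticity is never
  discussed, whereas the convergent iteration arrives at some other normal form, so an invariant
  shared by both is required. The chosen one is a Jordan decomposition in disguise. For resonant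
  \<open>Z\<close> of order 3 the operators \<open>{H2, -}\<close> and \<open>{Z, -}\<close>
  commute; the former is diagonal on monomials, the latter raises degrees and is nilpotent modulo
  any order. A polynomial \<open>P\<close> with simple roots at all eigenvalues annihilates the sum,
  up to a given order, only if the nilpotent part vanishes there. To first order in a perturbation
  \<open>F\<close> the operator on the eigenspace of \<mu> is \<open>P'(\<mu>)\<close> times the
  bracket with \<open>F\<close>, and \<open>P'(\<mu>)\<close> is nonzero because the roots are
  simple; this is how vanishing of coefficients is extracted.\<close>

definition cmp :: "'n::finite midx \<Rightarrow> 'n + 'n \<Rightarrow> nat" where
  "cmp k = case_sum (\<lambda>j. fst k $ j) (\<lambda>j. snd k $ j)"

definition unit_idx :: "'n::finite + 'n \<Rightarrow> 'n midx" where
  "unit_idx = case_sum (\<lambda>j. (axis j 1, 0)) (\<lambda>j. (0, axis j 1))"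

lemma cmp_simps [simp]: "cmp k (Inl j) = fst k $ j" "cmp k (Inr j) = snd k $ j"
  by (simp_all add: cmp_def)

lemma unit_idx_simps: "unit_idx (Inl j) = (axis j 1, 0)" "unit_idx (Inr j) = (0, axis j 1)"
  by (simp_all add: unit_idx_def)

lemma cmp_add [simp]: "cmp (k + l) v = cmp k v + cmp l v"
  by (cases v) simp_all

lemma cmp_diff [simp]: "cmp (k - l) v = cmp k v - cmp l v"
  by (cases v) simp_all

lemma cmp_zero [simp]: "cmp 0 v = 0"
  by (cases v) simp_all

lemma cmp_unit [simp]: "cmp (unit_idx v) u = (if u = v then 1 else 0)"
  by (cases v; cases u) (auto simp: unit_idx_def axis_def)

lemma midx_eqI: "(\<And>v. cmp k v = cmp l v) \<Longrightarrow> k = l"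
  by (metis cmp_simps prod_eq_iff vec_eq_iff)

lemma sum_UNIV_Plus:
  fixes f :: "'a::finite + 'b::finite \<Rightarrow> 'c::comm_monoid_add"
  shows "(\<Sum>v\<in>UNIV. f v) = (\<Sum>j\<in>UNIV. f (Inl j)) + (\<Sum>j\<in>UNIV. f (Inr j))"
  by (simp add: UNIV_Plus_UNIV[symmetric] sum.Plus del: UNIV_Plus_UNIV)

lemma prod_UNIV_Plus:
  fixes f :: "'a::finite + 'b::finite \<Rightarrow> 'c::comm_monoid_mult"
  shows "(\<Prod>v\<in>UNIV. f v) = (\<Prod>j\<in>UNIV. f (Inl j)) * (\<Prod>j\<in>UNIV. f (Inr j))"
  by (simp add: UNIV_Plus_UNIV[symmetric] prod.Plus del: UNIV_Plus_UNIV)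

lemma deg_eq: "deg k = (\<Sum>v\<in>UNIV. cmp k v)"
  by (simp add: deg_def sum_UNIV_Plus sum.distrib)

lemma deg_add [simp]: "deg (k + l) = deg k + deg l"
  by (simp add: deg_eq sum.distrib)

lemma deg_zero [simp]: "deg 0 = 0"
  by (simp add: deg_eq)

lemma deg_unit [simp]: "deg (unit_idx v) = 1"
  by (simp add: deg_eq)

lemma cmp_le_deg: "cmp k v \<le> deg k"
  unfolding deg_eq by (rule member_le_sum) auto

lemma deg_eq_0_iff: "deg k = 0 \<longleftrightarrow> k = 0"
  by (metis cmp_le_deg cmp_zero deg_zero le_zero_eq midx_eqI)

lemma midx_decomp:
  assumes "cmp k v > 0" obtains l where "k = l + unit_idx v"
proof -
  have "k = (k - unit_idx v) + unit_idx v"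
    by (rule midx_eqI) (use assms in auto)
  then show ?thesis using that by blast
qed

lemma deg_decomp:
  assumes "deg k > 0" obtains l v where "k = l + unit_idx v"
proof -
  obtain v where "cmp k v > 0"
    using assms unfolding deg_eq by (metis gr0I not_less_zero sum.neutral)
  then show ?thesis using midx_decomp that by metis
qed

lemma midx_induct [case_names zero add]:
  assumes "P 0" "\<And>k v. P k \<Longrightarrow> P (k + unit_idx v)"
  shows "P k"
proof (induction "deg k" arbitrary: k)
  case 0
  then show ?case using assms(1) deg_eq_0_iff by metis
next
  case (Suc n)
  then obtain l v where "k = l + unit_idx v" using deg_decomp by (metis zero_less_Suc)
  with Suc show ?case by (simp add: assms(2))
qed

lemma finite_deg_le: "finite {k :: 'n::finite midx. deg k \<le> n}"
proof (rule finite_imageD)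
  show "finite (cmp ` {k :: 'n midx. deg k \<le> n})"
  proof (rule finite_subset)
    show "cmp ` {k :: 'n midx. deg k \<le> n} \<subseteq> PiE UNIV (\<lambda>_. {..n})"
      using cmp_le_deg by (auto intro: order_trans)
    show "finite (PiE (UNIV :: ('n + 'n) set) (\<lambda>_. {..n}))" by (rule finite_PiE) auto
  qed
  show "inj_on cmp {k :: 'n midx. deg k \<le> n}"
    by (auto intro!: inj_onI midx_eqI)
qed

lemma deg_le_add: "deg a \<le> deg (a + b)" "deg b \<le> deg (a + b)"
  by simp_all

lemma finite_splits: "finite {(a, b). a + b = (k :: 'n::finite midx)}"
proof (rule finite_subset)
  show "{(a, b). a + b = k} \<subseteq> {a. deg a \<le> deg k} \<times> {b. deg b \<le> deg k}"
    using deg_le_add by blast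
qed (simp add: finite_deg_le)


section \<open>The ring of formal power series\<close>

definition sscale :: "complex \<Rightarrow> 'n::finite ser \<Rightarrow> 'n ser" where
  "sscale c F = (\<lambda>k. c * F k)"

definition smono :: "'n::finite midx \<Rightarrow> 'n ser" where
  "smono k = (\<lambda>l. if l = k then 1 else 0)"

lemma sscale_apply [simp]: "sscale c F k = c * F k"
  by (simp add: sscale_def)

lemma ser_minus_apply [simp]: "(F - G) k = F k - (G k :: complex)"
  by (rule minus_apply)

lemma ser_uminus_apply [simp]: "(- G) k = - (G k :: complex)"
  by (rule uminus_apply)

lemma ser_sum_apply: "(\<Sum>i\<in>I. F i) k = (\<Sum>i\<in>I. F i k :: complex)"
  by (induction I rule: infinite_finite_induct) auto

lemma ser_mult_commute: "ser_mult F G = ser_mult G F"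
  unfolding ser_mult_def fun_eq_iff
  by (intro allI sum.reindex_bij_witness[of _ prod.swap prod.swap]) (auto simp: add.commute)

lemma ser_mult_add: "ser_mult F (G + H) = ser_mult F G + ser_mult F H"
  by (auto simp: ser_mult_def fun_eq_iff sum.distrib[symmetric] algebra_simps intro!: sum.cong)

lemma ser_mult_scale: "ser_mult F (sscale c G) = sscale c (ser_mult F G)"
  by (auto simp: ser_mult_def fun_eq_iff sum_distrib_left algebra_simps intro!: sum.cong)

lemma ser_mult_assoc:
  fixes F :: "'n::finite ser"
  shows "ser_mult (ser_mult F G) H = ser_mult F (ser_mult G H)"
proof
  fix k
  have "ser_mult (ser_mult F G) H k =
      (\<Sum>(x, y)\<in>(SIGMA x:{(p, c). p + c = k}. {(a, b). a + b = fst x}). F (fst y) * G (snd y) * H (snd x))"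
    unfolding ser_mult_def
    by (subst sum.Sigma[symmetric])
       (auto simp: finite_splits sum_distrib_right case_prod_beta intro!: sum.cong)
  also have "\<dots> = (\<Sum>(x, y)\<in>(SIGMA x:{(a, q). a + q = k}. {(b, c). b + c = snd x}). F (fst x) * (G (fst y) * H (snd y)))"
    by (rule sum.reindex_bij_witness[of _ "\<lambda>(x, y). ((fst x + fst y, snd y), (fst x, fst y))"
         "\<lambda>(x, y). ((fst y, snd y + snd x), (snd y, snd x))"])
       (auto simp: add.assoc mult.assoc)
  also have "\<dots> = ser_mult F (ser_mult G H) k"
    unfolding ser_mult_def
    by (subst sum.Sigma[symmetric])
       (auto simp: finite_splits sum_distrib_left case_prod_beta intro!: sum.cong)
  finally show "ser_mult (ser_mult F G) H k = ser_mult F (ser_mult G H) k" .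
qed

lemma ser_mult_one: "ser_mult (smono 0) (F :: 'n::finite ser) = F"
proof
  fix k
  have "ser_mult (smono 0) F k = (\<Sum>(a, b)\<in>{(0 :: 'n midx, k)}. smono 0 a * F b)"
    unfolding ser_mult_def
  proof (rule sum.mono_neutral_right[OF finite_splits])
    show "\<forall>i\<in>{(a, b). a + b = k} - {(0, k)}. (case i of (a, b) \<Rightarrow> smono 0 a * F b) = 0"
      by (auto simp: smono_def zero_prod_def split: if_splits)
  qed auto
  then show "ser_mult (smono 0) F k = F k" by (simp add: smono_def)
qed

text \<open>Interpreted with explicit operations, since \<open>*\<close> on functions already
  denotes the pointwise product; the ring laws of the convolution become available under the prefix
  \<open>ser\<close>.\<close>

interpretation ser: comm_ring where times = "ser_mult :: 'n::finite ser \<Rightarrow> _"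
  and minus = minus and uminus = uminus and plus = plus and zero = 0
proof
  fix F G H :: "'n ser"
  show "ser_mult (F + G) H = ser_mult F H + ser_mult G H"
    by (metis ser_mult_add ser_mult_commute)
qed (auto simp: ser_mult_assoc intro: ser_mult_commute)

lemma smono_add: "ser_mult (smono k) (smono l) = smono (k + l :: 'n::finite midx)"
proof
  fix m
  have "ser_mult (smono k) (smono l) m = (\<Sum>(a, b)\<in>{(a, b). a + b = m \<and> a = k \<and> b = l}. 1)"
    unfolding ser_mult_def
    by (rule sum.mono_neutral_cong_right) (auto simp: smono_def finite_splits split: if_splits)
  also have "{(a, b). a + b = m \<and> a = k \<and> b = l} = (if m = k + l then {(k, l)} else {})"
    by auto
  finally show "ser_mult (smono k) (smono l) m = smono (k + l) m"
    by (simp add: smono_def)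
qed

lemma sscale_add: "sscale c (F + G) = sscale c F + sscale c G"
  by (auto simp: algebra_simps)

lemma sscale_add_left: "sscale (c + d) F = sscale c F + sscale d F"
  by (auto simp: algebra_simps)

lemma sscale_sscale [simp]: "sscale c (sscale d F) = sscale (c * d) F"
  by (auto simp: algebra_simps)

lemma sscale_one [simp]: "sscale 1 F = F" by auto

lemma sscale_zero [simp]: "sscale c 0 = 0" "sscale 0 F = 0" by auto

lemma sscale_minus_one: "sscale (-1) F = - F" by auto

lemma sscale_sum: "sscale c (\<Sum>i\<in>I. F i) = (\<Sum>i\<in>I. sscale c (F i))"
  by (auto simp: ser_sum_apply sum_distrib_left)

lemma ser_mult_scale_left: "ser_mult (sscale c F) G = sscale c (ser_mult F G)"
  by (metis ser_mult_commute ser_mult_scale)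


lemma ser_mult_sum: "ser_mult F (\<Sum>i\<in>I. G i) = (\<Sum>i\<in>I. ser_mult F (G i))"
  by (induction I rule: infinite_finite_induct) (simp_all only: sum.infinite sum.empty sum.insert ser_mult_add ser.mult_zero_right not_False_eq_True)

lemma ser_mult_sum_left: "ser_mult (\<Sum>i\<in>I. G i) F = (\<Sum>i\<in>I. ser_mult (G i) F)"
  by (metis (no_types, lifting) ser_mult_commute ser_mult_sum sum.cong)


section \<open>Partial derivatives and the Poisson bracket\<close>

definition sderiv :: "'n::finite + 'n \<Rightarrow> 'n ser \<Rightarrow> 'n ser" where
  "sderiv v F k = of_nat (cmp k v + 1) * F (k + unit_idx v)"

lemma sderiv_simps: "sderiv (Inl j) = ser_dz j" "sderiv (Inr j) = ser_dzb j"
  by (simp_all add: fun_eq_iff sderiv_def ser_dz_def ser_dzb_def unit_idx_def plus_prod_def)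

lemma sderiv_add: "sderiv v (F + G) = sderiv v F + sderiv v G"
  by (auto simp: sderiv_def algebra_simps)

lemma sderiv_scale: "sderiv v (sscale c F) = sscale c (sderiv v F)"
  by (auto simp: sderiv_def algebra_simps)

lemma sderiv_sum: "sderiv v (\<Sum>i\<in>I. F i) = (\<Sum>i\<in>I. sderiv v (F i))"
  by (auto simp: sderiv_def ser_sum_apply sum_distrib_left)

lemma sderiv_commute: "sderiv u (sderiv v F) = sderiv v (sderiv u F)"
  by (auto simp: sderiv_def add.commute add.left_commute)

text \<open>Shifting the first index by \<open>unit_idx v\<close> absorbs the derivative into a
  weight \<open>cmp a v\<close> on the splits of \<open>k + unit_idx v\<close>. In the Leibniz rule
  the weights of the two factors then add up to \<open>cmp k v + 1\<close>, the weight in the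
  derivative of the product.\<close>

lemma ser_mult_sderiv_left:
  fixes F :: "'n::finite ser"
  shows "ser_mult (sderiv v F) G k =
    (\<Sum>(a, b)\<in>{(a, b). a + b = k + unit_idx v}. of_nat (cmp a v) * F a * G b)"
proof -
  have "ser_mult (sderiv v F) G k =
     (\<Sum>(a, b)\<in>{(a, b). a + b = k + unit_idx v \<and> cmp a v > 0}. of_nat (cmp a v) * F a * G b)"
    unfolding ser_mult_def
  proof (rule sum.reindex_bij_witness[of _ "\<lambda>(a, b). (a - unit_idx v, b)" "\<lambda>(a, b). (a + unit_idx v, b)"])
    fix x assume "x \<in> {(a, b). a + b = k + unit_idx v \<and> cmp a v > 0}"
    then obtain a b where x: "x = (a, b)" "a + b = k + unit_idx v" "cmp a v > 0" by auto
    obtain c where c: "a = c + unit_idx v" using midx_decomp x(3) by blast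
    have d: "c + unit_idx v - unit_idx v = c" by (rule midx_eqI) auto
    have "c + b = k"
      using x(2) unfolding c by (metis add.commute add.left_commute add_left_cancel)
    then show "(case x of (a, b) \<Rightarrow> (a - unit_idx v, b)) \<in> {(a, b). a + b = k}"
      and "(case (case x of (a, b) \<Rightarrow> (a - unit_idx v, b)) of (a, b) \<Rightarrow> (a + unit_idx v, b)) = x"
      by (simp_all add: x c d)
  next
    fix x assume "x \<in> {(a, b). a + b = k}"
    then obtain a b where x: "x = (a, b)" "a + b = k" by auto
    show "(case (case x of (a, b) \<Rightarrow> (a + unit_idx v, b)) of (a, b) \<Rightarrow> (a - unit_idx v, b)) = x"
      unfolding x by (auto intro!: midx_eqI)
    show "(case x of (a, b) \<Rightarrow> (a + unit_idx v, b)) \<in> {(a, b). a + b = k + unit_idx v \<and> 0 < cmp a v}"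
      using x by (auto simp: algebra_simps)
    show "(case (case x of (a, b) \<Rightarrow> (a + unit_idx v, b)) of (a, b) \<Rightarrow> of_nat (cmp a v) * F a * G b) =
         (case x of (a, b) \<Rightarrow> sderiv v F a * G b)"
      unfolding x by (simp add: sderiv_def)
  qed
  also have "\<dots> = (\<Sum>(a, b)\<in>{(a, b). a + b = k + unit_idx v}. of_nat (cmp a v) * F a * G b)"
    by (rule sum.mono_neutral_left) (auto simp: finite_splits)
  finally show ?thesis .
qed

lemma sderiv_mult:
  fixes F :: "'n::finite ser"
  shows "sderiv v (ser_mult F G) = ser_mult (sderiv v F) G + ser_mult F (sderiv v G)"
proof
  fix k
  have "ser_mult F (sderiv v G) k =
      (\<Sum>(b, a)\<in>{(b, a). b + a = k + unit_idx v}. of_nat (cmp b v) * G b * F a)"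
    by (subst ser_mult_commute, rule ser_mult_sderiv_left)
  also have "\<dots> = (\<Sum>(a, b)\<in>{(a, b). a + b = k + unit_idx v}. of_nat (cmp b v) * F a * G b)"
    by (rule sum.reindex_bij_witness[of _ prod.swap prod.swap]) (auto simp: add.commute)
  finally have 1: "ser_mult F (sderiv v G) k = \<dots>" .
  have "(ser_mult (sderiv v F) G + ser_mult F (sderiv v G)) k =
     (\<Sum>(a, b)\<in>{(a, b). a + b = k + unit_idx v}. of_nat (cmp a v + cmp b v) * (F a * G b))"
    unfolding plus_fun_apply ser_mult_sderiv_left 1 sum.distrib[symmetric]
    by (rule sum.cong) (auto simp: algebra_simps)
  also have "\<dots> = (\<Sum>(a, b)\<in>{(a, b). a + b = k + unit_idx v}. of_nat (cmp k v + 1) * (F a * G b))"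
  proof (rule sum.cong, simp, clarify)
    fix a b :: "'n midx" assume "a + b = k + unit_idx v"
    then have "cmp (a + b) v = cmp (k + unit_idx v) v" by simp
    then have "cmp a v + cmp b v = cmp k v + 1" by simp
    then show "of_nat (cmp a v + cmp b v) * (F a * G b) = of_nat (cmp k v + 1) * (F a * G b)"
      by simp
  qed
  also have "\<dots> = sderiv v (ser_mult F G) k"
    by (simp add: sderiv_def ser_mult_def sum_distrib_left case_prod_beta)
  finally show "sderiv v (ser_mult F G) k = (ser_mult (sderiv v F) G + ser_mult F (sderiv v G)) k" ..
qed

text \<open>Conjugate variables are exchanged by \<open>conj_var\<close>; with the sign \<open>sgn_var\<close> the bracket becomes
  a single sum over all \<open>2n\<close> variables.\<close>

definition conj_var :: "'n + 'n \<Rightarrow> 'n + 'n" where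
  "conj_var = case_sum Inr Inl"

definition sgn_var :: "'n + 'n \<Rightarrow> complex" where
  "sgn_var = case_sum (\<lambda>_. - 1) (\<lambda>_. 1)"

lemma conj_conj_var [simp]: "conj_var (conj_var v) = v"
  by (cases v) (auto simp: conj_var_def)

lemma sgn_conj_var [simp]: "sgn_var (conj_var v) = - sgn_var v"
  by (cases v) (auto simp: conj_var_def sgn_var_def)

lemma norm_sgn_var [simp]: "cmod (sgn_var v) = 1"
  by (cases v) (auto simp: sgn_var_def)

lemma sgn_var_nonzero [simp]: "sgn_var v \<noteq> 0"
  by (cases v) (auto simp: sgn_var_def)

lemma bij_conj_var: "bij conj_var"
  by (metis bijI' conj_conj_var)

lemma sum_conj_var: "(\<Sum>v\<in>UNIV. f (conj_var v)) = (\<Sum>v\<in>UNIV. f (v :: 'n::finite + 'n))"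
  by (rule sum.reindex_bij_betw) (use bij_conj_var in \<open>simp add: bij_def bij_betw_def\<close>)

section \<open>Algebraic laws of the formal Poisson bracket\<close>

lemma ser_bracket_eq:
  "ser_bracket F G = (\<Sum>v\<in>UNIV. sscale (\<i> * sgn_var v) (ser_mult (sderiv v F) (sderiv (conj_var v) G)))"
  by (rule ext) (simp add: ser_bracket_def ser_sum_apply sum_UNIV_Plus conj_var_def sgn_var_def
      sderiv_simps sum_distrib_left sum_subtractf sum_negf algebra_simps)

lemma ser_bracket_add: "ser_bracket F (G + H) = ser_bracket F G + ser_bracket F H"
  by (simp add: ser_bracket_eq sderiv_add ser.distrib_left sscale_add sum.distrib)

lemma ser_bracket_add_left: "ser_bracket (F + G) H = ser_bracket F H + ser_bracket G H"
  by (simp add: ser_bracket_eq sderiv_add ser.distrib_right sscale_add sum.distrib)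

lemma ser_bracket_scale: "ser_bracket F (sscale c G) = sscale c (ser_bracket F G)"
  by (simp add: ser_bracket_eq sderiv_scale ser_mult_scale sscale_sum mult.commute)

lemma ser_bracket_scale_left: "ser_bracket (sscale c F) G = sscale c (ser_bracket F G)"
  by (simp add: ser_bracket_eq sderiv_scale ser_mult_scale_left sscale_sum mult.commute)

lemma ser_bracket_minus: "ser_bracket F (G - H) = ser_bracket F G - ser_bracket F H"
  by (metis add_diff_cancel diff_add_cancel ser_bracket_add)

lemma ser_bracket_uminus: "ser_bracket F (- G) = - ser_bracket F G"
  by (metis sscale_minus_one ser_bracket_scale)

lemma ser_bracket_uminus_left: "ser_bracket (- F) G = - ser_bracket F G"
  by (metis sscale_minus_one ser_bracket_scale_left)

lemma ser_bracket_zero [simp]: "ser_bracket F 0 = 0" "ser_bracket 0 F = 0"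
  by (metis sscale_zero(2) ser_bracket_scale, metis sscale_zero(2) ser_bracket_scale_left)

lemma ser_bracket_commute: "ser_bracket F G = - ser_bracket G F"
proof -
  have "ser_bracket G F =
    (\<Sum>v\<in>UNIV. sscale (\<i> * sgn_var (conj_var v)) (ser_mult (sderiv (conj_var v) G) (sderiv (conj_var (conj_var v)) F)))"
    unfolding ser_bracket_eq by (subst sum_conj_var[symmetric]) simp
  also have "\<dots> = - ser_bracket F G"
    unfolding ser_bracket_eq sum_negf[symmetric]
    by (rule sum.cong) (auto simp: ser.mult.commute)
  finally show ?thesis by simp
qed

lemma ser_bracket_mult:
  "ser_bracket F (ser_mult G H) = ser_mult (ser_bracket F G) H + ser_mult G (ser_bracket F H)"
  unfolding ser_bracket_eq sderiv_mult
  by (simp add: ser_mult_sum ser_mult_sum_left ser.distrib_left sscale_add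
      ser_mult_scale ser_mult_scale_left sum.distrib ser.mult.assoc ser.mult.left_commute)

lemma ser_bracket_sderiv:
  "sderiv v (ser_bracket F G) = ser_bracket (sderiv v F) G + ser_bracket F (sderiv v G)"
  by (simp add: ser_bracket_eq sderiv_sum sderiv_scale sderiv_mult sscale_add sum.distrib
      sderiv_commute[of v])

text \<open>Each nested bracket expands into two double sums, with a second derivative on one inner
  factor; \<open>e u v\<close> is the product of the two prefactors. Exchanging indices or passing
  to conjugate ones shows that the second derivatives of \<open>F\<close> cancel, while those of
  \<open>G\<close> and of \<open>H\<close> agree on both sides.\<close>

lemma ser_jacobi:
  "ser_bracket F (ser_bracket G H) = ser_bracket (ser_bracket F G) H + ser_bracket G (ser_bracket F H)"
proof -
  define D where "D = (sderiv :: 'a + 'a \<Rightarrow> 'a ser \<Rightarrow> 'a ser)"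
  define e where "e u v = - (sgn_var u * sgn_var v)" for u v :: "'a + 'a"
  let ?c = "conj_var"
  have 1: "ser_bracket A (ser_bracket B C) =
     (\<Sum>u\<in>UNIV. \<Sum>v\<in>UNIV. sscale (e u v) (ser_mult (D u A) (ser_mult (D v (D (?c u) B)) (D (?c v) C)))) +
     (\<Sum>u\<in>UNIV. \<Sum>v\<in>UNIV. sscale (e u v) (ser_mult (D u A) (ser_mult (D v B) (D (?c v) (D (?c u) C)))))" for A B C
    unfolding ser_bracket_eq[of A] ser_bracket_sderiv
    unfolding ser_bracket_eq[of _ C] ser_bracket_eq[of _ "sderiv _ C"]
    by (simp add: D_def e_def ser.distrib_left ser_mult_sum ser_mult_scale sscale_add
        sscale_sum sum.distrib algebra_simps)
  have eq: "ser_bracket (ser_bracket F G) H = ser_bracket H (ser_bracket G F)"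
    by (metis ser_bracket_commute ser_bracket_uminus minus_minus)
  have sw: "(\<Sum>u\<in>UNIV. \<Sum>v\<in>UNIV. f u v) = (\<Sum>u\<in>UNIV. \<Sum>v\<in>UNIV. f (?c v) (?c u))"
    for f :: "'a + 'a \<Rightarrow> 'a + 'a \<Rightarrow> 'a ser"
    by (subst sum.swap, subst sum_conj_var[symmetric], rule sum.cong, simp,
        subst sum_conj_var[symmetric], simp)
  have ee: "e (?c v) (?c u) = e u v" for u v by (simp add: e_def mult.commute)
  have e1: "e (?c u) v = - e u v" "e u (?c v) = - e u v" for u v by (simp_all add: e_def)
  have eqH: "ser_bracket H (ser_bracket G F) =
     (\<Sum>u\<in>UNIV. \<Sum>v\<in>UNIV. sscale (e u v) (ser_mult (D (?c v) H) (ser_mult (D (?c u) (D v G)) (D u F)))) +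
     (\<Sum>u\<in>UNIV. \<Sum>v\<in>UNIV. sscale (e u v) (ser_mult (D (?c v) H) (ser_mult (D (?c u) G) (D u (D v F)))))"
    unfolding 1[of H] by (subst (1 2) sw) (simp add: ee)
  have s2: "(\<Sum>u\<in>UNIV. \<Sum>v\<in>UNIV. f u v) = (\<Sum>u\<in>UNIV. \<Sum>v\<in>UNIV. f (?c v) u)"
    for f :: "'a + 'a \<Rightarrow> 'a + 'a \<Rightarrow> 'a ser"
    by (subst sum.swap, rule sum.cong, simp, subst sum_conj_var[symmetric], simp)
  have ec: "e v u = e u v" for u v by (simp add: e_def)
  have eqG1: "(\<Sum>u\<in>UNIV. \<Sum>v\<in>UNIV. sscale (e u v) (ser_mult (D u G) (ser_mult (D v (D (?c u) F)) (D (?c v) H)))) =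
     - (\<Sum>u\<in>UNIV. \<Sum>v\<in>UNIV. sscale (e u v) (ser_mult (D (?c v) H) (ser_mult (D (?c u) G) (D u (D v F)))))"
    by (subst s2, subst sum.swap)
       (simp add: e1 ec sum_negf[symmetric] ser.mult_ac D_def sderiv_commute sscale_def fun_eq_iff ser_sum_apply)
  have eqG2: "(\<Sum>u\<in>UNIV. \<Sum>v\<in>UNIV. sscale (e u v) (ser_mult (D u G) (ser_mult (D v F) (D (?c v) (D (?c u) H))))) =
     (\<Sum>u\<in>UNIV. \<Sum>v\<in>UNIV. sscale (e u v) (ser_mult (D u F) (ser_mult (D v G) (D (?c v) (D (?c u) H)))))"
    by (subst sum.swap) (simp add: ec ser.mult_ac D_def sderiv_commute)
  have eqH1: "(\<Sum>u\<in>UNIV. \<Sum>v\<in>UNIV. sscale (e u v) (ser_mult (D (?c v) H) (ser_mult (D (?c u) (D v G)) (D u F)))) =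
     (\<Sum>u\<in>UNIV. \<Sum>v\<in>UNIV. sscale (e u v) (ser_mult (D u F) (ser_mult (D v (D (?c u) G)) (D (?c v) H))))"
    by (simp add: ser.mult_ac D_def sderiv_commute)
  show ?thesis
    unfolding eq eqH unfolding 1[of F] 1[of G] eqG1 eqG2 eqH1 by simp
qed


section \<open>Orders of vanishing\<close>

lemma O_ord_le: "O_ord a F \<Longrightarrow> b \<le> a \<Longrightarrow> O_ord b F"
  by (auto simp: O_ord_def)

lemma O_ord_D: "O_ord a F \<Longrightarrow> deg k < a \<Longrightarrow> F k = 0"
  unfolding O_ord_def by blast

lemma O_ord_0 [simp]: "O_ord 0 F" "O_ord a 0"
  by (auto simp: O_ord_def)

lemma O_ord_add: "O_ord a F \<Longrightarrow> O_ord a G \<Longrightarrow> O_ord a (F + G)"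
  and O_ord_diff: "O_ord a F \<Longrightarrow> O_ord a G \<Longrightarrow> O_ord a (F - G)"
  and O_ord_uminus: "O_ord a F \<Longrightarrow> O_ord a (- F)"
  and O_ord_sscale: "O_ord a F \<Longrightarrow> O_ord a (sscale c F)"
  by (auto simp: O_ord_def)

lemma O_ord_sum: "(\<And>i. i \<in> I \<Longrightarrow> O_ord a (F i)) \<Longrightarrow> O_ord a (\<Sum>i\<in>I. F i)"
  by (auto simp: O_ord_def ser_sum_apply)

lemma O_ord_smono: "a \<le> deg k \<Longrightarrow> O_ord a (smono k)"
  by (auto simp: O_ord_def smono_def)

lemma O_ord_mult:
  assumes "O_ord a F" "O_ord b G" shows "O_ord (a + b) (ser_mult F G)"
  unfolding O_ord_def ser_mult_def
proof (intro allI impI sum.neutral ballI)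
  fix k and x :: "'a midx \<times> 'a midx" assume k: "deg k < a + b" and x: "x \<in> {(p, q). p + q = k}"
  obtain p q where pq: "x = (p, q)" by (cases x)
  with k x have "deg (p + q) < a + b" by blast
  then have "deg p < a \<or> deg q < b" by auto
  then show "(case x of (p, q) \<Rightarrow> F p * G q) = 0" using assms unfolding pq by (auto dest: O_ord_D)
qed

lemma O_ord_sderiv: "O_ord a F \<Longrightarrow> O_ord (a - 1) (sderiv v F)"
  unfolding O_ord_def[of "a - 1"] sderiv_def by (auto dest!: O_ord_D[of a F "_ + unit_idx v"])

lemma O_ord_bracket:
  assumes "O_ord a F" "O_ord b G" shows "O_ord ((a - 1) + (b - 1)) (ser_bracket F G)"
  unfolding ser_bracket_eq
  by (intro O_ord_sum O_ord_sscale O_ord_mult O_ord_sderiv assms)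

lemma O_ord_bracket3: "O_ord 3 F \<Longrightarrow> O_ord b G \<Longrightarrow> O_ord (b + 1) (ser_bracket F G)"
  by (rule O_ord_le[OF O_ord_bracket]) auto

lemma O_ord_bracket2:
  "O_ord 2 F \<Longrightarrow> O_ord b G \<Longrightarrow> O_ord b (ser_bracket F G)"
  by (rule O_ord_le[OF O_ord_bracket]) auto

lemma F_diamond_iff: "F \<in> F_diamond \<longleftrightarrow> O_ord 3 F"
  by (auto simp: F_diamond_def O_ord_def)

lemma O_ord_H2: "O_ord 2 (H2 \<omega> :: 'n::finite ser)"
proof -
  have "deg (axis j (Suc 0), axis j (Suc 0)) = 2" for j :: 'n
    by (simp add: deg_def axis_def sum.distrib)
  then show ?thesis
    by (auto simp: O_ord_def H2_def intro!: sum.neutral)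
qed

lemma O_ord_xi: "O_ord 3 (xi \<omega> H)"
  by (auto simp: O_ord_def xi_def)


section \<open>Brackets with coordinates and with the quadratic part\<close>

lemma sderiv_smono_zero [simp]: "sderiv v (smono 0) = 0"
proof
  fix k :: "'a midx"
  have "k + unit_idx v \<noteq> 0" by (metis deg_add deg_unit deg_zero add_is_0 one_neq_zero)
  then show "sderiv v (smono 0) k = 0 k" by (simp add: sderiv_def smono_def)
qed

lemma unit_idx_inj [simp]: "unit_idx u = unit_idx v \<longleftrightarrow> u = v"
  by (metis cmp_unit zero_neq_one)

lemma sderiv_smono_unit: "sderiv v (smono (unit_idx u)) = (if u = v then smono 0 else 0)"
proof
  fix k :: "'a midx"
  have "k + unit_idx v = unit_idx u \<longleftrightarrow> k = 0 \<and> u = v"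
  proof
    assume a: "k + unit_idx v = unit_idx u"
    then have "deg k + 1 = 1" by (metis deg_add deg_unit)
    then show "k = 0 \<and> u = v" using a by (simp add: deg_eq_0_iff)
  qed auto
  then show "sderiv v (smono (unit_idx u)) k = (if u = v then smono 0 else 0) k"
    by (auto simp: sderiv_def smono_def)
qed

lemma ser_bracket_sum: "ser_bracket F (\<Sum>i\<in>I. G i) = (\<Sum>i\<in>I. ser_bracket F (G i))"
  by (induction I rule: infinite_finite_induct)
     (simp_all only: sum.infinite sum.empty sum.insert ser_bracket_add ser_bracket_zero not_False_eq_True)

text \<open>Brackets with coordinates return all partial derivatives, so a statement about the
  operator \<open>{F, -}\<close> can be read back as one about the coefficients of
  \<open>F\<close>.\<close>

lemma ser_bracket_coord:
  "ser_bracket F (smono (unit_idx u)) = sscale (\<i> * sgn_var (conj_var u)) (sderiv (conj_var u) F)"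
proof -
  have "ser_bracket F (smono (unit_idx u)) =
    (\<Sum>v\<in>UNIV. if v = conj_var u then sscale (\<i> * sgn_var v) (sderiv v F) else 0)"
    unfolding ser_bracket_eq
  proof (rule sum.cong, simp)
    fix v
    have "u = conj_var v \<longleftrightarrow> v = conj_var u" by auto
    then show "sscale (\<i> * sgn_var v) (ser_mult (sderiv v F) (sderiv (conj_var v) (smono (unit_idx u)))) =
      (if v = conj_var u then sscale (\<i> * sgn_var v) (sderiv v F) else 0)"
      by (simp add: sderiv_smono_unit ser_mult_one[unfolded ser_mult_commute[of "smono 0"]])
  qed
  then show ?thesis by (simp only: sum.delta finite UNIV_I if_True)
qed

lemma ser_mult_sderiv_coord:
  "ser_mult (sderiv v F) (smono (unit_idx v)) k = of_nat (cmp k v) * F k"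
proof -
  have "ser_mult (sderiv v F) (smono (unit_idx v)) k =
    (\<Sum>(a, b)\<in>{(k, unit_idx v)}. of_nat (cmp a v) * F a * smono (unit_idx v) b)"
    unfolding ser_mult_sderiv_left
  proof (rule sum.mono_neutral_right[OF finite_splits])
    show "\<forall>x\<in>{(a, b). a + b = k + unit_idx v} - {(k, unit_idx v)}.
      (case x of (a, b) \<Rightarrow> of_nat (cmp a v) * F a * smono (unit_idx v) b) = 0"
    proof
      fix x assume x: "x \<in> {(a, b). a + b = k + unit_idx v} - {(k, unit_idx v)}"
      obtain a b where ab: "x = (a, b)" by (cases x)
      with x have "a + b = k + unit_idx v" "b = unit_idx v \<Longrightarrow> a \<noteq> k" by blast+
      then have "b \<noteq> unit_idx v" by (metis add_right_cancel)
      then show "(case x of (a, b) \<Rightarrow> of_nat (cmp a v) * F a * smono (unit_idx v) b) = 0"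
        by (simp add: ab smono_def)
    qed
  qed auto
  then show ?thesis by (simp add: smono_def)
qed

definition var_index :: "'n + 'n \<Rightarrow> 'n" where "var_index = case_sum id id"

lemma var_index_conj [simp]: "var_index (conj_var v) = var_index v"
  by (cases v) (auto simp: var_index_def conj_var_def)

lemma H2_eq: "H2 \<omega> = (\<Sum>j\<in>UNIV. sscale (of_real (\<omega> $ j)) (ser_mult (smono (unit_idx (Inl j))) (smono (unit_idx (Inr j)))))"
  unfolding smono_add
  by (rule ext) (simp add: H2_def ser_sum_apply unit_idx_simps smono_def if_distrib cong: if_cong)

lemma sderiv_H2: "sderiv v (H2 \<omega>) = sscale (of_real (\<omega> $ var_index v)) (smono (unit_idx (conj_var v)))"
proof -
  have "sderiv v (H2 \<omega>) = (\<Sum>j\<in>UNIV. if j = var_index v then sscale (of_real (\<omega> $ j)) (smono (unit_idx (conj_var v))) else 0)"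
    unfolding H2_eq sderiv_sum sderiv_scale sderiv_mult sderiv_smono_unit
    by (rule sum.cong, simp, cases v)
       (auto simp: ser_mult_one ser_mult_one[unfolded ser_mult_commute[of "smono 0"]] var_index_def conj_var_def
          ser.mult_zero_left ser.mult_zero_right)
  then show ?thesis by (simp only: sum.delta finite UNIV_I if_True)
qed

lemma ser_bracket_H2_right: "ser_bracket F (H2 \<omega>) k = \<i> * of_real (freq \<omega> (kprime k)) * F k"
proof -
  have "ser_bracket F (H2 \<omega>) k = \<i> * (\<Sum>v\<in>UNIV. sgn_var v * of_real (\<omega> $ var_index v) * of_nat (cmp k v)) * F k"
    by (simp add: ser_bracket_eq ser_sum_apply sderiv_H2 ser_mult_scale ser_mult_sderiv_coord
        sum_distrib_left sum_distrib_right algebra_simps)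
  also have "(\<Sum>v\<in>UNIV. sgn_var v * of_real (\<omega> $ var_index v) * of_nat (cmp k v)) = of_real (freq \<omega> (kprime k))"
    by (simp add: sum_UNIV_Plus sgn_var_def var_index_def freq_def kprime_def sum_subtractf sum_negf algebra_simps)
  finally show ?thesis .
qed

text \<open>Eigenvalue of \<open>{H2, -}\<close> on the monomial with index \<open>k\<close>; the
  sign is the one for \<open>H2\<close> in the first slot.\<close>

definition eigval :: "real ^ 'n::finite \<Rightarrow> 'n midx \<Rightarrow> complex" where
  "eigval \<omega> k = - \<i> * of_real (freq \<omega> (kprime k))"

lemma ser_bracket_H2: "ser_bracket (H2 \<omega>) F k = eigval \<omega> k * F k"
  by (subst ser_bracket_commute) (simp add: ser_bracket_H2_right eigval_def)

lemma kprime_add: "kprime (k + l) = kprime k + kprime l"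
  by (simp add: kprime_def vec_eq_iff)

lemma freq_add: "freq \<omega> (p + q) = freq \<omega> p + freq \<omega> q"
  by (simp add: freq_def sum.distrib algebra_simps)

lemma eigval_add: "eigval \<omega> (k + l) = eigval \<omega> k + eigval \<omega> l"
  by (simp add: eigval_def kprime_add freq_add algebra_simps)

lemma eigval_eq_0_iff: "eigval \<omega> k = 0 \<longleftrightarrow> kprime k \<in> res_lattice \<omega>"
  by (simp add: eigval_def res_lattice_def)

lemma eigval_unit_conj: "eigval \<omega> (unit_idx (conj_var v)) = - eigval \<omega> (unit_idx v)"
proof -
  have "kprime (unit_idx (conj_var v)) + kprime (unit_idx v) = 0"
    by (cases v) (auto simp: conj_var_def unit_idx_def kprime_def vec_eq_iff)
  moreover have "freq \<omega> 0 = 0" by (simp add: freq_def)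
  ultimately have "eigval \<omega> (unit_idx (conj_var v) + unit_idx v) = 0"
    by (simp add: eigval_def kprime_add)
  then show ?thesis by (simp add: eigval_add eq_neg_iff_add_eq_0)
qed


section \<open>The Lie series\<close>

definition lie_pow :: "'n::finite ser \<Rightarrow> nat \<Rightarrow> 'n ser \<Rightarrow> 'n ser" where
  "lie_pow X m = ser_bracket X ^^ m"

definition lie_term :: "'n::finite ser \<Rightarrow> nat \<Rightarrow> 'n ser \<Rightarrow> 'n ser" where
  "lie_term X m F = sscale (1 / fact m) (lie_pow X m F)"

text \<open>Cutting the sum at \<open>deg k\<close> is exact for \<open>X\<close> of order 3: every
  bracket with \<open>X\<close> raises the order by at least one, so later terms have no coefficient
  at \<open>k\<close>. The exponential is thus defined without any convergence.\<close>

definition lie_exp :: "'n::finite ser \<Rightarrow> 'n ser \<Rightarrow> 'n ser" where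
  "lie_exp X F k = (\<Sum>m\<le>deg k. lie_term X m F k)"

lemma lie_pow_simps [simp]: "lie_pow X 0 F = F" "lie_pow X (Suc m) F = ser_bracket X (lie_pow X m F)"
  by (simp_all add: lie_pow_def)

lemma lie_pow_Suc2: "lie_pow X (Suc m) F = lie_pow X m (ser_bracket X F)"
  by (simp add: lie_pow_def funpow_swap1)

lemma lie_pow_add: "lie_pow X (m + n) F = lie_pow X m (lie_pow X n F)"
  by (simp add: lie_pow_def funpow_add)

lemma lie_pow_plus: "lie_pow X m (F + G) = lie_pow X m F + lie_pow X m G"
  by (induction m) (simp_all only: ser_bracket_add lie_pow_simps)

lemma lie_pow_sscale: "lie_pow X m (sscale c F) = sscale c (lie_pow X m F)"
  by (induction m) (simp_all only: ser_bracket_scale lie_pow_simps)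

lemma lie_pow_zero [simp]: "lie_pow X m 0 = 0"
  by (metis lie_pow_sscale sscale_zero(2))

lemma lie_pow_sum: "lie_pow X m (\<Sum>i\<in>I. F i) = (\<Sum>i\<in>I. lie_pow X m (F i))"
  by (induction I rule: infinite_finite_induct)
     (simp_all only: sum.infinite sum.empty sum.insert lie_pow_plus lie_pow_zero not_False_eq_True)

lemma O_ord_lie_pow: "O_ord 3 X \<Longrightarrow> O_ord a F \<Longrightarrow> O_ord (a + m) (lie_pow X m F)"
proof (induction m)
  case (Suc m)
  then show ?case using O_ord_bracket3[of X "a + m"] by simp
qed simp

text \<open>Each bracket with a series of order \<open>s\<close> raises the order by
  \<open>s - 2\<close>; one bracket applied to order \<open>s\<close> gives
  \<open>2 * s - 2\<close>, the gain of a Newton step.\<close>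

lemma O_ord_lie_pow_gen:
  "O_ord s X \<Longrightarrow> 2 \<le> s \<Longrightarrow> O_ord a F \<Longrightarrow> 1 \<le> a \<Longrightarrow> O_ord (a + m * (s - 2)) (lie_pow X m F)"
proof (induction m)
  case (Suc m)
  then have "O_ord (s - 1 + (a + m * (s - 2) - 1)) (lie_pow X (Suc m) F)"
    using O_ord_bracket[of s X "a + m * (s - 2)"] by simp
  then show ?case by (rule O_ord_le) (use Suc.prems in auto)
qed auto

lemma O_ord_lie_term: "O_ord 3 X \<Longrightarrow> O_ord a F \<Longrightarrow> O_ord (a + m) (lie_term X m F)"
  by (simp add: lie_term_def O_ord_lie_pow O_ord_sscale)

lemma lie_term_add: "lie_term X m (F + G) = lie_term X m F + lie_term X m G"
  by (simp add: lie_term_def lie_pow_plus sscale_add)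

lemma lie_term_sscale: "lie_term X m (sscale c F) = sscale c (lie_term X m F)"
  by (simp add: lie_term_def lie_pow_sscale mult.commute)

lemma lie_term_sum: "lie_term X m (\<Sum>i\<in>I. F i) = (\<Sum>i\<in>I. lie_term X m (F i))"
  unfolding lie_term_def lie_pow_sum by (rule sscale_sum)

lemma lie_term_0 [simp]: "lie_term X 0 F = F"
  by (simp add: lie_term_def)

lemma lie_term_Suc: "sscale (of_nat (Suc m)) (lie_term X (Suc m) F) = ser_bracket X (lie_term X m F)"
proof -
  have "(1 + of_nat m) / ((1 + of_nat m) * fact m) = (1 / fact m :: complex)"
    using of_nat_neq_0[of m, where ?'a = complex] by (simp add: divide_simps)
  then show ?thesis by (simp add: lie_term_def ser_bracket_scale)
qed

lemma lie_exp_trunc: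
  assumes "O_ord 3 X" "deg k \<le> M"
  shows "lie_exp X F k = (\<Sum>m\<le>M. lie_term X m F k)"
  unfolding lie_exp_def
  by (rule sum.mono_neutral_left)
     (use assms in \<open>auto intro!: O_ord_D[OF O_ord_lie_term[OF assms(1), of 0]]\<close>)

lemma lie_exp_add: "lie_exp X (F + G) = lie_exp X F + lie_exp X G"
  by (rule ext) (simp add: lie_exp_def lie_term_add sum.distrib)

lemma lie_exp_sscale: "lie_exp X (sscale c F) = sscale c (lie_exp X F)"
  by (rule ext) (simp add: lie_exp_def lie_term_sscale sum_distrib_left)

lemma lie_exp_diff: "lie_exp X (F - G) = lie_exp X F - lie_exp X G"
  by (metis add_diff_cancel diff_add_cancel lie_exp_add)

lemma O_ord_lie_exp: "O_ord 3 X \<Longrightarrow> O_ord a F \<Longrightarrow> O_ord a (lie_exp X F)"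
  unfolding O_ord_def[of a "lie_exp X F"] lie_exp_def
  by (intro allI impI sum.neutral ballI O_ord_D[OF O_ord_lie_term]) auto

lemma lie_exp_trunc_ord:
  assumes "O_ord 3 X" shows "O_ord (Suc M) (lie_exp X F - (\<Sum>m\<le>M. lie_term X m F))"
  unfolding O_ord_def by (simp add: lie_exp_trunc[OF assms, of _ M] ser_sum_apply)

lemma sscale_cancel: "sscale c F = sscale c G \<Longrightarrow> c \<noteq> 0 \<Longrightarrow> F = G"
  by (metis left_inverse sscale_one sscale_sscale)

text \<open>The exponential of a derivation respects every bilinear operation that it derives:
  Leibniz rule for the terms divided by factorials, then a Cauchy product. The abstract
  \<open>B\<close> serves the product and the bracket alike; \<open>deg k + 2\<close> in the
  locality assumption fits the bracket, whose coefficient at \<open>k\<close> sees degrees up to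
  \<open>deg k + 1\<close> of each factor.\<close>

lemma lie_exp_bilinear:
  fixes X :: "'n::finite ser" and B :: "'n ser \<Rightarrow> 'n ser \<Rightarrow> 'n ser"
  assumes X: "O_ord 3 X"
    and add: "\<And>F G H. B F (G + H) = B F G + B F H" "\<And>F G H. B (F + G) H = B F H + B G H"
    and sc: "\<And>c F G. B F (sscale c G) = sscale c (B F G)" "\<And>c F G. B (sscale c F) G = sscale c (B F G)"
    and der: "\<And>F G. ser_bracket X (B F G) = B (ser_bracket X F) G + B F (ser_bracket X G)"
    and loc: "\<And>k F G. O_ord (deg k + 2) F \<Longrightarrow> B F G k = 0" "\<And>k F G. O_ord (deg k + 2) G \<Longrightarrow> B F G k = 0"
  shows "lie_exp X (B F G) = B (lie_exp X F) (lie_exp X G)"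
proof
  fix k :: "'n midx"
  let ?P = "lie_term X"
  define M where "M = deg k + 2"
  have zero: "B 0 G = 0" "B F 0 = 0" for F G
    by (metis sc(2) sscale_zero(2), metis sc(1) sscale_zero(2))
  have Bsum: "B F (\<Sum>i\<in>I. G i) = (\<Sum>i\<in>I. B F (G i))" "B (\<Sum>i\<in>I. G i) F = (\<Sum>i\<in>I. B (G i) F)"
    for F G and I :: "nat set"
    by (induction I rule: infinite_finite_induct)
       (simp_all only: sum.infinite sum.empty sum.insert add zero not_False_eq_True)
  have leib: "?P m (B F G) = (\<Sum>i\<le>m. B (?P i F) (?P (m - i) G))" for m
  proof (induction m)
    case (Suc m)
    let ?a = "\<lambda>i j. B (?P i F) (?P j G)"
    have "sscale (of_nat (Suc m)) (?P (Suc m) (B F G)) = (\<Sum>i\<le>m. ser_bracket X (?a i (m - i)))"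
      unfolding lie_term_Suc Suc by (rule ser_bracket_sum)
    also have "\<dots> = (\<Sum>i\<le>m. sscale (of_nat (Suc i)) (?a (Suc i) (m - i)) + sscale (of_nat (Suc m - i)) (?a i (Suc m - i)))"
      by (intro sum.cong refl)
         (simp only: der lie_term_Suc[symmetric] sc Suc_diff_le atMost_iff)
    also have "\<dots> = (\<Sum>i\<le>m. sscale (of_nat (Suc i)) (?a (Suc i) (Suc m - Suc i))) +
        (\<Sum>i\<le>m. sscale (of_nat (Suc m - i)) (?a i (Suc m - i)))"
      by (simp add: sum.distrib)
    also have "(\<Sum>i\<le>m. sscale (of_nat (Suc i)) (?a (Suc i) (Suc m - Suc i))) =
        (\<Sum>i\<le>Suc m. sscale (of_nat i) (?a i (Suc m - i)))"
      by (subst sum.atMost_Suc_shift) simp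
    also have "(\<Sum>i\<le>m. sscale (of_nat (Suc m - i)) (?a i (Suc m - i))) =
        (\<Sum>i\<le>Suc m. sscale (of_nat (Suc m - i)) (?a i (Suc m - i)))"
      by simp
    also have "(\<Sum>i\<le>Suc m. sscale (of_nat i) (?a i (Suc m - i))) + \<dots> =
        (\<Sum>i\<le>Suc m. sscale (of_nat (Suc m)) (?a i (Suc m - i)))"
      unfolding sum.distrib[symmetric] sscale_add_left[symmetric]
      by (intro sum.cong refl arg_cong2[of _ _ _ _ sscale]) (simp flip: of_nat_add)
    also have "\<dots> = sscale (of_nat (Suc m)) (\<Sum>i\<le>Suc m. ?a i (Suc m - i))"
      by (simp only: sscale_sum)
    finally show ?case by (rule sscale_cancel) (simp del: of_nat_Suc)
  qed simp
  have vanish: "B (?P i F) (?P j G) k = 0" if "i > M \<or> j > M" for i j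
    using that loc O_ord_le[OF O_ord_lie_term[OF X O_ord_0(1)]] unfolding M_def
    by (metis add_0 less_imp_le)
  \<comment> \<open>The triangle \<open>i + j \<le> 2 * M\<close> contains the square
    \<open>i, j \<le> M\<close>, and locality annihilates every pair outside the square.\<close>
  have "lie_exp X (B F G) k = (\<Sum>m\<le>2 * M. \<Sum>i\<le>m. B (?P i F) (?P (m - i) G) k)"
    by (subst lie_exp_trunc[OF X, of _ "2 * M"]) (auto simp: M_def leib ser_sum_apply)
  also have "\<dots> = (\<Sum>(i, j)\<in>{(i, j). i + j \<le> 2 * M}. B (?P i F) (?P j G) k)"
    by (rule sum.triangle_reindex_eq[symmetric])
  also have "\<dots> = (\<Sum>(i, j)\<in>{..M} \<times> {..M}. B (?P i F) (?P j G) k)"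
  proof (rule sum.mono_neutral_right)
    show "finite {(i, j). i + j \<le> 2 * M}"
      by (rule finite_subset[of _ "{..2*M} \<times> {..2*M}"]) auto
  qed (use vanish in \<open>auto, meson not_le_imp_less, meson not_le_imp_less\<close>)
  also have "\<dots> = B (\<Sum>i\<le>M. ?P i F) (\<Sum>j\<le>M. ?P j G) k"
    unfolding Bsum ser_sum_apply by (subst sum.swap) (rule sum.cartesian_product[symmetric])
  also have "\<dots> = B (lie_exp X F) (lie_exp X G) k"
  proof -
    let ?F = "\<Sum>i\<le>M. ?P i F" and ?G = "\<Sum>i\<le>M. ?P i G"
    have "lie_exp X F = ?F + (lie_exp X F - ?F)" "lie_exp X G = ?G + (lie_exp X G - ?G)" by auto
    then have "B (lie_exp X F) (lie_exp X G) k = B (?F + (lie_exp X F - ?F)) (?G + (lie_exp X G - ?G)) k"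
      by simp
    also have "\<dots> = B ?F ?G k"
      using lie_exp_trunc_ord[OF X, of M F] lie_exp_trunc_ord[OF X, of M G] loc
      by (simp only: add plus_fun_apply) (simp add: M_def O_ord_le)
    finally show ?thesis by simp
  qed
  finally show "lie_exp X (B F G) k = B (lie_exp X F) (lie_exp X G) k" .
qed

lemma lie_exp_mult:
  assumes "O_ord 3 X" shows "lie_exp X (ser_mult F G) = ser_mult (lie_exp X F) (lie_exp X G)"
proof (rule lie_exp_bilinear[OF assms])
  show "ser_mult F G k = 0" if "O_ord (deg k + 2) F" for k and F G :: "'a ser"
    using O_ord_mult[OF that, of 0 G] by (auto intro: O_ord_D)
  show "ser_mult F G k = 0" if "O_ord (deg k + 2) G" for k and F G :: "'a ser"
    using O_ord_mult[OF _ that, of 0 F] by (auto intro: O_ord_D)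
qed (simp_all only: ser.distrib_left ser.distrib_right ser_mult_scale ser_mult_scale_left ser_bracket_mult)

lemma lie_exp_bracket:
  assumes "O_ord 3 X" shows "lie_exp X (ser_bracket F G) = ser_bracket (lie_exp X F) (lie_exp X G)"
proof (rule lie_exp_bilinear[OF assms])
  show "ser_bracket F G k = 0" if "O_ord (deg k + 2) F" for k and F G :: "'a ser"
    using O_ord_bracket[OF that, of 0 G] by (auto intro: O_ord_D)
  show "ser_bracket F G k = 0" if "O_ord (deg k + 2) G" for k and F G :: "'a ser"
    using O_ord_bracket[OF _ that, of 0 F] by (auto intro: O_ord_D)
qed (rule ser_bracket_add ser_bracket_add_left ser_bracket_scale ser_bracket_scale_left ser_jacobi)+

lemma lie_exp_one: "lie_exp X (smono 0) = smono 0"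
proof -
  have "ser_bracket X (smono 0) = 0"
    by (simp add: ser_bracket_eq ser.mult_zero_right)
  then have "lie_pow X (Suc m) (smono 0) = 0" for m
    by (simp only: lie_pow_Suc2 lie_pow_zero)
  then have "lie_term X m (smono 0) = (if m = 0 then smono 0 else 0)" for m
    by (cases m) (simp_all add: lie_term_def del: lie_pow_simps(2))
  then show ?thesis by (auto simp: lie_exp_def fun_eq_iff if_distribR sum.delta cong: if_cong)
qed

text \<open>Grouping the double series by \<open>m = i + j\<close> leaves an alternating sum of
  binomial coefficients in front of \<open>lie_pow X m F\<close>, which vanishes unless
  \<open>m = 0\<close>.\<close>

lemma lie_exp_inverse:
  fixes X :: "'n::finite ser"
  assumes X: "O_ord 3 X" shows "lie_exp (- X) (lie_exp X F) = F"
proof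
  fix k :: "'n midx"
  define M where "M = deg k"
  have X': "O_ord 3 (- X)" using X by (rule O_ord_uminus)
  have neg: "lie_pow (- X) m F = sscale ((-1) ^ m) (lie_pow X m F)" for m F
  proof (induction m)
    case (Suc m)
    have "lie_pow (- X) (Suc m) F = - sscale ((- 1) ^ m) (ser_bracket X (lie_pow X m F))"
      unfolding lie_pow_simps Suc ser_bracket_uminus_left ser_bracket_scale
      by (rule ext) simp
    also have "\<dots> = sscale ((- 1) ^ Suc m) (lie_pow X (Suc m) F)"
      by (simp only: sscale_minus_one[symmetric] sscale_sscale lie_pow_simps power_Suc)
    finally show ?case .
  qed simp
  have tk: "lie_term (- X) i (lie_exp X F) k = (\<Sum>j\<le>M. lie_term (- X) i (lie_term X j F) k)" for i
  proof -
    let ?F = "\<Sum>j\<le>M. lie_term X j F"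
    have "?F + (lie_exp X F - ?F) = lie_exp X F" by (rule ext) simp
    from arg_cong[OF this, of "\<lambda>G. lie_term (- X) i G k"]
    have "lie_term (- X) i (lie_exp X F) k = lie_term (- X) i ?F k + lie_term (- X) i (lie_exp X F - ?F) k"
      unfolding lie_term_add plus_fun_apply by (rule sym)
    moreover have "lie_term (- X) i (lie_exp X F - ?F) k = 0"
      by (rule O_ord_D[OF O_ord_lie_term[OF X' lie_exp_trunc_ord[OF X]]]) (simp add: M_def)
    moreover have "lie_term (- X) i ?F k = (\<Sum>j\<le>M. lie_term (- X) i (lie_term X j F) k)"
      by (subst lie_term_sum) (rule ser_sum_apply)
    ultimately show ?thesis by (metis add_0_right)
  qed
  have tt: "lie_term (- X) i (lie_term X j F) k = (-1) ^ i / (fact i * fact j) * lie_pow X (i + j) F k" for i j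
    by (simp add: lie_term_def lie_pow_sscale neg lie_pow_add)
  have van: "lie_pow X m F k = 0" if "m > M" for m
    using O_ord_D[OF O_ord_lie_pow[OF X, of 0 F m]] that by (simp add: M_def)
  have "lie_exp (- X) (lie_exp X F) k =
      (\<Sum>(i, j)\<in>{..M} \<times> {..M}. (-1) ^ i / (fact i * fact j) * lie_pow X (i + j) F k)"
    unfolding lie_exp_trunc[OF X' eq_refl[OF M_def[symmetric]]] tk tt
    by (rule sum.cartesian_product)
  also have "\<dots> = (\<Sum>(i, j)\<in>{(i, j). i + j \<le> M}. (-1) ^ i / (fact i * fact j) * lie_pow X (i + j) F k)"
    by (rule sum.mono_neutral_right) (use van in \<open>auto, meson not_le_imp_less\<close>)
  also have "\<dots> = (\<Sum>m\<le>M. \<Sum>i\<le>m. (-1) ^ i / (fact i * fact (m - i)) * lie_pow X (i + (m - i)) F k)"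
    by (rule sum.triangle_reindex_eq)
  also have "\<dots> = (\<Sum>m\<le>M. if m = 0 then F k else 0)"
  proof (intro sum.cong refl)
    fix m
    have "(\<Sum>i\<le>m. (-1) ^ i / (fact i * fact (m - i)) * lie_pow X (i + (m - i)) F k) =
       (\<Sum>i\<le>m. (-1) ^ i * of_nat (m choose i)) * (lie_pow X m F k / fact m)"
      unfolding sum_distrib_right
      by (intro sum.cong refl) (simp add: binomial_fact field_simps)
    then show "(\<Sum>i\<le>m. (-1) ^ i / (fact i * fact (m - i)) * lie_pow X (i + (m - i)) F k) = (if m = 0 then F k else 0)"
      using choose_alternating_sum[of m, where ?'a = complex] by auto
  qed
  finally show "lie_exp (- X) (lie_exp X F) k = F k" by (simp add: M_def)
qed


text \<open>As simplification rules these would also rewrite eta-expanded series in argument position.\<close>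

lemmas ser_apply = plus_fun_apply minus_apply uminus_apply zero_fun_apply sscale_apply

declare ser_apply [simp del] ser_minus_apply [simp del] ser_uminus_apply [simp del]


section \<open>A spectral obstruction to low-order normal forms\<close>

text \<open>The operator polynomial \<open>P({H, -})\<close> applied to \<open>f\<close>, with
  \<open>P\<close> given by its list of roots.\<close>

fun shift_prod :: "'n::finite ser \<Rightarrow> complex list \<Rightarrow> 'n ser \<Rightarrow> 'n ser" where
  "shift_prod H [] f = f"
| "shift_prod H (\<mu> # l) f = ser_bracket H (shift_prod H l f) - sscale \<mu> (shift_prod H l f)"

lemma sscale_diff: "sscale c (F - G) = sscale c F - sscale c G"
  by (rule ext) (simp add: ser_apply algebra_simps)

lemma O_ord_shift_prod: "O_ord 2 H \<Longrightarrow> O_ord a f \<Longrightarrow> O_ord a (shift_prod H l f)"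
  by (induction l) (simp_all add: O_ord_diff O_ord_sscale O_ord_bracket2)

lemma shift_prod_H2: "shift_prod (H2 \<omega>) l f k = prod_list (map (\<lambda>\<mu>. eigval \<omega> k - \<mu>) l) * f k"
  by (induction l) (simp_all add: ser_bracket_H2 ser_apply algebra_simps)

lemma shift_prod_lie_exp:
  assumes "O_ord 3 X"
  shows "shift_prod (lie_exp X H) l (lie_exp X f) = lie_exp X (shift_prod H l f)"
  by (induction l) (simp_all only: shift_prod.simps lie_exp_diff lie_exp_sscale lie_exp_bracket[OF assms])

text \<open>Test series have no constant term because \<open>eig_list\<close> covers degrees 1 to
  \<open>r - 2\<close> only; \<open>r - 1\<close> is the order that results from bracketing a series
  of order 1 with one of order \<open>r\<close>.\<close>

definition kills :: "nat \<Rightarrow> complex list \<Rightarrow> 'n::finite ser \<Rightarrow> bool" where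
  "kills r S H \<longleftrightarrow> (\<forall>f. O_ord 1 f \<longrightarrow> O_ord (r - 1) (shift_prod H S f))"

text \<open>Since \<open>lie_exp X\<close> preserves the bracket, it conjugates
  \<open>{H, -}\<close> into \<open>{lie_exp X H, -}\<close>; through the inverse
  \<open>lie_exp (- X)\<close> every admissible \<open>f\<close> is the image of an admissible
  one.\<close>

lemma kills_lie_exp:
  assumes X: "O_ord 3 X" and H: "kills r S H" shows "kills r S (lie_exp X H)"
  unfolding kills_def
proof (intro allI impI)
  fix f :: "'a ser" assume f: "O_ord 1 f"
  have X': "O_ord 3 (- X)" using X by (rule O_ord_uminus)
  define g where "g = lie_exp (- X) f"
  have "lie_exp X g = f" using lie_exp_inverse[OF X', of f] by (simp add: g_def)
  moreover have "O_ord 1 g" unfolding g_def by (intro O_ord_lie_exp X' f)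
  ultimately show "O_ord (r - 1) (shift_prod (lie_exp X H) S f)"
    using H X by (metis O_ord_lie_exp kills_def shift_prod_lie_exp)
qed

lemma finite_eigvals: "finite (eigval \<omega> ` {k. 1 \<le> deg k \<and> deg k < r})"
  by (rule finite_imageI, rule finite_subset[OF _ finite_deg_le[of r]]) auto

text \<open>Many indices may share an eigenvalue; listing each value once makes the roots of
  \<open>P\<close> simple. The order of the list is arbitrary.\<close>

definition eig_list :: "real ^ 'n::finite \<Rightarrow> nat \<Rightarrow> complex list" where
  "eig_list \<omega> r = (SOME l. distinct l \<and> set l = eigval \<omega> ` {k :: 'n midx. 1 \<le> deg k \<and> deg k < r - 1})"

lemma eig_list: "distinct (eig_list \<omega> r)" "set (eig_list \<omega> r) = eigval \<omega> ` {k. 1 \<le> deg k \<and> deg k < r - 1}"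
  using someI_ex[OF finite_distinct_list[OF finite_eigvals[of \<omega> "r - 1"]]]
  unfolding eig_list_def by (auto simp: conj_commute)

text \<open>On series without constant term, brackets with \<open>N\<close> vanish modulo order
  \<open>r - 1\<close>. The operator polynomial therefore acts as for \<open>H2\<close> alone, that
  is diagonally, and every monomial of degree 1 to \<open>r - 2\<close> meets a zero factor.\<close>

lemma kills_normal:
  assumes N: "O_ord r N" and r: "2 \<le> r" shows "kills r (eig_list \<omega> r) (H2 \<omega> + N)"
  unfolding kills_def
proof (intro allI impI)
  fix f :: "'a ser" assume f: "O_ord 1 f"
  have N2: "O_ord 2 N" using N r by (rule O_ord_le)
  have H: "O_ord 2 (H2 \<omega> + N)" by (intro O_ord_add O_ord_H2 N2)
  have eq: "O_ord (r - 1) (shift_prod (H2 \<omega> + N) l f - shift_prod (H2 \<omega>) l f)" for l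
  proof (induction l)
    case (Cons \<mu> l)
    let ?p = "shift_prod (H2 \<omega> + N) l f" and ?q = "shift_prod (H2 \<omega>) l f"
    have "shift_prod (H2 \<omega> + N) (\<mu> # l) f - shift_prod (H2 \<omega>) (\<mu> # l) f =
      ser_bracket (H2 \<omega>) (?p - ?q) + ser_bracket N ?p - sscale \<mu> (?p - ?q)"
      by (simp add: ser_bracket_minus ser_bracket_add_left sscale_diff)
    moreover have "O_ord (r - 1) (ser_bracket N ?p)"
      using O_ord_bracket[OF N O_ord_shift_prod[OF H f]] by simp
    ultimately show ?case
      using Cons by (simp add: O_ord_diff O_ord_add O_ord_sscale O_ord_bracket2 O_ord_H2)
  qed simp
  show "O_ord (r - 1) (shift_prod (H2 \<omega> + N) (eig_list \<omega> r) f)"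
    unfolding O_ord_def
  proof (intro allI impI)
    fix k :: "'a midx" assume k: "deg k < r - 1"
    have "shift_prod (H2 \<omega>) (eig_list \<omega> r) f k = 0"
    proof (cases "deg k \<ge> 1")
      case True
      with k have "eigval \<omega> k \<in> set (eig_list \<omega> r)" by (auto simp: eig_list)
      then have "0 \<in> set (map (\<lambda>\<mu>. eigval \<omega> k - \<mu>) (eig_list \<omega> r))" by force
      then have "prod_list (map (\<lambda>\<mu>. eigval \<omega> k - \<mu>) (eig_list \<omega> r)) = 0"
        by (simp only: prod_list_zero_iff)
      then show ?thesis by (simp add: shift_prod_H2)
    next
      case False
      then show ?thesis using O_ord_D[OF f, of k] by (simp add: shift_prod_H2)
    qed
    then show "shift_prod (H2 \<omega> + N) (eig_list \<omega> r) f k = 0"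
      using O_ord_D[OF eq k] by (simp add: ser_apply)
  qed
qed

text \<open>The derivative at \<open>z\<close> of the monic polynomial with roots \<open>l\<close>,
  computed by the product rule.\<close>

fun dprod :: "complex \<Rightarrow> complex list \<Rightarrow> complex" where
  "dprod z [] = 0"
| "dprod z (\<mu> # l) = (z - \<mu>) * dprod z l + prod_list (map (\<lambda>\<mu>. z - \<mu>) l)"

lemma dprod_nonzero: "distinct l \<Longrightarrow> z \<in> set l \<Longrightarrow> dprod z l \<noteq> 0"
proof (induction l)
  case (Cons \<mu> l)
  show ?case
  proof (cases "z = \<mu>")
    case True
    then have "0 \<notin> set (map (\<lambda>\<mu>. z - \<mu>) l)" using Cons by force
    then have "prod_list (map (\<lambda>\<mu>. z - \<mu>) l) \<noteq> 0" by (simp only: prod_list_zero_iff not_False_eq_True)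
    with True show ?thesis by simp
  next
    case False
    with Cons have z: "z \<in> set l" "dprod z l \<noteq> 0" by auto
    then have "0 \<in> set (map (\<lambda>\<mu>. z - \<mu>) l)" by force
    then have "prod_list (map (\<lambda>\<mu>. z - \<mu>) l) = 0" by (simp only: prod_list_zero_iff)
    with False z show ?thesis by simp
  qed
qed simp

text \<open>The eigenvalues of \<open>{H2, -}\<close> in the list being simple, the component of the operator product
  along the eigenspace of a coordinate is, to leading order, a nonzero multiple of the bracket with
  the resonant part.\<close>

lemma kills_resonant:
  assumes F: "O_ord s F" and s: "3 \<le> s" and kl: "kills r (eig_list \<omega> r) (H2 \<omega> + F)"
    and k: "kprime k \<in> res_lattice \<omega>" "deg k < 2 * s - 2" "deg k < r"
  shows "F k = 0"
proof (cases "deg k < s")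
  case False
  then obtain m u where km: "k = m + unit_idx u" using deg_decomp s by (metis less_le_trans not_less zero_less_numeral gr0I)
  \<comment> \<open>Bracketing with the coordinate conjugate to \<open>u\<close> differentiates
    along \<open>u\<close>, so the coefficient of \<open>F\<close> at \<open>k\<close> reappears in
    \<open>{F, ?x}\<close> at \<open>m\<close>. Resonance of \<open>k\<close> means that
    \<open>m\<close> and \<open>?x\<close> share the eigenvalue \<open>?z\<close>.\<close>
  let ?v = "conj_var u" let ?x = "smono (unit_idx ?v)"
  let ?z = "eigval \<omega> (unit_idx ?v)"
  have deg: "deg k = deg m + 1" by (simp add: km)
  have "eigval \<omega> k = 0" using k(1) by (simp add: eigval_eq_0_iff)
  then have ev: "eigval \<omega> m = ?z"
    using eigval_unit_conj[of \<omega> "?v"] by (simp add: km eigval_add add_eq_0_iff2)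
  define p where "p l = prod_list (map (\<lambda>\<mu>. ?z - \<mu>) l)" for l
  \<comment> \<open>First-order perturbation theory: on indices with eigenvalue \<open>?z\<close>,
    the operator polynomial applied to \<open>?x\<close> is \<open>P(?z)\<close> times
    \<open>?x\<close> plus \<open>P'(?z)\<close> times \<open>{F, ?x}\<close>. Contributions of
    second order in \<open>F\<close> have order
    \<open>(s - 1) + (s - 2) = 2 * s - 3\<close>.\<close>
  have main: "O_ord (s - 1) (shift_prod (H2 \<omega> + F) l ?x - sscale (p l) ?x) \<and>
      (\<forall>k. deg k < 2 * s - 3 \<and> eigval \<omega> k = ?z \<longrightarrow>
        shift_prod (H2 \<omega> + F) l ?x k = p l * ?x k + dprod ?z l * ser_bracket F ?x k)" for l
  proof (induction l)
    case (Cons \<mu> l)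
    define P where "P = shift_prod (H2 \<omega> + F) l ?x"
    define B where "B = P - sscale (p l) ?x"
    have B: "O_ord (s - 1) B" using Cons by (simp add: B_def P_def)
    have PB: "P = sscale (p l) ?x + B" by (simp add: B_def)
    have FB: "O_ord (2 * s - 3) (ser_bracket F B)"
      by (rule O_ord_le[OF O_ord_bracket[OF F B]]) (use s in auto)
    have Fx: "O_ord (s - 1) (ser_bracket F ?x)"
      by (rule O_ord_le[OF O_ord_bracket[OF F O_ord_smono[of 1]]]) auto
    have eq: "shift_prod (H2 \<omega> + F) (\<mu> # l) ?x k =
        eigval \<omega> k * P k + p l * ser_bracket F ?x k + ser_bracket F B k - \<mu> * P k" for k
    proof -
      have "ser_bracket F P = sscale (p l) (ser_bracket F ?x) + ser_bracket F B"
        by (subst PB) (simp only: ser_bracket_add ser_bracket_scale)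
      then show ?thesis
        by (simp add: P_def[symmetric] ser_bracket_add_left ser_bracket_H2 ser_apply)
    qed
    have xk: "eigval \<omega> k * ?x k = ?z * ?x k" for k by (simp add: smono_def)
    have "O_ord (s - 1) (shift_prod (H2 \<omega> + F) (\<mu> # l) ?x - sscale (p (\<mu> # l)) ?x)"
      unfolding O_ord_def
    proof (intro allI impI)
      fix k :: "'a midx" assume k: "deg k < s - 1"
      then have "ser_bracket F ?x k = 0" "ser_bracket F B k = 0" "B k = 0"
        using O_ord_D[OF Fx k] O_ord_D[OF FB, of k] O_ord_D[OF B k] s by auto
      then show "(shift_prod (H2 \<omega> + F) (\<mu> # l) ?x - sscale (p (\<mu> # l)) ?x) k = 0"
        unfolding minus_apply eq using xk[of k]
          by (cases "?x k = 0") (simp_all add: PB p_def ser_apply algebra_simps)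
    qed
    moreover have "shift_prod (H2 \<omega> + F) (\<mu> # l) ?x k = p (\<mu> # l) * ?x k + dprod ?z (\<mu> # l) * ser_bracket F ?x k"
      if "deg k < 2 * s - 3" "eigval \<omega> k = ?z" for k
    proof -
      have "ser_bracket F B k = 0" using O_ord_D[OF FB that(1)] .
      moreover have "P k = p l * ?x k + dprod ?z l * ser_bracket F ?x k"
        using Cons that unfolding P_def by blast
      ultimately show ?thesis unfolding eq that(2) by (simp add: p_def algebra_simps)
    qed
    ultimately show ?case by blast
  qed (simp add: p_def)
  have r: "3 < r" using k(3) False s by auto
  have zin: "?z \<in> set (eig_list \<omega> r)" unfolding eig_list by (rule imageI) (use r in auto)
  then have "0 \<in> set (map (\<lambda>\<mu>. ?z - \<mu>) (eig_list \<omega> r))" by force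
  then have p0: "p (eig_list \<omega> r) = 0" unfolding p_def by (simp only: prod_list_zero_iff)
  have "O_ord (r - 1) (shift_prod (H2 \<omega> + F) (eig_list \<omega> r) ?x)"
    using kl O_ord_smono[of 1 "unit_idx ?v"] by (simp add: kills_def)
  then have "shift_prod (H2 \<omega> + F) (eig_list \<omega> r) ?x m = 0"
    by (rule O_ord_D) (use k deg in auto)
  moreover have "deg m < 2 * s - 3" using k deg by auto
  ultimately have "dprod ?z (eig_list \<omega> r) * ser_bracket F ?x m = 0"
    using main[of "eig_list \<omega> r"] p0 ev by auto
  then have "ser_bracket F ?x m = 0"
    using dprod_nonzero[OF eig_list(1) zin] by simp
  then have "sderiv u F m = 0" by (simp add: ser_bracket_coord ser_apply)
  moreover have "of_nat (cmp m u + 1) \<noteq> (0 :: complex)" by (simp only: of_nat_eq_0_iff)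
  ultimately show ?thesis by (simp add: sderiv_def km del: of_nat_add of_nat_Suc)
qed (use F in \<open>auto dest: O_ord_D\<close>)

section \<open>Differentiation and limits of families of series, coefficient by coefficient\<close>

definition ser_has_deriv :: "(real \<Rightarrow> 'n::finite ser) \<Rightarrow> 'n ser \<Rightarrow> real \<Rightarrow> bool" where
  "ser_has_deriv F F' t \<longleftrightarrow> (\<forall>k. ((\<lambda>s. F s k) has_vector_derivative F' k) (at t))"

definition ser_tendsto :: "('a \<Rightarrow> 'n::finite ser) \<Rightarrow> 'n ser \<Rightarrow> 'a filter \<Rightarrow> bool" where
  "ser_tendsto F L net \<longleftrightarrow> (\<forall>k. ((\<lambda>s. F s k) \<longlongrightarrow> L k) net)"

lemma ser_has_deriv_const: "ser_has_deriv (\<lambda>_. F) 0 t"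
  by (simp add: ser_has_deriv_def ser_apply)

lemma ser_has_deriv_add:
  "ser_has_deriv F F' t \<Longrightarrow> ser_has_deriv G G' t \<Longrightarrow> ser_has_deriv (\<lambda>s. F s + G s) (F' + G') t"
  by (auto simp: ser_has_deriv_def simp: ser_apply intro!: has_vector_derivative_add)

lemma ser_has_deriv_diff:
  "ser_has_deriv F F' t \<Longrightarrow> ser_has_deriv G G' t \<Longrightarrow> ser_has_deriv (\<lambda>s. F s - G s) (F' - G') t"
  by (auto simp: ser_has_deriv_def simp: ser_apply intro!: has_vector_derivative_diff)

lemma ser_has_deriv_sscale:
  "ser_has_deriv F F' t \<Longrightarrow> ser_has_deriv (\<lambda>s. sscale c (F s)) (sscale c F') t"
  by (auto simp: ser_has_deriv_def ser_apply intro!: has_vector_derivative_mult_right)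

lemma ser_has_deriv_sderiv:
  "ser_has_deriv F F' t \<Longrightarrow> ser_has_deriv (\<lambda>s. sderiv v (F s)) (sderiv v F') t"
  unfolding ser_has_deriv_def sderiv_def by (intro allI has_vector_derivative_mult_right) blast

lemma ser_has_deriv_sum:
  "(\<And>i. i \<in> I \<Longrightarrow> ser_has_deriv (F i) (F' i) t) \<Longrightarrow> ser_has_deriv (\<lambda>s. \<Sum>i\<in>I. F i s) (\<Sum>i\<in>I. F' i) t"
  unfolding ser_has_deriv_def ser_sum_apply by (auto intro!: has_vector_derivative_sum)

lemma ser_has_deriv_mult:
  assumes "ser_has_deriv F F' t" "ser_has_deriv G G' t"
  shows "ser_has_deriv (\<lambda>s. ser_mult (F s) (G s)) (ser_mult (F t) G' + ser_mult F' (G t)) t"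
  unfolding ser_has_deriv_def
proof
  fix k
  have "((\<lambda>s. \<Sum>x\<in>{(a, b). a + b = k}. F s (fst x) * G s (snd x)) has_vector_derivative
     (\<Sum>x\<in>{(a, b). a + b = k}. F t (fst x) * G' (snd x) + F' (fst x) * G t (snd x))) (at t)"
    using assms unfolding ser_has_deriv_def
    by (intro has_vector_derivative_sum has_vector_derivative_mult) auto
  then show "((\<lambda>s. ser_mult (F s) (G s) k) has_vector_derivative
      (ser_mult (F t) G' + ser_mult F' (G t)) k) (at t)"
    by (simp add: ser_mult_def ser_apply case_prod_unfold sum.distrib)
qed

lemma ser_has_deriv_bracket:
  assumes "ser_has_deriv F F' t" "ser_has_deriv G G' t"
  shows "ser_has_deriv (\<lambda>s. ser_bracket (F s) (G s)) (ser_bracket (F t) G' + ser_bracket F' (G t)) t"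
proof -
  have "ser_has_deriv (\<lambda>s. ser_bracket (F s) (G s)) (\<Sum>v\<in>UNIV. sscale (\<i> * sgn_var v)
      (ser_mult (sderiv v (F t)) (sderiv (conj_var v) G') + ser_mult (sderiv v F') (sderiv (conj_var v) (G t)))) t"
    unfolding ser_bracket_eq
    by (intro ser_has_deriv_sum ser_has_deriv_sscale ser_has_deriv_mult ser_has_deriv_sderiv assms)
  then show ?thesis by (simp only: ser_bracket_eq sscale_add sum.distrib)
qed

lemma ser_tendsto_const: "ser_tendsto (\<lambda>_. F) F net"
  by (simp add: ser_tendsto_def)

lemma ser_tendsto_add:
  "ser_tendsto F F' t \<Longrightarrow> ser_tendsto G G' t \<Longrightarrow> ser_tendsto (\<lambda>s. F s + G s) (F' + G') t"
  by (auto simp: ser_tendsto_def simp: ser_apply intro!: tendsto_add)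

lemma ser_tendsto_diff:
  "ser_tendsto F F' t \<Longrightarrow> ser_tendsto G G' t \<Longrightarrow> ser_tendsto (\<lambda>s. F s - G s) (F' - G') t"
  by (auto simp: ser_tendsto_def simp: ser_apply intro!: tendsto_diff)

lemma ser_tendsto_sscale:
  "ser_tendsto F F' t \<Longrightarrow> ser_tendsto (\<lambda>s. sscale c (F s)) (sscale c F') t"
  by (auto simp: ser_tendsto_def simp: ser_apply intro!: tendsto_mult)

lemma ser_tendsto_bracket:
  assumes "ser_tendsto F F' t" "ser_tendsto G G' t"
  shows "ser_tendsto (\<lambda>s. ser_bracket (F s) (G s)) (ser_bracket F' G') t"
  using assms unfolding ser_tendsto_def ser_bracket_eq ser_sum_apply sscale_apply ser_mult_def sderiv_def case_prod_unfold
  by (intro allI tendsto_intros) blast+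

lemma ser_tendsto_shift_prod:
  assumes "ser_tendsto H H' t"
  shows "ser_tendsto (\<lambda>s. shift_prod (H s) l f) (shift_prod H' l f) t"
  by (induction l)
     (simp_all only: shift_prod.simps ser_tendsto_const ser_tendsto_diff ser_tendsto_sscale ser_tendsto_bracket assms)

text \<open>A Lax equation: by the Jacobi identity \<open>{H, -}\<close> evolves by its commutator
  with \<open>{\<Xi>, -}\<close>, and so does every polynomial in it.\<close>

lemma ser_has_deriv_shift_prod:
  assumes "ser_has_deriv H (- ser_bracket \<Xi> (H t)) t"
  shows "ser_has_deriv (\<lambda>s. shift_prod (H s) l f)
     (shift_prod (H t) l (ser_bracket \<Xi> f) - ser_bracket \<Xi> (shift_prod (H t) l f)) t"
proof (induction l)
  case Nil
  then show ?case by (simp add: ser_has_deriv_const)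
next
  case (Cons \<mu> l)
  define P where "P = shift_prod (H t) l f"
  define Q where "Q = shift_prod (H t) l (ser_bracket \<Xi> f)"
  have "ser_has_deriv (\<lambda>s. shift_prod (H s) (\<mu> # l) f)
     (ser_bracket (H t) (Q - ser_bracket \<Xi> P) + ser_bracket (- ser_bracket \<Xi> (H t)) P
       - sscale \<mu> (Q - ser_bracket \<Xi> P)) t"
    unfolding shift_prod.simps P_def Q_def
    by (intro ser_has_deriv_diff ser_has_deriv_bracket ser_has_deriv_sscale assms Cons)
  moreover have "ser_bracket (H t) (Q - ser_bracket \<Xi> P) + ser_bracket (- ser_bracket \<Xi> (H t)) P
       - sscale \<mu> (Q - ser_bracket \<Xi> P) =
     (ser_bracket (H t) Q - sscale \<mu> Q) - ser_bracket \<Xi> (ser_bracket (H t) P - sscale \<mu> P)"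
    unfolding ser_bracket_minus ser_bracket_uminus_left ser_jacobi[of \<Xi> "H t" P] ser_bracket_scale
    by (simp add: sscale_diff algebra_simps)
  ultimately show ?case by (simp only: P_def Q_def shift_prod.simps)
qed

text \<open>Along the flow the leading graded part of the operator product is constant, because a Lie
  derivative along a series of order 3 strictly raises degrees; hence it equals its limit.\<close>

lemma kills_flow:
  fixes H0 N :: "'n::finite ser"
  assumes nf: "is_normal_form \<omega> H0 N" and N: "O_ord r N" and r: "3 \<le> r"
  shows "kills r (eig_list \<omega> r) (H2 \<omega> + H0)"
proof -
  from nf obtain H where fl: "norm_flow \<omega> H0 H" and lim: "\<And>k. ((\<lambda>\<delta>. H \<delta> k) \<longlongrightarrow> N k) at_top"
    unfolding is_normal_form_def by blast
  let ?P = "\<lambda>t. shift_prod (H2 \<omega> + H t) (eig_list \<omega> r)"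
  have H3: "O_ord 3 (H t)" for t using fl by (simp add: norm_flow_def F_diamond_iff)
  have H: "O_ord 2 (H2 \<omega> + H t)" for t using O_ord_le[OF H3, of 2] by (intro O_ord_add O_ord_H2) auto
  have D: "ser_has_deriv (\<lambda>t. H2 \<omega> + H t) (- ser_bracket (xi \<omega> (H t)) (H2 \<omega> + H t)) t" for t
  proof -
    have "ser_has_deriv H (- ser_bracket (xi \<omega> (H t)) (H2 \<omega> + H t)) t"
      using fl by (simp add: norm_flow_def ser_has_deriv_def ser_apply)
    from ser_has_deriv_add[OF ser_has_deriv_const this] show ?thesis by simp
  qed
  have T: "ser_tendsto (\<lambda>t. H2 \<omega> + H t) (H2 \<omega> + N) at_top"
    by (rule ser_tendsto_add[OF ser_tendsto_const]) (use lim in \<open>simp add: ser_tendsto_def\<close>)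
  have K: "kills r (eig_list \<omega> r) (H2 \<omega> + N)" using kills_normal[OF N] r by simp
  \<comment> \<open>Induction on the gain \<open>d\<close>. Both terms of the derivative vanish in
    degree \<open>i + d\<close>: one because \<open>{\<Xi>, f}\<close> has order
    \<open>i + 1\<close>, the other because the outer bracket raises the order once more. The
    coefficient is then constant in time and equals its limit, which is 0 by
    \<open>K\<close>.\<close>
  have "O_ord (min (i + d) (r - 1)) (?P t f)" if "1 \<le> i" "O_ord i f" for i d t f
    using that
  proof (induction d arbitrary: i f t)
    case 0
    then show ?case by (intro O_ord_le[OF O_ord_shift_prod[OF H]]) auto
  next
    case (Suc d)
    show ?case unfolding O_ord_def
    proof (intro allI impI)
      fix k :: "'n midx" assume k: "deg k < min (i + Suc d) (r - 1)"
      show "?P t f k = 0"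
      proof (cases "deg k < i + d")
        case True
        then show ?thesis using O_ord_D[OF Suc.IH[OF Suc.prems, of t], of k] k by simp
      next
        case False
        have "((\<lambda>s. ?P s f k) has_vector_derivative 0) (at s)" for s
        proof -
          let ?X = "xi \<omega> (H s)"
          have "O_ord (min (i + 1 + d) (r - 1)) (?P s (ser_bracket ?X f))"
            by (rule Suc.IH) (use O_ord_bracket3[OF O_ord_xi Suc.prems(2)] in auto)
          then have 1: "?P s (ser_bracket ?X f) k = 0" by (rule O_ord_D) (use k in auto)
          have "O_ord (min (i + d) (r - 1) + 1) (ser_bracket ?X (?P s f))"
            by (rule O_ord_bracket3[OF O_ord_xi Suc.IH[OF Suc.prems]])
          then have 2: "ser_bracket ?X (?P s f) k = 0" by (rule O_ord_D) (use k False in auto)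
          have "((\<lambda>t. ?P t f k) has_vector_derivative
              (?P s (ser_bracket ?X f) - ser_bracket ?X (?P s f)) k) (at s)"
            using ser_has_deriv_shift_prod[OF D[of s]] unfolding ser_has_deriv_def by blast
          then show ?thesis by (simp only: minus_apply 1 2 diff_zero)
        qed
        then obtain c where c: "\<And>s. ?P s f k = c"
          using has_vector_derivative_zero_constant[of UNIV "\<lambda>s. ?P s f k"] by auto
        have "((\<lambda>s. ?P s f k) \<longlongrightarrow> shift_prod (H2 \<omega> + N) (eig_list \<omega> r) f k) at_top"
          using ser_tendsto_shift_prod[OF T] unfolding ser_tendsto_def by blast
        then have "c = shift_prod (H2 \<omega> + N) (eig_list \<omega> r) f k"
          unfolding c by (simp add: tendsto_const_iff)
        moreover have "O_ord 1 f" using Suc.prems by (auto intro: O_ord_le)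
        ultimately show ?thesis using K k c[of t] by (auto simp: kills_def dest: O_ord_D)
      qed
    qed
  qed
  then have "O_ord (min (1 + r) (r - 1)) (?P 0 f)" if "O_ord 1 f" for f
    using that by blast
  moreover have "min (1 + r) (r - 1) = r - 1" by simp
  ultimately have "O_ord (r - 1) (?P 0 f)" if "O_ord 1 f" for f
    using that by metis
  moreover have "H 0 = H0" using fl by (simp add: norm_flow_def)
  ultimately show ?thesis by (simp add: kills_def)
qed


section \<open>Weighted norms\<close>

text \<open>A bound on the weighted \<open>l\<^sup>1\<close>-norm, stated for finite partial sums so that no summability side
  conditions arise.\<close>

definition wle :: "real \<Rightarrow> 'n::finite ser \<Rightarrow> real \<Rightarrow> bool" where
  "wle R F c \<longleftrightarrow> (\<forall>A. finite A \<longrightarrow> (\<Sum>k\<in>A. cmod (F k) * R ^ deg k) \<le> c)"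

text \<open>The Euler operator. A single bound on it controls all partial derivatives, and it acts
  diagonally, hence commutes with the splitting into resonant and nonresonant parts.\<close>

definition eul :: "'n::finite ser \<Rightarrow> 'n ser" where
  "eul F = (\<lambda>k. of_nat (deg k) * F k)"

lemma eul_apply: "eul F k = of_nat (deg k) * F k"
  by (simp add: eul_def)

lemma O_ord_eul: "O_ord a F \<Longrightarrow> O_ord a (eul F)"
  unfolding O_ord_def eul_apply by simp

lemma wleD: "wle R F c \<Longrightarrow> finite A \<Longrightarrow> (\<Sum>k\<in>A. cmod (F k) * R ^ deg k) \<le> c"
  by (simp add: wle_def)

lemma wle_nonneg: "wle R F c \<Longrightarrow> 0 \<le> c"
  using wleD[of R F c "{}"] by simp

lemma wle_mono: "wle R F c \<Longrightarrow> c \<le> d \<Longrightarrow> wle R F d"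
  unfolding wle_def by (meson order_trans)

lemma wle_le:
  assumes "wle R F c" "\<And>k. cmod (G k) \<le> cmod (F k)" "0 \<le> R" shows "wle R G c"
  unfolding wle_def
proof (intro allI impI)
  fix A :: "'a midx set" assume "finite A"
  have "(\<Sum>k\<in>A. cmod (G k) * R ^ deg k) \<le> (\<Sum>k\<in>A. cmod (F k) * R ^ deg k)"
    by (intro sum_mono mult_right_mono assms) (use assms in auto)
  also have "\<dots> \<le> c" by (rule wleD) fact+
  finally show "(\<Sum>k\<in>A. cmod (G k) * R ^ deg k) \<le> c" .
qed

lemma wle_zero: "0 \<le> c \<Longrightarrow> wle R 0 c"
  by (simp add: wle_def ser_apply)

lemma wle_add:
  assumes "wle R F c" "wle R G d" "0 \<le> R" shows "wle R (F + G) (c + d)"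
  unfolding wle_def
proof (intro allI impI)
  fix A :: "'a midx set" assume A: "finite A"
  have "(\<Sum>k\<in>A. cmod ((F + G) k) * R ^ deg k) \<le> (\<Sum>k\<in>A. cmod (F k) * R ^ deg k + cmod (G k) * R ^ deg k)"
    by (intro sum_mono) (use assms in \<open>simp add: ser_apply norm_triangle_ineq mult_right_mono flip: distrib_right\<close>)
  also have "\<dots> \<le> c + d" unfolding sum.distrib by (intro add_mono wleD assms A)
  finally show "(\<Sum>k\<in>A. cmod ((F + G) k) * R ^ deg k) \<le> c + d" .
qed

lemma wle_sscale:
  assumes "wle R F c" shows "wle R (sscale z F) (cmod z * c)"
  unfolding wle_def ser_apply norm_mult mult.assoc sum_distrib_left[symmetric]
  using assms by (auto simp: wle_def intro!: mult_left_mono)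

lemma wle_sum:
  "(\<And>i. i \<in> I \<Longrightarrow> wle R (F i) (c i)) \<Longrightarrow> 0 \<le> R \<Longrightarrow> wle R (\<Sum>i\<in>I. F i) (\<Sum>i\<in>I. c i)"
  by (induction I rule: infinite_finite_induct) (simp_all add: wle_zero wle_add)

lemma wle_mult:
  fixes F :: "'n::finite ser"
  assumes F: "wle R F c" and G: "wle R G d" and R: "0 \<le> R"
  shows "wle R (ser_mult F G) (c * d)"
  unfolding wle_def
proof (intro allI impI)
  fix A :: "'n midx set" assume A: "finite A"
  define S where "S = (SIGMA k:A. {(a, b). a + b = k})"
  have S: "finite S" unfolding S_def by (intro finite_SigmaI A finite_splits)
  define U where "U = fst ` snd ` S"
  define V where "V = snd ` snd ` S"
  have UV: "finite U" "finite V" using S by (auto simp: U_def V_def)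
  let ?f = "\<lambda>a. cmod (F a) * R ^ deg a" and ?g = "\<lambda>b. cmod (G b) * R ^ deg b"
  have "(\<Sum>k\<in>A. cmod (ser_mult F G k) * R ^ deg k) \<le> (\<Sum>k\<in>A. \<Sum>x\<in>{(a, b). a + b = k}. ?f (fst x) * ?g (snd x))"
  proof (rule sum_mono)
    fix k :: "'n midx"
    have "cmod (ser_mult F G k) * R ^ deg k \<le> (\<Sum>x\<in>{(a, b). a + b = k}. cmod (F (fst x) * G (snd x))) * R ^ deg k"
      unfolding ser_mult_def case_prod_unfold by (rule mult_right_mono[OF norm_sum]) (use R in simp)
    also have "\<dots> = (\<Sum>x\<in>{(a, b). a + b = k}. ?f (fst x) * ?g (snd x))"
      unfolding sum_distrib_right
      by (rule sum.cong, simp, simp only: mem_Collect_eq case_prod_unfold, drule sym[of "_ + _"])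
         (simp only: deg_add power_add norm_mult mult_ac)
    finally show "cmod (ser_mult F G k) * R ^ deg k \<le> \<dots>" .
  qed
  also have "\<dots> = (\<Sum>(k, x)\<in>S. ?f (fst x) * ?g (snd x))"
    unfolding S_def by (rule sum.Sigma) (auto simp: A finite_splits)
  also have "\<dots> = (\<Sum>x\<in>snd ` S. ?f (fst x) * ?g (snd x))"
  proof -
    have "inj_on snd S" by (auto simp: S_def inj_on_def)
    then show ?thesis by (subst sum.reindex) (auto simp: case_prod_unfold)
  qed
  also have "\<dots> \<le> (\<Sum>x\<in>U \<times> V. ?f (fst x) * ?g (snd x))"
    by (rule sum_mono2) (use UV R in \<open>simp_all add: U_def V_def subset_fst_snd\<close>)
  also have "\<dots> = sum ?f U * sum ?g V"
    by (simp add: sum_product sum.cartesian_product case_prod_unfold)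
  also have "\<dots> \<le> c * d"
    by (intro mult_mono wleD F G UV wle_nonneg[OF F] sum_nonneg) (use R in auto)
  finally show "(\<Sum>k\<in>A. cmod (ser_mult F G k) * R ^ deg k) \<le> c * d" .
qed

text \<open>The Schwarz lemma for weighted norms: each order of vanishing gains one factor
  \<open>R' / R\<close>.\<close>

lemma wle_ord:
  fixes F :: "'n::finite ser"
  assumes F: "wle R F c" and a: "O_ord a F" and R: "0 < R'" "R' \<le> R"
  shows "wle R' F (c * (R' / R) ^ a)"
  unfolding wle_def
proof (intro allI impI)
  fix A :: "'n midx set" assume A: "finite A"
  have "(\<Sum>k\<in>A. cmod (F k) * R' ^ deg k) \<le> (\<Sum>k\<in>A. (cmod (F k) * R ^ deg k) * (R' / R) ^ a)"
  proof (rule sum_mono)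
    fix k :: "'n midx"
    show "cmod (F k) * R' ^ deg k \<le> (cmod (F k) * R ^ deg k) * (R' / R) ^ a"
    proof (cases "deg k < a")
      case False
      have "(R' / R) ^ deg k \<le> (R' / R) ^ a"
        by (rule power_decreasing) (use False R in auto)
      then have "R ^ deg k * (R' / R) ^ deg k \<le> R ^ deg k * (R' / R) ^ a"
        using R by (intro mult_left_mono) auto
      moreover have "R ^ deg k * (R' / R) ^ deg k = R' ^ deg k"
        using R by (simp add: power_divide)
      ultimately show ?thesis by (simp add: mult.assoc mult_left_mono)
    qed (use O_ord_D[OF a] in simp)
  qed
  also have "\<dots> \<le> c * (R' / R) ^ a"
    unfolding sum_distrib_right[symmetric]
    by (rule mult_right_mono[OF wleD[OF F A]]) (use R in auto)
  finally show "(\<Sum>k\<in>A. cmod (F k) * R' ^ deg k) \<le> c * (R' / R) ^ a" .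
qed

lemma wle_mono_R: "wle R F c \<Longrightarrow> 0 < R' \<Longrightarrow> R' \<le> R \<Longrightarrow> wle R' F c"
  using wle_ord[of R F c 0 R'] by simp

lemma wle_of_eul:
  assumes "wle R (eul F) c" "O_ord 1 F" "0 \<le> R" shows "wle R F c"
proof (rule wle_le[OF assms(1) _ assms(3)])
  fix k
  show "cmod (F k) \<le> cmod (eul F k)"
  proof (cases "deg k = 0")
    case False
    then have "1 \<le> real (deg k)" by simp
    then show ?thesis
      using mult_right_mono[of 1 "real (deg k)" "cmod (F k)"] by (simp add: eul_apply norm_mult)
  qed (use O_ord_D[OF assms(2)] in simp)
qed

text \<open>A Cauchy estimate in the logarithmic radius: \<open>t * exp (- s * t)\<close> is at most
  \<open>1 / (exp 1 * s)\<close>, by \<open>exp y \<ge> 1 + y\<close> at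
  \<open>y = s * t - 1\<close>.\<close>

lemma wle_eul:
  fixes F :: "'n::finite ser"
  assumes F: "wle R F c" and s: "0 < s" and R: "0 < R"
  shows "wle (R * exp (- s)) (eul F) (c / (exp 1 * s))"
  unfolding wle_def
proof (intro allI impI)
  fix A :: "'n midx set" assume A: "finite A"
  have "(\<Sum>k\<in>A. cmod (eul F k) * (R * exp (- s)) ^ deg k) \<le> (\<Sum>k\<in>A. (cmod (F k) * R ^ deg k) * (1 / (exp 1 * s)))"
  proof (rule sum_mono)
    fix k :: "'n midx"
    have "s * deg k \<le> exp (s * deg k - 1)" using exp_ge_add_one_self[of "s * deg k - 1"] by simp
    then have "deg k * exp (- (s * deg k)) \<le> 1 / (exp 1 * s)"
      using s by (simp add: exp_diff exp_minus field_simps)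
    moreover have "exp (- s) ^ deg k = exp (- (s * deg k))"
      by (simp add: exp_of_nat2_mult[symmetric] mult.commute)
    ultimately have "(cmod (F k) * R ^ deg k) * (deg k * exp (- s) ^ deg k) \<le> (cmod (F k) * R ^ deg k) * (1 / (exp 1 * s))"
      using R by (intro mult_left_mono) auto
    then show "cmod (eul F k) * (R * exp (- s)) ^ deg k \<le> (cmod (F k) * R ^ deg k) * (1 / (exp 1 * s))"
      by (simp add: eul_apply norm_mult power_mult_distrib mult_ac)
  qed
  also have "\<dots> \<le> c / (exp 1 * s)"
    unfolding sum_distrib_right[symmetric]
    using mult_right_mono[OF wleD[OF F A], of "1 / (exp 1 * s)"] s by simp
  finally show "(\<Sum>k\<in>A. cmod (eul F k) * (R * exp (- s)) ^ deg k) \<le> c / (exp 1 * s)" .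
qed

lemma wle_sderiv:
  fixes F :: "'n::finite ser"
  assumes F: "wle R (eul F) c" and R: "0 < R"
  shows "wle R (sderiv v F) (c / R)"
  unfolding wle_def
proof (intro allI impI)
  fix A :: "'n midx set" assume A: "finite A"
  let ?s = "\<lambda>k. k + unit_idx v"
  have "(\<Sum>k\<in>A. cmod (sderiv v F k) * R ^ deg k) \<le> (\<Sum>k\<in>A. cmod (eul F (?s k)) * R ^ deg (?s k) / R)"
  proof (rule sum_mono)
    fix k :: "'n midx"
    have "cmp k v + 1 \<le> deg (?s k)" using cmp_le_deg[of k v] by simp
    then have "real (cmp k v + 1) * cmod (F (?s k)) \<le> real (deg (?s k)) * cmod (F (?s k))"
      by (intro mult_right_mono) (simp_all del: of_nat_add deg_add)
    then have "cmod (sderiv v F k) \<le> cmod (eul F (?s k))"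
      unfolding sderiv_def eul_apply norm_mult norm_of_nat .
    then have "cmod (sderiv v F k) * R ^ deg k \<le> cmod (eul F (?s k)) * R ^ deg k"
      using R by (intro mult_right_mono) auto
    then show "cmod (sderiv v F k) * R ^ deg k \<le> cmod (eul F (?s k)) * R ^ deg (?s k) / R"
      using R by simp
  qed
  also have "\<dots> = (\<Sum>k\<in>?s ` A. cmod (eul F k) * R ^ deg k) / R"
    by (subst sum.reindex) (auto simp: inj_on_def sum_divide_distrib simp del: deg_add)
  also have "\<dots> \<le> c / R"
    using R A by (intro divide_right_mono wleD[OF F]) auto
  finally show "(\<Sum>k\<in>A. cmod (sderiv v F k) * R ^ deg k) \<le> c / R" .
qed

definition nvar :: "'n::finite itself \<Rightarrow> real" where
  "nvar _ = 2 * real CARD('n)"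

lemma nvar_ge: "2 \<le> nvar TYPE('n::finite)"
proof -
  have "0 < CARD('n)" by simp
  then have "1 \<le> real CARD('n)" by linarith
  then show ?thesis by (simp add: nvar_def)
qed

text \<open>One product per variable gives the factor \<open>nvar\<close>, and two derivatives give
  \<open>1 / R ^ 2\<close>. For this reason sizes are expressed as multiples of \<open>R ^ 2\<close>
  in what follows.\<close>

lemma wle_bracket:
  fixes F :: "'n::finite ser"
  assumes F: "wle R (eul F) c" and G: "wle R (eul G) d" and R: "0 < R"
  shows "wle R (ser_bracket F G) (nvar TYPE('n) * c * d / R ^ 2)"
proof -
  have "wle R (ser_bracket F G) (\<Sum>v\<in>(UNIV :: ('n + 'n) set). cmod (\<i> * sgn_var v) * ((c / R) * (d / R)))"
    unfolding ser_bracket_eq using R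
    by (intro wle_sum wle_sscale wle_mult wle_sderiv F G) auto
  also have "(\<Sum>v\<in>(UNIV :: ('n + 'n) set). cmod (\<i> * sgn_var v) * ((c / R) * (d / R))) =
      nvar TYPE('n) * c * d / R ^ 2"
    by (simp add: norm_mult nvar_def UNIV_Plus_UNIV[symmetric] card_Plus power2_eq_square del: UNIV_Plus_UNIV)
  finally show ?thesis .
qed

lemma wle_smono: "0 \<le> R \<Longrightarrow> wle R (smono k) (R ^ deg k)"
  unfolding wle_def
proof (intro allI impI)
  fix A :: "'a midx set" assume R: "0 \<le> R" and A: "finite A"
  have "(\<Sum>l\<in>A. cmod (smono k l) * R ^ deg l) = (\<Sum>l\<in>A. if l = k then R ^ deg k else 0)"
    by (intro sum.cong) (auto simp: smono_def)
  then show "(\<Sum>l\<in>A. cmod (smono k l) * R ^ deg l) \<le> R ^ deg k"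
    using A R by (simp add: sum.delta')
qed

lemma wle_smono_unit: "0 \<le> R \<Longrightarrow> wle R (smono (unit_idx v)) R"
  using wle_smono[of R "unit_idx v"] by simp

lemma eul_smono_unit: "eul (smono (unit_idx v)) = smono (unit_idx v)"
  by (rule ext) (simp add: eul_apply smono_def)


section \<open>Estimates for Lie series\<close>

text \<open>Every bracket spends a loss \<open>s\<close> of logarithmic radius on the derivative of
  its second argument. The bound on \<open>X\<close>, in units of \<open>R ^ 2 / nvar\<close>,
  survives all shrinkings because \<open>eul X\<close> has order at least 2.\<close>

lemma wle_lie_pow:
  fixes F :: "'n::finite ser"
  assumes X: "O_ord 3 X" "wle R (eul X) (x * R ^ 2 / nvar TYPE('n))"
    and F: "wle R F c" and R: "0 < R" and s: "0 < s"
  shows "wle (R * exp (- (real m * s))) (lie_pow X m F) ((x / (exp 1 * s)) ^ m * c)"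
proof (induction m)
  case 0
  then show ?case using F by simp
next
  case (Suc m)
  let ?R = "R * exp (- (real m * s))" and ?R' = "R * exp (- (real (Suc m) * s))"
  let ?n = "nvar TYPE('n)"
  have n: "?n > 0" using nvar_ge[where 'n = 'n] by linarith
  have RR: "?R' = ?R * exp (- s)" by (simp add: exp_add[symmetric] algebra_simps)
  have 1: "wle ?R' (eul (lie_pow X m F)) ((x / (exp 1 * s)) ^ m * c / (exp 1 * s))"
    unfolding RR by (rule wle_eul[OF Suc s]) (use R in simp)
  have R'R: "?R' \<le> R" "0 < ?R'" using R s by simp_all
  have "O_ord 2 (eul X)" using O_ord_eul[OF X(1)] by (rule O_ord_le) simp
  from wle_ord[OF X(2) this R'R(2,1)]
  have 2: "wle ?R' (eul X) (x * ?R' ^ 2 / ?n)"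
    using R by (simp add: power_divide power_mult_distrib mult.assoc)
  have "wle ?R' (ser_bracket X (lie_pow X m F))
     (?n * (x * ?R' ^ 2 / ?n) * ((x / (exp 1 * s)) ^ m * c / (exp 1 * s)) / ?R' ^ 2)"
    by (rule wle_bracket[OF 2 1 R'R(2)])
  also have "?n * (x * ?R' ^ 2 / ?n) * ((x / (exp 1 * s)) ^ m * c / (exp 1 * s)) / ?R' ^ 2 =
      (x / (exp 1 * s)) ^ Suc m * c"
    using n R by (simp add: field_simps)
  finally show ?case by simp
qed

lemma power_self_le_exp_fact: "real m ^ m \<le> exp 1 ^ m * fact m"
proof -
  have "inverse (fact m) * real m ^ m \<le> exp (real m)"
    using sum_le_suminf[OF summable_exp[of "real m"], of "{m}"] by (simp add: exp_def)
  then show ?thesis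
    by (simp add: exp_of_nat_mult[symmetric] field_simps)
qed

text \<open>The loss \<open>d\<close> is divided equally among the \<open>m\<close> brackets. The
  resulting power \<open>m ^ m\<close> is absorbed by the factors \<open>exp 1\<close> of the Cauchy
  estimates together with the factorial.\<close>

lemma wle_lie_term:
  fixes F :: "'n::finite ser"
  assumes X: "O_ord 3 X" "wle R (eul X) (x * R ^ 2 / nvar TYPE('n))" and x: "0 \<le> x"
    and F: "wle R F c" and R: "0 < R" and d: "0 < d"
  shows "wle (R * exp (- d)) (lie_term X m F) ((x / d) ^ m * c)"
proof (cases "m = 0")
  case True
  then show ?thesis using wle_mono_R[OF F, of "R * exp (- d)"] R d by simp
next
  case False
  define s where "s = d / m"
  have s: "0 < s" using d False by (simp add: s_def)
  have "real m * s = d" using False by (simp add: s_def)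
  with wle_lie_pow[OF X F R s, of m]
  have "wle (R * exp (- d)) (lie_pow X m F) ((x / (exp 1 * s)) ^ m * c)" by simp
  from wle_sscale[OF this, of "1 / fact m"]
  have "wle (R * exp (- d)) (lie_term X m F) (1 / fact m * ((x / (exp 1 * s)) ^ m * c))"
    by (simp add: lie_term_def norm_divide)
  moreover have "1 / fact m * ((x / (exp 1 * s)) ^ m * c) \<le> (x / d) ^ m * c"
  proof -
    have "1 / fact m * (x / (exp 1 * s)) ^ m = (x / d) ^ m * (real m ^ m / (exp 1 ^ m * fact m))"
      using d False by (simp add: s_def power_mult_distrib power_divide field_simps)
    also have "\<dots> \<le> (x / d) ^ m * 1"
      using power_self_le_exp_fact[of m] x d by (intro mult_left_mono) (auto simp: divide_simps)
    finally show ?thesis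
      using mult_right_mono[OF _ wle_nonneg[OF F], of "1 / fact m * (x / (exp 1 * s)) ^ m" "(x / d) ^ m"]
      by simp
  qed
  ultimately show ?thesis by (rule wle_mono)
qed

text \<open>The first bracket uses the given bound on \<open>eul F\<close>, and only the other
  \<open>m\<close> brackets spend the loss \<open>d\<close>. Compared with
  \<open>wle_lie_term\<close> one factor \<open>1 / d\<close> is saved, which is what makes losses
  of order \<open>1 / K\<close> affordable in \<open>averaging\<close>.\<close>

lemma wle_lie_term_Suc:
  fixes F :: "'n::finite ser"
  assumes X: "O_ord 3 X" "wle R (eul X) (x * R ^ 2 / nvar TYPE('n))" and x: "0 \<le> x"
    and F: "wle R (eul F) g" and R: "0 < R" and d: "0 < d"
  shows "wle (R * exp (- d)) (lie_term X (Suc m) F) ((x / d) ^ m * (x * g))"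
proof -
  have n: "nvar TYPE('n) > 0" using nvar_ge[where 'n = 'n] by linarith
  have "wle R (ser_bracket X F) (x * g)"
    using wle_bracket[OF X(2) F R] n R by simp
  from wle_lie_term[OF X x this R d, of m]
  have "wle (R * exp (- d)) (lie_term X m (ser_bracket X F)) ((x / d) ^ m * (x * g))" .
  then show ?thesis
  proof (rule wle_le)
    fix k
    have "lie_term X (Suc m) F k = lie_term X m (ser_bracket X F) k / of_nat (Suc m)"
      unfolding lie_term_def lie_pow_Suc2 sscale_apply fact_Suc by simp
    then show "cmod (lie_term X (Suc m) F k) \<le> cmod (lie_term X m (ser_bracket X F) k)"
      by (simp add: norm_divide divide_le_eq mult_le_cancel_left1 del: of_nat_Suc)
  qed (use R in simp)
qed

text \<open>Each coefficient of \<open>G\<close> is a finite sum of its own length; a finite set of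
  indices admits a common length \<open>M\<close>, and the geometric bound does not depend on
  it.\<close>

lemma wle_series:
  fixes G :: "'n::finite ser"
  assumes H: "\<And>m. wle R (H m) (q ^ m * c)" and q: "0 \<le> q" "q \<le> 1 / 2" and R: "0 \<le> R"
    and G: "\<And>k M. deg k \<le> M \<Longrightarrow> G k = (\<Sum>m\<le>M. H m k)"
  shows "wle R G (2 * c)"
  unfolding wle_def
proof (intro allI impI)
  fix A :: "'n midx set" assume A: "finite A"
  have c: "0 \<le> c" using wle_nonneg[OF H[of 0]] by simp
  define M where "M = (\<Sum>k\<in>A. deg k)"
  have M: "deg k \<le> M" if "k \<in> A" for k
    unfolding M_def by (rule member_le_sum) (use that A in auto)
  have "(\<Sum>k\<in>A. cmod (G k) * R ^ deg k) \<le> (\<Sum>k\<in>A. \<Sum>m\<le>M. cmod (H m k) * R ^ deg k)"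
  proof (rule sum_mono)
    fix k assume "k \<in> A"
    then have "cmod (G k) \<le> (\<Sum>m\<le>M. cmod (H m k))" using G[OF M] norm_sum by metis
    then show "cmod (G k) * R ^ deg k \<le> (\<Sum>m\<le>M. cmod (H m k) * R ^ deg k)"
      unfolding sum_distrib_right[symmetric] using R by (intro mult_right_mono) auto
  qed
  also have "\<dots> = (\<Sum>m\<le>M. \<Sum>k\<in>A. cmod (H m k) * R ^ deg k)" by (rule sum.swap)
  also have "\<dots> \<le> (\<Sum>m\<le>M. (1/2) ^ m * c)"
  proof (rule sum_mono)
    fix m
    have "(\<Sum>k\<in>A. cmod (H m k) * R ^ deg k) \<le> q ^ m * c" by (rule wleD[OF H A])
    also have "\<dots> \<le> (1/2) ^ m * c" by (intro mult_right_mono power_mono q c)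
    finally show "(\<Sum>k\<in>A. cmod (H m k) * R ^ deg k) \<le> (1/2) ^ m * c" .
  qed
  also have "\<dots> = (\<Sum>m\<le>M. (1/2) ^ m) * c" by (simp add: sum_distrib_right)
  also have "\<dots> \<le> 2 * c"
  proof (rule mult_right_mono[OF _ c])
    have "(\<Sum>m\<le>M. (1/2) ^ m) = 2 - (1/2 :: real) ^ M" by (induction M) auto
    then show "(\<Sum>m\<le>M. (1/2 :: real) ^ m) \<le> 2" by simp
  qed
  finally show "(\<Sum>k\<in>A. cmod (G k) * R ^ deg k) \<le> 2 * c" .
qed

context
  fixes X :: "'n::finite ser" and R x d :: real
  assumes X: "O_ord 3 X" "wle R (eul X) (x * R ^ 2 / nvar TYPE('n))"
    and x: "0 \<le> x" "x \<le> d / 2" and R: "0 < R" and d: "0 < d"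
begin

lemma lie_ratio: "0 \<le> x / d" "x / d \<le> 1 / 2"
  using x d by (simp_all add: field_simps)

lemma wle_lie_exp:
  assumes "wle R F c" shows "wle (R * exp (- d)) (lie_exp X F) (2 * c)"
proof (rule wle_series[OF wle_lie_term[OF X x(1) assms R d] lie_ratio])
  show "lie_exp X F k = (\<Sum>m\<le>M. lie_term X m F k)" if "deg k \<le> M" for k M
    using that by (rule lie_exp_trunc[OF X(1)])
qed (use R in simp)

lemma lie_exp_minus_self:
  assumes "deg k \<le> M" shows "(lie_exp X F - F) k = (\<Sum>m\<le>M. lie_term X (Suc m) F k)"
proof -
  have "lie_exp X F k = (\<Sum>m\<le>Suc M. lie_term X m F k)"
    by (rule lie_exp_trunc[OF X(1)]) (use assms in simp)
  then show ?thesis unfolding minus_apply sum.atMost_Suc_shift by simp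
qed

lemma wle_lie_exp_diff:
  assumes "wle R (eul F) g" shows "wle (R * exp (- d)) (lie_exp X F - F) (2 * (x * g))"
proof (rule wle_series[OF wle_lie_term_Suc[OF X x(1) assms R d] lie_ratio])
  show "(lie_exp X F - F) k = (\<Sum>m\<le>M. lie_term X (Suc m) F k)" if "deg k \<le> M" for k M
    using that by (rule lie_exp_minus_self)
qed (use R in simp)

text \<open>If \<open>{X, H} = - P\<close>, the terms of the Lie series of \<open>H\<close> combine with those of \<open>P\<close>.\<close>

lemma lie_exp_homological:
  assumes H: "ser_bracket X H = - P" and M: "deg k \<le> M"
  shows "(lie_exp X (H + P) - H) k = (\<Sum>m\<le>M. (1 - 1 / of_nat (m + 2)) * lie_term X (Suc m) P k)"
proof -
  have t: "lie_term X (Suc m) H = sscale (- 1 / of_nat (Suc m)) (lie_term X m P)" for m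
  proof (rule sscale_cancel)
    show "sscale (of_nat (Suc m)) (lie_term X (Suc m) H) =
      sscale (of_nat (Suc m)) (sscale (- 1 / of_nat (Suc m)) (lie_term X m P))"
      unfolding lie_term_def lie_pow_Suc2 H sscale_sscale fact_Suc
      by (simp add: lie_pow_sscale divide_simps flip: sscale_minus_one del: of_nat_Suc)
  qed (simp del: of_nat_Suc)
  \<comment> \<open>The series of \<open>H\<close> runs ahead of that of \<open>P\<close>: its terms
    0 and 1 are \<open>H\<close> and \<open>- P\<close>, and its term \<open>m + 2\<close> is term
    \<open>m + 1\<close> of \<open>P\<close> times \<open>- 1 / (m + 2)\<close>.\<close>
  have "lie_exp X H k = (\<Sum>m\<le>Suc (Suc M). lie_term X m H k)"
    by (rule lie_exp_trunc[OF X(1)]) (use M in simp)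
  also have "\<dots> = H k - P k + (\<Sum>m\<le>M. - 1 / of_nat (m + 2) * lie_term X (Suc m) P k)"
    unfolding sum.atMost_Suc_shift[of _ "Suc M"] sum.atMost_Suc_shift[of _ M] t sscale_apply by simp
  finally have 1: "lie_exp X H k = \<dots>" .
  have 2: "lie_exp X P k = P k + (\<Sum>m\<le>M. lie_term X (Suc m) P k)"
    using lie_exp_minus_self[OF M, of P] by (simp add: minus_apply algebra_simps)
  show ?thesis
    unfolding lie_exp_add minus_apply plus_fun_apply 1 2 left_diff_distrib sum_subtractf
    by (simp add: sum_negf)
qed

text \<open>\<open>P\<close> cancels against the first Lie term of \<open>H\<close>, so every
  remaining term contains a bracket of \<open>X\<close> with \<open>P\<close>. Since
  \<open>x\<close> is itself proportional to the size of \<open>P\<close> once \<open>X\<close>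
  solves the homological equation, the remainder is quadratically small.\<close>

lemma wle_lie_exp_homological:
  assumes P: "wle R P c" and H: "ser_bracket X H = - P"
  shows "wle (R * exp (- d)) (lie_exp X (H + P) - H) (2 * (x / d * c))"
proof (rule wle_series[OF _ lie_ratio])
  let ?H = "\<lambda>m. sscale (1 - 1 / of_nat (m + 2)) (lie_term X (Suc m) P)"
  show "wle (R * exp (- d)) (?H m) ((x / d) ^ m * (x / d * c))" for m
  proof -
    have "wle (R * exp (- d)) (lie_term X (Suc m) P) ((x / d) ^ m * (x / d * c))"
      using wle_lie_term[OF X x(1) P R d, of "Suc m"] by (simp add: mult_ac)
    then show ?thesis
    proof (rule wle_le)
      fix k
      have "1 - 1 / of_nat (m + 2) = complex_of_real (1 - 1 / real (m + 2))" by simp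
      then have "cmod (1 - 1 / of_nat (m + 2)) = \<bar>1 - 1 / real (m + 2)\<bar>"
        by (simp only: norm_of_real)
      also have "\<dots> \<le> 1" by (simp add: abs_le_iff field_simps)
      finally show "cmod (?H m k) \<le> cmod (lie_term X (Suc m) P k)"
        unfolding sscale_apply norm_mult by (rule mult_left_le_one_le[OF norm_ge_zero norm_ge_zero])
    qed (use R in simp)
  qed
  show "(lie_exp X (H + P) - H) k = (\<Sum>m\<le>M. ?H m k)" if "deg k \<le> M" for k M
    unfolding sscale_apply by (rule lie_exp_homological[OF H that])
  show "0 \<le> R * exp (- d)" using R by simp
qed

end


section \<open>Evaluation of convergent series\<close>

definition pcmp :: "'n::finite pt \<Rightarrow> 'n + 'n \<Rightarrow> complex" where
  "pcmp z = case_sum (\<lambda>j. fst z $ j) (\<lambda>j. snd z $ j)"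

lemma pcmp_simps [simp]: "pcmp z (Inl j) = fst z $ j" "pcmp z (Inr j) = snd z $ j"
  by (simp_all add: pcmp_def)

lemma pt_eqI: "(\<And>v. pcmp z v = pcmp w v) \<Longrightarrow> z = w"
  by (metis pcmp_simps prod_eq_iff vec_eq_iff)

lemma pcmp_zero [simp]: "pcmp 0 v = 0"
  by (cases v) simp_all

lemma polydisc_iff: "z \<in> polydisc R \<longleftrightarrow> (\<forall>v. cmod (pcmp z v) < R)"
  by (auto simp: polydisc_def split_sum_all)

lemma monomial_eq: "monomial k z = (\<Prod>v\<in>UNIV. pcmp z v ^ cmp k v)"
  by (simp add: monomial_def prod_UNIV_Plus prod.distrib)

lemma monomial_add: "monomial (k + l) z = monomial k z * monomial l z"
  by (simp add: monomial_eq power_add prod.distrib)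

lemma monomial_zero [simp]: "monomial 0 z = 1"
  by (simp add: monomial_eq)

lemma monomial_unit [simp]: "monomial (unit_idx v) z = pcmp z v"
proof -
  have "monomial (unit_idx v) z = (\<Prod>u\<in>UNIV. if u = v then pcmp z u else 1)"
    unfolding monomial_eq by (rule prod.cong) auto
  then show ?thesis by simp
qed

lemma norm_monomial_le:
  assumes "\<And>v. cmod (pcmp z v) \<le> R" shows "cmod (monomial k z) \<le> R ^ deg k"
proof -
  have "cmod (monomial k z) \<le> (\<Prod>v\<in>UNIV. R ^ cmp k v)"
    unfolding monomial_eq prod_norm[symmetric]
    by (rule prod_mono) (simp add: norm_power power_mono assms)
  then show ?thesis by (simp add: deg_eq power_sum)
qed

lemma polydisc_shrink:
  assumes "z \<in> polydisc R" "0 < R"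
  obtains R' where "0 < R'" "R' < R" "z \<in> polydisc R'"
proof -
  define m where "m = Max (range (\<lambda>v. cmod (pcmp z v)))"
  have m: "cmod (pcmp z v) \<le> m" for v unfolding m_def by (rule Max_ge) auto
  have "m \<in> range (\<lambda>v. cmod (pcmp z v))" unfolding m_def by (rule Max_in) auto
  then have mR: "m < R" "0 \<le> m" using assms(1) by (auto simp: polydisc_iff)
  have "cmod (pcmp z v) < (m + R) / 2" for v using m[of v] mR by simp
  then show ?thesis using mR that[of "(m + R) / 2"] by (auto simp: polydisc_iff)
qed

lemma polydisc_mono: "z \<in> polydisc R \<Longrightarrow> R \<le> R' \<Longrightarrow> z \<in> polydisc R'"
  by (auto simp: polydisc_iff intro: less_le_trans)

lemma eval_terms_bound:
  assumes "wle R F c" "z \<in> polydisc R" "finite A"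
  shows "(\<Sum>k\<in>A. cmod (F k * monomial k z)) \<le> c"
proof -
  have "(\<Sum>k\<in>A. cmod (F k * monomial k z)) \<le> (\<Sum>k\<in>A. cmod (F k) * R ^ deg k)"
    unfolding norm_mult using assms(2)
    by (intro sum_mono mult_left_mono norm_monomial_le) (auto simp: polydisc_iff intro: less_imp_le)
  also have "\<dots> \<le> c" by (rule wleD[OF assms(1,3)])
  finally show ?thesis .
qed

lemma eval_abs_summable:
  assumes "wle R F c" "z \<in> polydisc R"
  shows "(\<lambda>k. cmod (F k * monomial k z)) summable_on UNIV"
  unfolding abs_summable_iff_bdd_above
  by (rule bdd_aboveI[of _ c]) (use eval_terms_bound[OF assms] in auto)

lemma eval_summable:
  assumes "wle R F c" "z \<in> polydisc R"
  shows "(\<lambda>k. F k * monomial k z) summable_on UNIV"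
  using eval_abs_summable[OF assms] by (rule abs_summable_summable)

lemma eval_bound:
  assumes "wle R F c" "z \<in> polydisc R" shows "cmod (ser_eval F z) \<le> c"
proof -
  have "cmod (ser_eval F z) \<le> (\<Sum>\<^sub>\<infinity>k. cmod (F k * monomial k z))"
    unfolding ser_eval_def by (rule norm_infsum_bound[OF eval_abs_summable[OF assms]])
  also have "\<dots> \<le> c"
    by (rule infsum_le_finite_sums[OF eval_abs_summable[OF assms]]) (rule eval_terms_bound[OF assms])
  finally show ?thesis .
qed

lemma eval_add:
  assumes "wle R F c" "wle R G d" "z \<in> polydisc R"
  shows "ser_eval (F + G) z = ser_eval F z + ser_eval G z"
  using infsum_add[OF eval_summable[OF assms(1,3)] eval_summable[OF assms(2,3)]]
  by (simp add: ser_eval_def ser_apply algebra_simps)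

lemma eval_sscale: "ser_eval (sscale c F) z = c * ser_eval F z"
  by (simp add: ser_eval_def ser_apply mult.assoc infsum_cmult_right')

lemma eval_zero [simp]: "ser_eval 0 z = 0"
  by (simp add: ser_eval_def ser_apply)

lemma eval_sum:
  assumes "\<And>i. i \<in> I \<Longrightarrow> wle R (F i) (c i)" "z \<in> polydisc R" "0 \<le> R"
  shows "ser_eval (\<Sum>i\<in>I. F i) z = (\<Sum>i\<in>I. ser_eval (F i) z)"
  using assms(1)
proof (induction I rule: infinite_finite_induct)
  case (insert i I)
  have "wle R (\<Sum>i\<in>I. F i) (\<Sum>i\<in>I. c i)" by (rule wle_sum) (use insert assms in auto)
  then have "ser_eval (F i + (\<Sum>i\<in>I. F i)) z = ser_eval (F i) z + ser_eval (\<Sum>i\<in>I. F i) z"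
    using insert.prems by (intro eval_add[OF _ _ assms(2)]) auto
  moreover have "ser_eval (\<Sum>i\<in>I. F i) z = (\<Sum>i\<in>I. ser_eval (F i) z)"
    using insert by blast
  ultimately show ?case using insert by simp
qed auto

lemma eval_smono: "ser_eval (smono k) z = monomial k z"
proof -
  have "((\<lambda>l. smono k l * monomial l z) has_sum monomial k z) UNIV"
    by (rule has_sum_finite_neutralI[of "{k}"]) (auto simp: smono_def)
  then show ?thesis unfolding ser_eval_def by (rule infsumI)
qed

section \<open>Truncation, and evaluation as a ring homomorphism\<close>

definition trunc :: "nat \<Rightarrow> 'n::finite ser \<Rightarrow> 'n ser" where
  "trunc n F = (\<Sum>k\<in>{k. deg k < n}. sscale (F k) (smono k))"

lemma finite_deg_less: "finite {k :: 'n::finite midx. deg k < n}"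
  by (rule finite_subset[OF _ finite_deg_le[of n]]) auto

lemma trunc_apply: "trunc n F k = (if deg k < n then F k else 0)"
proof -
  have "trunc n F k = (\<Sum>l\<in>{l. deg l < n}. if l = k then F k else 0)"
    unfolding trunc_def ser_sum_apply by (rule sum.cong) (auto simp: smono_def ser_apply)
  then show ?thesis by (simp add: sum.delta' finite_deg_less)
qed

lemma eval_trunc: "ser_eval (trunc n F) z = (\<Sum>k\<in>{k. deg k < n}. F k * monomial k z)"
proof -
  have "((\<lambda>k. trunc n F k * monomial k z) has_sum (\<Sum>k\<in>{k. deg k < n}. F k * monomial k z)) UNIV"
    by (rule has_sum_finite_neutralI[OF finite_deg_less]) (auto simp: trunc_apply)
  then show ?thesis unfolding ser_eval_def by (rule infsumI)
qed

lemma O_ord_trunc: "O_ord n (F - trunc n F)"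
  unfolding O_ord_def by (simp add: ser_apply trunc_apply)

lemma wle_trunc: "wle R F c \<Longrightarrow> 0 \<le> R \<Longrightarrow> wle R (trunc n F) c"
  by (rule wle_le) (auto simp: trunc_apply)

lemma wle_tail: "wle R F c \<Longrightarrow> 0 \<le> R \<Longrightarrow> wle R (F - trunc n F) c"
  by (rule wle_le) (auto simp: trunc_apply ser_apply)

lemma eval_trunc_diff:
  assumes "wle R F c" "z \<in> polydisc R" "0 \<le> R"
  shows "ser_eval F z = ser_eval (trunc n F) z + ser_eval (F - trunc n F) z"
  using eval_add[OF wle_trunc[OF assms(1,3)] wle_tail[OF assms(1,3)] assms(2), of n n] by simp

text \<open>Identities that are continuous in the weighted norm need only be checked for polynomials.\<close>

lemma eq_from_geometric_bound:
  assumes q: "0 \<le> q" "q < 1" and b: "\<And>n :: nat. cmod (a - b) \<le> c * q ^ n" shows "a = b"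
proof -
  have "(\<lambda>n. c * q ^ n) \<longlonglongrightarrow> c * 0"
    by (intro tendsto_mult tendsto_const LIMSEQ_realpow_zero q)
  then have "cmod (a - b) \<le> c * 0" by (rule tendsto_lowerbound) (use b in auto)
  then show ?thesis by simp
qed

lemma eval_mult:
  fixes F :: "'n::finite ser"
  assumes F: "wle R F c" and G: "wle R G d" and z: "z \<in> polydisc R" and R: "0 < R"
  shows "ser_eval (ser_mult F G) z = ser_eval F z * ser_eval G z"
proof -
  obtain R' where R': "0 < R'" "R' < R" "z \<in> polydisc R'" using polydisc_shrink[OF z R] .
  define q where "q = R' / R"
  have q: "0 \<le> q" "q < 1" using R' R by (auto simp: q_def)
  have cd: "0 \<le> c" "0 \<le> d" using wle_nonneg F G by auto
  have mono: "ser_eval (ser_mult (trunc n F) (trunc n G)) z = ser_eval (trunc n F) z * ser_eval (trunc n G) z" for n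
  proof -
    have "ser_mult (trunc n F) (trunc n G) =
      (\<Sum>l\<in>{l. deg l < n}. \<Sum>k\<in>{k. deg k < n}. sscale (F k * G l) (smono (k + l)))"
      unfolding trunc_def ser_mult_sum_left ser_mult_sum ser_mult_scale ser_mult_scale_left smono_add sscale_sum sscale_sscale
      by (simp add: mult.commute)
    moreover have w: "wle R (sscale (F k * G l) (smono (k + l))) (cmod (F k * G l) * R ^ deg (k + l))" for k l
      by (intro wle_sscale wle_smono) (use R in auto)
    moreover have "wle R (\<Sum>k\<in>{k. deg k < n}. sscale (F k * G l) (smono (k + l)))
        (\<Sum>k\<in>{k. deg k < n}. cmod (F k * G l) * R ^ deg (k + l))" for l
      by (rule wle_sum[OF w]) (use R in auto)
    from eval_sum[OF this z] have "ser_eval (\<Sum>l\<in>{l. deg l < n}. \<Sum>k\<in>{k. deg k < n}. sscale (F k * G l) (smono (k + l))) z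
       = (\<Sum>l\<in>{l. deg l < n}. ser_eval (\<Sum>k\<in>{k. deg k < n}. sscale (F k * G l) (smono (k + l))) z)"
      using R by simp
    moreover have "ser_eval (\<Sum>k\<in>{k. deg k < n}. sscale (F k * G l) (smono (k + l))) z =
        (\<Sum>k\<in>{k. deg k < n}. F k * G l * monomial (k + l) z)" for l
      using R by (subst eval_sum[OF w z]) (simp_all add: eval_sscale eval_smono)
    ultimately have "ser_eval (ser_mult (trunc n F) (trunc n G)) z =
      (\<Sum>l\<in>{l. deg l < n}. \<Sum>k\<in>{k. deg k < n}. F k * G l * monomial (k + l) z)"
      by simp
    then show ?thesis
      unfolding eval_trunc sum_product by (subst sum.swap) (simp add: monomial_add mult_ac)
  qed
  show ?thesis
  proof (rule eq_from_geometric_bound[OF q])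
    fix n
    let ?F = "trunc n F" and ?G = "trunc n G"
    let ?f = "F - ?F" and ?g = "G - ?G"
    have f: "wle R ?f c" "wle R ?F c" and g: "wle R ?g d" "wle R ?G d"
      using wle_tail[OF F] wle_trunc[OF F] wle_tail[OF G] wle_trunc[OF G] R by auto
    have small: "cmod (ser_eval H z) \<le> e * q ^ n" if "wle R H e" "O_ord n H" for H e
      using eval_bound[OF wle_ord[OF that R'(1)] R'(3)] R'(2) by (simp add: q_def)
    have sf: "cmod (ser_eval ?f z) \<le> c * q ^ n" "cmod (ser_eval ?g z) \<le> d * q ^ n"
      by (rule small[OF f(1) O_ord_trunc], rule small[OF g(1) O_ord_trunc])
    have w1: "wle R (ser_mult ?f G) (c * d)" and w2: "wle R (ser_mult ?F ?g) (c * d)"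
      and w3: "wle R (ser_mult ?F ?G) (c * d)"
      using R by (auto intro!: wle_mult f g G)
    have s1: "cmod (ser_eval (ser_mult ?f G) z) \<le> c * d * q ^ n"
      by (rule small[OF w1]) (use O_ord_mult[OF O_ord_trunc O_ord_0(1)] in simp)
    have s2: "cmod (ser_eval (ser_mult ?F ?g) z) \<le> c * d * q ^ n"
      by (rule small[OF w2]) (use O_ord_mult[OF O_ord_0(1) O_ord_trunc] in simp)
    have "ser_mult F G = (ser_mult ?F ?G + ser_mult ?F ?g) + ser_mult ?f G"
      by (simp only: ser.distrib_right[symmetric] ser.distrib_left[symmetric] diff_add_cancel add_diff_cancel_left')
         (simp add: ser_mult_add[symmetric] ser.distrib_right[symmetric])
    then have e: "ser_eval (ser_mult F G) z =
        ser_eval ?F z * ser_eval ?G z + ser_eval (ser_mult ?F ?g) z + ser_eval (ser_mult ?f G) z"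
      using eval_add[OF wle_add[OF w3 w2] w1 z] eval_add[OF w3 w2 z] R by (simp add: mono)
    have "ser_eval F z * ser_eval G z = ser_eval ?F z * ser_eval ?G z + ser_eval ?F z * ser_eval ?g z + ser_eval ?f z * ser_eval G z"
      using eval_trunc_diff[OF F z, of n] eval_trunc_diff[OF G z, of n] R by (simp add: algebra_simps)
    with e have "ser_eval (ser_mult F G) z - ser_eval F z * ser_eval G z =
       (ser_eval (ser_mult ?F ?g) z + ser_eval (ser_mult ?f G) z) - (ser_eval ?F z * ser_eval ?g z + ser_eval ?f z * ser_eval G z)"
      by simp
    also have "cmod \<dots> \<le> (c * d * q ^ n + c * d * q ^ n) + (c * (d * q ^ n) + (c * q ^ n) * d)"
    proof (rule order_trans[OF norm_triangle_ineq4], rule add_mono)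
      show "cmod (ser_eval (ser_mult ?F ?g) z + ser_eval (ser_mult ?f G) z) \<le> c * d * q ^ n + c * d * q ^ n"
        by (rule order_trans[OF norm_triangle_ineq add_mono[OF s2 s1]])
      have "cmod (ser_eval ?F z * ser_eval ?g z) \<le> c * (d * q ^ n)"
        unfolding norm_mult by (intro mult_mono eval_bound[OF f(2) z] sf cd norm_ge_zero)
      moreover have "cmod (ser_eval ?f z * ser_eval G z) \<le> (c * q ^ n) * d"
        unfolding norm_mult by (intro mult_mono eval_bound[OF G z] sf) (use cd q in auto)
      ultimately show "cmod (ser_eval ?F z * ser_eval ?g z + ser_eval ?f z * ser_eval G z) \<le> c * (d * q ^ n) + (c * q ^ n) * d"
        by (rule order_trans[OF norm_triangle_ineq add_mono])
    qed
    finally show "cmod (ser_eval (ser_mult F G) z - ser_eval F z * ser_eval G z) \<le> 4 * c * d * q ^ n"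
      by (simp add: algebra_simps)
  qed
qed

lemma eval_origin: "O_ord 1 F \<Longrightarrow> ser_eval F 0 = 0"
proof -
  assume F: "O_ord 1 F"
  have "F k * monomial k 0 = 0" for k
  proof (cases "deg k = 0")
    case False
    then obtain l v where "k = l + unit_idx v" using deg_decomp by (metis gr0I)
    then show ?thesis by (simp add: monomial_add)
  qed (use O_ord_D[OF F] in simp)
  then show ?thesis unfolding ser_eval_def by (rule infsum_0)
qed


section \<open>Cauchy estimates\<close>

lemma sum_root_of_unity_powers:
  fixes w :: complex assumes "w ^ N = 1" shows "(\<Sum>j<N. w ^ j) = (if w = 1 then of_nat N else 0)"
  using assms geometric_sum[of w N] by auto

lemma root_of_unity_power_inj:
  fixes a b N :: nat
  assumes N: "0 < N" and ab: "a < N" "b < N"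
    and eq: "cis (2 * pi / N) ^ a * cis (- (2 * pi / N)) ^ b = 1"
  shows "a = b"
proof -
  have "cis (2 * pi / N * (real a - real b)) = 1"
    using eq by (simp add: Complex.DeMoivre cis_mult algebra_simps diff_divide_distrib)
  then have "cos (2 * pi / N * (real a - real b)) = 1" by (simp add: complex_eq_iff)
  then obtain m :: int where m: "2 * pi / N * (real a - real b) = m * 2 * pi"
    using cos_one_2pi_int by auto
  then have "(real a - real b) * (2 * pi) = (m * real N) * (2 * pi)" using N by (simp add: field_simps)
  then have "real a - real b = m * real N" by simp
  then have "int a - int b = m * int N" by (metis of_int_diff of_int_eq_iff of_int_mult of_int_of_nat_eq)
  moreover have "\<bar>int a - int b\<bar> < int N" using ab by auto
  ultimately have "\<bar>m\<bar> * int N < 1 * int N" by (simp add: abs_mult)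
  then have "m = 0" using N by (metis mult_less_cancel_right_pos of_nat_0_less_iff abs_ge_zero zless_imp_add1_zle linorder_not_less abs_le_zero_iff zle_add1_eq_le add_0)
  then show ?thesis using \<open>int a - int b = m * int N\<close> by simp
qed

text \<open>A discrete Cauchy formula: the average over the grid of \<open>N\<close>-th roots of
  unity on the torus of radius \<open>t\<close>, against the character \<open>ch\<close>, isolates
  \<open>F k\<close> exactly. No aliasing occurs, because all exponents of the truncation are below
  \<open>N\<close>.\<close>

lemma cauchy_estimate_trunc:
  fixes F :: "'n::finite ser"
  assumes t: "0 \<le> t" and k: "deg k < N"
    and b: "\<And>z. (\<And>v. cmod (pcmp z v) = t) \<Longrightarrow> cmod (ser_eval (trunc N F) z) \<le> B"
  shows "cmod (F k) * t ^ deg k \<le> B"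
proof -
  define \<zeta> where "\<zeta> = cis (2 * pi / N)"
  define \<eta> where "\<eta> = cis (- (2 * pi / N))"
  have N: "0 < N" using k by simp
  have zN: "\<zeta> ^ N = 1" using N by (simp add: \<zeta>_def Complex.DeMoivre)
  have "\<eta> = cnj \<zeta>" by (simp add: \<zeta>_def \<eta>_def cis_cnj)
  then have eN: "\<eta> ^ N = 1" by (metis complex_cnj_one complex_cnj_power zN)
  have nz: "cmod \<zeta> = 1" "cmod \<eta> = 1" by (simp_all add: \<zeta>_def \<eta>_def)
  define S where "S = PiE (UNIV :: ('n + 'n) set) (\<lambda>_. {..<N})"
  define p where "p g = ((\<chi> j. t * \<zeta> ^ g (Inl j), \<chi> j. t * \<zeta> ^ g (Inr j)) :: 'n pt)" for g
  have p: "pcmp (p g) v = t * \<zeta> ^ g v" for g v by (cases v) (simp_all add: p_def)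
  define ch where "ch g = (\<Prod>v\<in>UNIV. \<eta> ^ (g v * cmp k v))" for g :: "'n + 'n \<Rightarrow> nat"
  have orth: "(\<Sum>g\<in>S. monomial m (p g) * ch g) = (if m = k then of_nat (card S) * t ^ deg k else 0)"
    if m: "deg m < N" for m
  proof -
    have "(\<Sum>g\<in>S. monomial m (p g) * ch g) =
      t ^ deg m * (\<Sum>g\<in>S. \<Prod>v\<in>UNIV. (\<zeta> ^ cmp m v * \<eta> ^ cmp k v) ^ g v)"
      unfolding sum_distrib_left
    proof (rule sum.cong, simp)
      fix g
      have "monomial m (p g) = t ^ deg m * (\<Prod>v\<in>UNIV. \<zeta> ^ (g v * cmp m v))"
        by (simp add: monomial_eq p power_mult_distrib prod.distrib deg_eq power_sum power_mult)
      then show "monomial m (p g) * ch g = t ^ deg m * (\<Prod>v\<in>UNIV. (\<zeta> ^ cmp m v * \<eta> ^ cmp k v) ^ g v)"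
        by (simp add: ch_def prod.distrib power_mult_distrib power_mult[symmetric] mult.commute)
    qed
    also have "(\<Sum>g\<in>S. \<Prod>v\<in>UNIV. (\<zeta> ^ cmp m v * \<eta> ^ cmp k v) ^ g v) =
        (\<Prod>v\<in>UNIV. \<Sum>j<N. (\<zeta> ^ cmp m v * \<eta> ^ cmp k v) ^ j)"
      unfolding S_def by (rule prod_sum_PiE[symmetric]) auto
    also have "\<dots> = (\<Prod>v\<in>UNIV. if cmp m v = cmp k v then of_nat N else 0)"
    proof (rule prod.cong, simp)
      fix v
      have 1: "(\<zeta> ^ cmp m v * \<eta> ^ cmp k v) ^ N = 1"
        by (simp add: power_mult_distrib) (simp add: power_mult[symmetric] mult.commute[of _ N] power_mult zN eN)
      have ze: "\<zeta> * \<eta> = 1" by (simp add: \<zeta>_def \<eta>_def cis_mult)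
      have "(\<zeta> ^ cmp m v * \<eta> ^ cmp k v = 1) \<longleftrightarrow> cmp m v = cmp k v"
      proof
        assume "cmp m v = cmp k v"
        then show "\<zeta> ^ cmp m v * \<eta> ^ cmp k v = 1" by (simp add: power_mult_distrib[symmetric] ze)
      next
        assume "\<zeta> ^ cmp m v * \<eta> ^ cmp k v = 1"
        then show "cmp m v = cmp k v"
          using root_of_unity_power_inj[OF N, of "cmp m v" "cmp k v"] cmp_le_deg[of m v] cmp_le_deg[of k v] m k
          by (simp add: \<zeta>_def \<eta>_def)
      qed
      then show "(\<Sum>j<N. (\<zeta> ^ cmp m v * \<eta> ^ cmp k v) ^ j) = (if cmp m v = cmp k v then of_nat N else 0)"
        by (simp add: sum_root_of_unity_powers[OF 1])
    qed
    also have "\<dots> = (if m = k then of_nat (card S) else 0)"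
    proof (cases "m = k")
      case False
      then obtain v where "cmp m v \<noteq> cmp k v" using midx_eqI by blast
      then show ?thesis using False by (auto intro!: prod_zero)
    qed (simp add: S_def card_PiE)
    finally show ?thesis by simp
  qed
  have "(\<Sum>g\<in>S. ser_eval (trunc N F) (p g) * ch g) = (\<Sum>m\<in>{m. deg m < N}. F m * (\<Sum>g\<in>S. monomial m (p g) * ch g))"
    unfolding eval_trunc sum_distrib_right sum_distrib_left by (subst sum.swap) (simp add: mult.assoc)
  also have "\<dots> = (\<Sum>m\<in>{m. deg m < N}. if m = k then F k * (of_nat (card S) * t ^ deg k) else 0)"
    by (rule sum.cong) (auto simp: orth)
  also have "\<dots> = of_nat (card S) * (F k * t ^ deg k)"
    using k by (simp add: sum.delta' finite_deg_less)
  finally have "of_nat (card S) * (F k * t ^ deg k) = (\<Sum>g\<in>S. ser_eval (trunc N F) (p g) * ch g)" ..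
  from arg_cong[OF this, of cmod]
  have "real (card S) * (cmod (F k) * t ^ deg k) = cmod (\<Sum>g\<in>S. ser_eval (trunc N F) (p g) * ch g)"
    using t by (simp add: norm_mult norm_power)
  also have "\<dots> \<le> (\<Sum>g\<in>S. B)"
  proof (rule sum_norm_le)
    fix g
    have "cmod (ser_eval (trunc N F) (p g)) \<le> B"
      by (rule b) (use t in \<open>simp add: p norm_mult norm_power nz\<close>)
    moreover have "cmod (ch g) = 1" by (simp add: ch_def norm_power nz flip: prod_norm)
    ultimately show "cmod (ser_eval (trunc N F) (p g) * ch g) \<le> B" by (simp add: norm_mult)
  qed
  finally have "real (card S) * (cmod (F k) * t ^ deg k) \<le> real (card S) * B" by simp
  moreover have "0 < card S" using N by (simp add: S_def card_PiE)
  ultimately show ?thesis by simp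
qed

text \<open>The point with all coordinates \<open>s\<close> turns convergence into a finite weighted
  norm \<open>c\<close> at some \<open>s > t\<close>. The uncontrolled \<open>c\<close> enters only
  through the tail of the truncation, which tends to 0, so the sup norm alone remains.\<close>

lemma cauchy_estimate:
  fixes F :: "'n::finite ser"
  assumes F: "F \<in> A_space \<rho>" and t: "0 < t" "t < \<rho>"
  shows "cmod (F k) * t ^ deg k \<le> A_norm \<rho> F"
proof -
  let ?M = "A_norm \<rho> F"
  define s where "s = (t + \<rho>) / 2"
  have s: "t < s" "s < \<rho>" "0 < s" using t by (auto simp: s_def)
  define z0 where "z0 = ((\<chi> j. of_real s, \<chi> j. of_real s) :: 'n pt)"
  have z0: "pcmp z0 v = of_real s" for v by (cases v) (simp_all add: z0_def)
  have "z0 \<in> polydisc \<rho>" using s by (simp add: polydisc_iff z0)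
  then have "(\<lambda>k. cmod (F k * monomial k z0)) summable_on UNIV"
    using F by (simp add: A_space_def converges_on_def summable_on_iff_abs_summable_on_complex)
  moreover have "cmod (F k * monomial k z0) = cmod (F k) * s ^ deg k" for k
    using s by (simp add: norm_mult monomial_eq z0 norm_power deg_eq power_sum flip: prod_norm)
  ultimately have sm: "(\<lambda>k. cmod (F k) * s ^ deg k) summable_on UNIV" by simp
  define c where "c = (\<Sum>\<^sub>\<infinity>k. cmod (F k) * s ^ deg k)"
  have w: "wle s F c" unfolding wle_def c_def
    using s by (auto intro!: finite_sum_le_infsum sm)
  have M: "cmod (ser_eval F z) \<le> ?M" if "z \<in> polydisc \<rho>" for z
  proof -
    have "bdd_above ((\<lambda>z. cmod (ser_eval F z)) ` polydisc \<rho>)"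
      using F unfolding A_space_def bounded_iff by (auto simp: bdd_above_def)
    then show ?thesis unfolding A_norm_def by (rule cSUP_upper[OF that])
  qed
  have "cmod (F k) * t ^ deg k \<le> ?M + c * (t / s) ^ N" if N: "deg k < N" for N
  proof (rule cauchy_estimate_trunc[OF _ N])
    fix z :: "'n pt" assume z: "\<And>v. cmod (pcmp z v) = t"
    have zs: "z \<in> polydisc s" "z \<in> polydisc \<rho>" using z s by (auto simp: polydisc_iff)
    have zu: "z \<in> polydisc u'" if "t < u'" for u' using z that by (auto simp: polydisc_iff)
    \<comment> \<open>The torus of radius \<open>t\<close> lies outside the open polydisc of radius
      \<open>t\<close>; the estimate is made at radii \<open>u > t\<close> and passed to the
      limit.\<close>
    have tail: "cmod (ser_eval (F - trunc N F) z) \<le> c * (t / s) ^ N"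
    proof (rule tendsto_lowerbound)
      show "((\<lambda>u. c * (u / s) ^ N) \<longlongrightarrow> c * (t / s) ^ N) (at_right t)"
        by (intro tendsto_intros) (use s in auto)
      have "\<forall>\<^sub>F u in at_right t. u \<in> {t<..<s}" by (rule eventually_at_right_real[OF s(1)])
      then show "\<forall>\<^sub>F u in at_right t. cmod (ser_eval (F - trunc N F) z) \<le> c * (u / s) ^ N"
      proof (rule eventually_mono)
        fix u assume u: "u \<in> {t<..<s}"
        then have "wle u (F - trunc N F) (c * (u / s) ^ N)"
          using s t by (intro wle_ord[OF wle_tail[OF w] O_ord_trunc]) auto
        then show "cmod (ser_eval (F - trunc N F) z) \<le> c * (u / s) ^ N"
          by (rule eval_bound) (use zu u in auto)
      qed
    qed simp
    have "ser_eval (trunc N F) z = ser_eval F z - ser_eval (F - trunc N F) z"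
      using eval_trunc_diff[OF w zs(1), of N] s by simp
    then have "cmod (ser_eval (trunc N F) z) \<le> cmod (ser_eval F z) + cmod (ser_eval (F - trunc N F) z)"
      by (simp add: norm_triangle_ineq4)
    then show "cmod (ser_eval (trunc N F) z) \<le> ?M + c * (t / s) ^ N" using M[OF zs(2)] tail by linarith
  qed (use t in simp)
  then have ev: "\<forall>\<^sub>F N in sequentially. cmod (F k) * t ^ deg k \<le> ?M + c * (t / s) ^ N"
    by (auto intro: eventually_sequentiallyI[of "Suc (deg k)"])
  have "(\<lambda>N. ?M + c * (t / s) ^ N) \<longlonglongrightarrow> ?M + c * 0"
    by (intro tendsto_intros LIMSEQ_realpow_zero) (use s t in auto)
  then have "cmod (F k) * t ^ deg k \<le> ?M + c * 0" by (rule tendsto_lowerbound) (use ev in auto)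
  then show ?thesis by simp
qed

text \<open>The full sum is a product of \<open>2n\<close> geometric series, each of value
  2.\<close>

lemma sum_half_power_deg:
  fixes A :: "'n::finite midx set"
  assumes "finite A" shows "(\<Sum>k\<in>A. (1 / 2 :: real) ^ deg k) \<le> 4 ^ CARD('n)"
proof -
  define N where "N = Suc (\<Sum>k\<in>A. deg k)"
  have lt: "cmp k v < N" if "k \<in> A" for k v
    using member_le_sum[of k A deg] that assms cmp_le_deg[of k v] by (simp add: N_def)
  have inj: "inj_on cmp A" by (rule inj_onI) (metis midx_eqI)
  have "(\<Sum>k\<in>A. (1 / 2 :: real) ^ deg k) = (\<Sum>g\<in>cmp ` A. \<Prod>v\<in>UNIV. (1 / 2 :: real) ^ g v)"
    by (subst sum.reindex[OF inj]) (simp add: deg_eq power_sum)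
  also have "\<dots> \<le> (\<Sum>g\<in>PiE UNIV (\<lambda>_. {..<N}). \<Prod>v\<in>(UNIV :: ('n + 'n) set). (1 / 2 :: real) ^ g v)"
    by (rule sum_mono2) (use lt in \<open>auto intro!: finite_PiE prod_nonneg\<close>)
  also have "\<dots> = (\<Prod>v\<in>(UNIV :: ('n + 'n) set). \<Sum>j<N. (1 / 2 :: real) ^ j)"
    by (rule prod_sum_PiE[symmetric]) auto
  also have "\<dots> \<le> (\<Prod>v\<in>(UNIV :: ('n + 'n) set). 2)"
  proof (rule prod_mono, safe)
    have "(\<Sum>j<N. (1/2 :: real) ^ j) = 2 - 2 * (1/2) ^ N" by (induction N) auto
    then show "(\<Sum>j<N. (1/2 :: real) ^ j) \<le> 2" by simp
  qed (simp add: sum_nonneg)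
  also have "\<dots> = 4 ^ CARD('n)"
  proof -
    have "card (UNIV :: ('n + 'n) set) = CARD('n) * 2"
      by (simp add: UNIV_Plus_UNIV[symmetric] card_Plus del: UNIV_Plus_UNIV)
    then show ?thesis by (simp only: prod_constant power_mult mult.commute[of _ 2]) simp
  qed
  finally show ?thesis .
qed

text \<open>Cauchy estimates at radius \<open>\<rho> / 2\<close>, then halving the radius once more
  to make the sum over all indices converge: this is the origin of \<open>\<rho> / 4\<close> and of
  \<open>4 ^ CARD('n)\<close>.\<close>

lemma wle_A_space:
  fixes F :: "'n::finite ser"
  assumes F: "F \<in> A_space \<rho>" and r: "0 < \<rho>"
  shows "wle (\<rho> / 4) F (A_norm \<rho> F * 4 ^ CARD('n))"
  unfolding wle_def
proof (intro allI impI)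
  fix A :: "'n midx set" assume A: "finite A"
  have c: "cmod (F k) * (\<rho> / 2) ^ deg k \<le> A_norm \<rho> F" for k
    by (rule cauchy_estimate[OF F]) (use r in auto)
  have M: "0 \<le> A_norm \<rho> F" using order_trans[OF _ c[of 0]] r by simp
  have "(\<Sum>k\<in>A. cmod (F k) * (\<rho> / 4) ^ deg k) \<le> (\<Sum>k\<in>A. A_norm \<rho> F * (1 / 2) ^ deg k)"
  proof (rule sum_mono)
    fix k :: "'n midx"
    have "(\<rho> / 4) ^ deg k = (\<rho> / 2) ^ deg k * (1 / 2) ^ deg k"
      by (simp flip: power_mult_distrib)
    then show "cmod (F k) * (\<rho> / 4) ^ deg k \<le> A_norm \<rho> F * (1 / 2) ^ deg k"
      using mult_right_mono[OF c[of k], of "(1 / 2) ^ deg k"] by (simp add: mult.assoc)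
  qed
  also have "\<dots> \<le> A_norm \<rho> F * 4 ^ CARD('n)"
    unfolding sum_distrib_left[symmetric] by (rule mult_left_mono[OF sum_half_power_deg[OF A] M])
  finally show "(\<Sum>k\<in>A. cmod (F k) * (\<rho> / 4) ^ deg k) \<le> A_norm \<rho> F * 4 ^ CARD('n)" .
qed


section \<open>Complex derivatives and canonical maps\<close>

definition pt_inj :: "'n::finite + 'n \<Rightarrow> complex \<Rightarrow> 'n pt" where
  "pt_inj = case_sum (\<lambda>j c. (axis j c, 0)) (\<lambda>j c. (0, axis j c))"

text \<open>The gradient \<open>D\<close> runs over all \<open>2n\<close> variables; complex
  linearity is built into the shape of the derivative.\<close>

definition cderiv :: "('n::finite pt \<Rightarrow> complex) \<Rightarrow> ('n + 'n \<Rightarrow> complex) \<Rightarrow> 'n pt \<Rightarrow> bool" where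
  "cderiv F D z \<longleftrightarrow> (F has_derivative (\<lambda>h. \<Sum>v\<in>UNIV. pcmp h v * D v)) (at z)"

lemma pcmp_add [simp]: "pcmp (z + w) v = pcmp z v + pcmp w v"
  and pcmp_scaleR [simp]: "pcmp (r *\<^sub>R z) v = r *\<^sub>R pcmp z v"
  by (cases v; simp)+

lemma pcmp_sum: "pcmp (\<Sum>i\<in>I. f i) v = (\<Sum>i\<in>I. pcmp (f i) v)"
  by (induction I rule: infinite_finite_induct) auto

lemma pcmp_inj [simp]: "pcmp (pt_inj v c) u = (if u = v then c else 0)"
  by (cases v; cases u) (auto simp: pt_inj_def axis_def)

lemma pt_decomp: "z = (\<Sum>v\<in>UNIV. pt_inj v (pcmp z v))"
  by (rule pt_eqI) (simp add: pcmp_sum)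

lemma bounded_linear_pcmp: "bounded_linear (\<lambda>z. pcmp z v)"
  by (rule linear_conv_bounded_linear[THEN iffD1], rule linearI) simp_all

lemma bounded_linear_pt_inj: "bounded_linear (pt_inj v)"
  by (rule linear_conv_bounded_linear[THEN iffD1], rule linearI) (auto intro!: pt_eqI)

lemma norm_pcmp_le: "cmod (pcmp z v) \<le> norm z"
proof (cases v)
  case (Inl j)
  then show ?thesis using Finite_Cartesian_Product.norm_nth_le[of "fst z" j] norm_fst_le[of "fst z" "snd z"] by simp
next
  case (Inr j)
  then show ?thesis using Finite_Cartesian_Product.norm_nth_le[of "snd z" j] norm_snd_le[of "snd z" "fst z"] by simp
qed

lemma holo_on_iff: "holo_on F U \<longleftrightarrow> (\<forall>z\<in>U. \<exists>D. cderiv F D z)"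
proof
  assume h: "holo_on F U"
  show "\<forall>z\<in>U. \<exists>D. cderiv F D z"
  proof
    fix z assume "z \<in> U"
    then obtain f' where f': "(F has_derivative f') (at z)" "\<And>c v. f' (c *s fst v, c *s snd v) = c * f' v"
      using h by (auto simp: holo_on_def)
    have lin: "linear f'" using f'(1) by (simp add: has_derivative_bounded_linear bounded_linear.linear)
    have "f' h = (\<Sum>v\<in>UNIV. pcmp h v * f' (pt_inj v 1))" for h
    proof -
      have e: "pt_inj v c = (c *s fst (pt_inj v 1), c *s snd (pt_inj v 1))" for v c
        by (cases v) (auto simp: pt_inj_def vec_eq_iff axis_def)
      have A: "f' h = (\<Sum>v\<in>UNIV. f' (pt_inj v (pcmp h v)))"
        using linear_sum[OF lin, of "\<lambda>v. pt_inj v (pcmp h v)" UNIV] unfolding pt_decomp[of h, symmetric] .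
      have B: "f' (pt_inj v c) = c * f' (pt_inj v 1)" for v c
        using f'(2)[of c "pt_inj v 1"] unfolding e[of v c, symmetric] .
      show ?thesis unfolding A by (rule sum.cong[OF refl]) (rule B)
    qed
    then have "f' = (\<lambda>h. \<Sum>v\<in>UNIV. pcmp h v * f' (pt_inj v 1))" by blast
    then have "cderiv F (\<lambda>v. f' (pt_inj v 1)) z" using f'(1) unfolding cderiv_def by metis
    then show "\<exists>D. cderiv F D z" by blast
  qed
next
  have pc: "pcmp (c *s fst v, c *s snd v) u = c * pcmp v u" for c and v :: "'a pt" and u
    by (cases u) auto
  assume "\<forall>z\<in>U. \<exists>D. cderiv F D z"
  then show "holo_on F U"
    unfolding holo_on_def cderiv_def
  proof (intro ballI)
    fix z assume "\<forall>z\<in>U. \<exists>D. (F has_derivative (\<lambda>h. \<Sum>v\<in>UNIV. pcmp h v * D v)) (at z)" "z \<in> U"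
    then obtain D where "(F has_derivative (\<lambda>h. \<Sum>v\<in>UNIV. pcmp h v * D v)) (at z)" by blast
    then show "\<exists>f'. (F has_derivative f') (at z) \<and> (\<forall>c v. f' (c *s fst v, c *s snd v) = c * f' v)"
      by (intro exI[of _ "\<lambda>h. \<Sum>v\<in>UNIV. pcmp h v * D v"]) (simp add: pc sum_distrib_left mult.assoc)
  qed
qed

lemma cderiv_deriv:
  assumes "cderiv F D z" shows "deriv (\<lambda>t. F (z + pt_inj v t)) 0 = D v"
proof (rule DERIV_imp_deriv)
  have p0: "pt_inj v 0 = 0" by (rule pt_eqI) simp
  have 1: "((\<lambda>t. z + pt_inj v t) has_derivative (\<lambda>s. pt_inj v s)) (at 0)"
    using has_derivative_add[OF has_derivative_const bounded_linear.has_derivative[OF bounded_linear_pt_inj has_derivative_ident]]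
    by simp
  have "((\<lambda>t. F (z + pt_inj v t)) has_derivative (\<lambda>s. \<Sum>u\<in>UNIV. pcmp (pt_inj v s) u * D u)) (at 0)"
    by (rule has_derivative_compose[OF 1]) (use assms in \<open>simp add: p0 cderiv_def\<close>)
  moreover have "(\<lambda>s. \<Sum>u\<in>UNIV. pcmp (pt_inj v s) u * D u) = (*) (D v)"
  proof
    fix s
    have "(\<Sum>u\<in>UNIV. pcmp (pt_inj v s) u * D u) = (\<Sum>u\<in>UNIV. if u = v then D u * s else 0)"
      by (rule sum.cong) auto
    then show "(\<Sum>u\<in>UNIV. pcmp (pt_inj v s) u * D u) = D v * s" by simp
  qed
  ultimately show "((\<lambda>t. F (z + pt_inj v t)) has_field_derivative D v) (at 0)"
    by (simp add: has_field_derivative_def)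
qed

lemma bracket_cderiv:
  assumes F: "cderiv F D z" and G: "cderiv G E z"
  shows "bracket F G z = (\<Sum>v\<in>UNIV. \<i> * sgn_var v * (D v * E (conj_var v)))"
proof -
  have e: "z + pt_inj (Inl j) t = (fst z + axis j t, snd z)" "z + pt_inj (Inr j) t = (fst z, snd z + axis j t)" for j t
    by (auto simp: pt_inj_def prod_eq_iff)
  have pd: "pd_z j F z = D (Inl j)" "pd_zb j F z = D (Inr j)" "pd_z j G z = E (Inl j)" "pd_zb j G z = E (Inr j)" for j
    using cderiv_deriv[OF F] cderiv_deriv[OF G] unfolding pd_z_def pd_zb_def e[symmetric] by auto
  show ?thesis
    by (simp add: bracket_def pd sum_UNIV_Plus conj_var_def sgn_var_def sum_distrib_left sum_subtractf sum_negf algebra_simps)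
qed

lemma cderiv_chain:
  assumes F: "cderiv F D (\<Phi> w)" and P: "\<And>u. cderiv (\<lambda>w. pcmp (\<Phi> w) u) (E u) w"
  shows "cderiv (F \<circ> \<Phi>) (\<lambda>v. \<Sum>u\<in>UNIV. D u * E u v) w"
proof -
  have "((\<lambda>w. \<Sum>u\<in>UNIV. pt_inj u (pcmp (\<Phi> w) u)) has_derivative
      (\<lambda>h. \<Sum>u\<in>UNIV. pt_inj u (\<Sum>v\<in>UNIV. pcmp h v * E u v))) (at w)"
    using P unfolding cderiv_def
    by (intro has_derivative_sum bounded_linear.has_derivative[OF bounded_linear_pt_inj]) auto
  then have "(\<Phi> has_derivative (\<lambda>h. \<Sum>u\<in>UNIV. pt_inj u (\<Sum>v\<in>UNIV. pcmp h v * E u v))) (at w)"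
    by (simp only: pt_decomp[symmetric])
  from has_derivative_compose[OF this F[unfolded cderiv_def]]
  have "((\<lambda>x. F (\<Phi> x)) has_derivative
      (\<lambda>h. \<Sum>u\<in>UNIV. pcmp (\<Sum>u\<in>UNIV. pt_inj u (\<Sum>v\<in>UNIV. pcmp h v * E u v)) u * D u)) (at w)" .
  moreover have "(\<lambda>h. \<Sum>u\<in>UNIV. pcmp (\<Sum>u\<in>UNIV. pt_inj u (\<Sum>v\<in>UNIV. pcmp h v * E u v)) u * D u) =
      (\<lambda>h. \<Sum>v\<in>UNIV. pcmp h v * (\<Sum>u\<in>UNIV. D u * E u v))"
  proof
    fix h
    have "(\<Sum>u\<in>UNIV. pcmp (\<Sum>u\<in>UNIV. pt_inj u (\<Sum>v\<in>UNIV. pcmp h v * E u v)) u * D u) =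
      (\<Sum>u\<in>UNIV. (\<Sum>v\<in>UNIV. pcmp h v * E u v) * D u)"
      by (simp add: pcmp_sum)
    also have "\<dots> = (\<Sum>v\<in>UNIV. pcmp h v * (\<Sum>u\<in>UNIV. D u * E u v))"
      unfolding sum_distrib_left sum_distrib_right by (subst sum.swap) (simp add: mult_ac)
    finally show "(\<Sum>u\<in>UNIV. pcmp (\<Sum>u\<in>UNIV. pt_inj u (\<Sum>v\<in>UNIV. pcmp h v * E u v)) u * D u) = \<dots>" .
  qed
  ultimately show ?thesis by (simp add: cderiv_def o_def)
qed

text \<open>A pointwise version of the bracket condition, so that it composes without shrinking domains.\<close>

definition local_canonical :: "('n::finite pt \<Rightarrow> 'n pt) \<Rightarrow> 'n pt \<Rightarrow> bool" where
  "local_canonical \<Phi> w \<longleftrightarrow> (\<forall>u. \<exists>E. cderiv (\<lambda>w. pcmp (\<Phi> w) u) E w) \<and>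
     (\<forall>F G D D'. cderiv F D (\<Phi> w) \<and> cderiv G D' (\<Phi> w) \<longrightarrow>
        bracket (F \<circ> \<Phi>) (G \<circ> \<Phi>) w = bracket F G (\<Phi> w))"

lemma local_canonical_compose:
  assumes P: "local_canonical \<Phi> (\<Psi> w)" and Q: "local_canonical \<Psi> w"
  shows "local_canonical (\<Phi> \<circ> \<Psi>) w"
proof -
  obtain E where E: "\<And>u. cderiv (\<lambda>w. pcmp (\<Psi> w) u) (E u) w"
    using Q unfolding local_canonical_def by metis
  obtain E' where E': "\<And>u. cderiv (\<lambda>w. pcmp (\<Phi> w) u) (E' u) (\<Psi> w)"
    using P unfolding local_canonical_def by metis
  have c: "\<exists>D. cderiv ((\<lambda>w. pcmp (\<Phi> w) u) \<circ> \<Psi>) D w" for u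
    using cderiv_chain[OF E' E] by blast
  have b: "bracket (F \<circ> (\<Phi> \<circ> \<Psi>)) (G \<circ> (\<Phi> \<circ> \<Psi>)) w = bracket F G (\<Phi> (\<Psi> w))"
    if FG: "cderiv F D (\<Phi> (\<Psi> w))" "cderiv G D' (\<Phi> (\<Psi> w))" for F G D D'
  proof -
    have "bracket ((F \<circ> \<Phi>) \<circ> \<Psi>) ((G \<circ> \<Phi>) \<circ> \<Psi>) w = bracket (F \<circ> \<Phi>) (G \<circ> \<Phi>) (\<Psi> w)"
      using Q cderiv_chain[OF FG(1) E'] cderiv_chain[OF FG(2) E'] unfolding local_canonical_def by blast
    also have "\<dots> = bracket F G (\<Phi> (\<Psi> w))"
      using P FG unfolding local_canonical_def by blast
    finally show ?thesis by (simp add: o_assoc)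
  qed
  show ?thesis
    unfolding local_canonical_def using c b by (auto simp: o_def)
qed

text \<open>Condition \<open>J\<close> says that the coordinate functions of \<open>\<Phi>\<close>
  satisfy the canonical relations, that is, that the Jacobian matrix is symplectic; the chain rule
  extends this to all pairs of functions.\<close>

lemma local_canonicalI:
  fixes \<Phi> :: "'n::finite pt \<Rightarrow> 'n pt"
  assumes E: "\<And>u. cderiv (\<lambda>w. pcmp (\<Phi> w) u) (E u) w"
    and J: "\<And>a b. (\<Sum>v\<in>UNIV. \<i> * sgn_var v * (E a v * E b (conj_var v))) = (if b = conj_var a then \<i> * sgn_var a else 0)"
  shows "local_canonical \<Phi> w"
  unfolding local_canonical_def
proof (intro conjI allI impI)
  show "\<exists>E. cderiv (\<lambda>w. pcmp (\<Phi> w) u) E w" for u using E by blast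
  fix F G :: "'n pt \<Rightarrow> complex" and D D' :: "'n + 'n \<Rightarrow> complex"
  assume FG: "cderiv F D (\<Phi> w) \<and> cderiv G D' (\<Phi> w)"
  have "bracket (F \<circ> \<Phi>) (G \<circ> \<Phi>) w =
     (\<Sum>v\<in>UNIV. \<i> * sgn_var v * ((\<Sum>a\<in>UNIV. D a * E a v) * (\<Sum>b\<in>UNIV. D' b * E b (conj_var v))))"
    using FG by (intro bracket_cderiv cderiv_chain E) auto
  also have "\<dots> = (\<Sum>v\<in>UNIV. \<Sum>a\<in>UNIV. \<Sum>b\<in>UNIV. D a * D' b * (\<i> * sgn_var v * (E a v * E b (conj_var v))))"
    unfolding sum_product unfolding sum_distrib_left by (intro sum.cong refl) (simp add: mult_ac)
  also have "\<dots> = (\<Sum>a\<in>UNIV. \<Sum>b\<in>UNIV. D a * D' b * (\<Sum>v\<in>UNIV. \<i> * sgn_var v * (E a v * E b (conj_var v))))"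
    unfolding sum_distrib_left by (subst sum.swap, rule sum.cong[OF refl], subst sum.swap) simp
  also have "\<dots> = (\<Sum>a\<in>UNIV. \<Sum>b\<in>UNIV. if b = conj_var a then D a * D' b * (\<i> * sgn_var a) else 0)"
    unfolding J by (intro sum.cong refl) simp
  also have "\<dots> = (\<Sum>a\<in>UNIV. \<i> * sgn_var a * (D a * D' (conj_var a)))"
    by (simp add: mult_ac)
  also have "\<dots> = bracket F G (\<Phi> w)"
    using FG by (intro bracket_cderiv[symmetric]) auto
  finally show "bracket (F \<circ> \<Phi>) (G \<circ> \<Phi>) w = bracket F G (\<Phi> w)" .
qed

section \<open>Polydiscs and termwise differentiation\<close>

lemma open_polydisc: "open (polydisc R :: 'n::finite pt set)"
proof -
  have "(polydisc R :: 'n pt set) = (\<Inter>v. {z. cmod (pcmp z v) < R})" by (auto simp: polydisc_iff)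
  moreover have "open {z :: 'n pt. cmod (pcmp z v) < R}" for v
    by (intro open_Collect_less continuous_intros linear_continuous_on bounded_linear_pcmp)
  ultimately show ?thesis by (auto intro!: open_INT)
qed

lemma convex_polydisc: "convex (polydisc R :: 'n::finite pt set)"
proof (rule convexI)
  fix x y :: "'n pt" and u v :: real
  assume *: "x \<in> polydisc R" "y \<in> polydisc R" "0 \<le> u" "0 \<le> v" "u + v = 1"
  show "u *\<^sub>R x + v *\<^sub>R y \<in> polydisc R"
    unfolding polydisc_iff
  proof
    fix i
    have "cmod (pcmp (u *\<^sub>R x + v *\<^sub>R y) i) \<le> u * cmod (pcmp x i) + v * cmod (pcmp y i)"
      using norm_triangle_ineq[of "u *\<^sub>R pcmp x i" "v *\<^sub>R pcmp y i"] * by simp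
    also have "\<dots> < R" by (rule convex_bound_lt) (use * in \<open>auto simp: polydisc_iff\<close>)
    finally show "cmod (pcmp (u *\<^sub>R x + v *\<^sub>R y) i) < R" .
  qed
qed

lemma eul_smono: "eul (smono k) = sscale (of_nat (deg k)) (smono k)"
  by (rule ext) (simp add: eul_apply smono_def ser_apply)

lemma wle_sderiv_smono:
  assumes "0 < R" shows "wle R (sderiv v (smono k)) (real (deg k) * R ^ deg k / R)"
  using wle_sderiv[of R "smono k" "real (deg k) * R ^ deg k" v] wle_sscale[OF wle_smono[of R k], of "of_nat (deg k)"] assms
  by (simp add: eul_smono)

lemma cderiv_monomial: "cderiv (monomial k) (\<lambda>v. ser_eval (sderiv v (smono k)) z) z"
proof (induction k rule: midx_induct)
  case zero
  have "monomial 0 = (\<lambda>z :: 'a pt. 1)" by auto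
  then show ?case by (simp add: cderiv_def)
next
  case (add k u)
  obtain R where R: "0 < R" "z \<in> polydisc R"
  proof
    show "0 < norm z + 1" using norm_ge_zero[of z] by linarith
    show "z \<in> polydisc (norm z + 1)"
      unfolding polydisc_iff using norm_pcmp_le[of z] by (meson le_less_trans less_add_one)
  qed
  have wk: "wle R (smono l) (R ^ deg l)" for l :: "'a midx" by (rule wle_smono) (use R in simp)
  have ev: "ser_eval (sderiv v (smono (k + unit_idx u))) z =
      ser_eval (sderiv v (smono k)) z * pcmp z u + monomial k z * (if u = v then 1 else 0)" for v
  proof -
    have "sderiv v (smono (k + unit_idx u)) =
      ser_mult (sderiv v (smono k)) (smono (unit_idx u)) + ser_mult (smono k) (sderiv v (smono (unit_idx u)))"
      by (simp only: smono_add[symmetric] sderiv_mult)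
    moreover have "ser_eval (ser_mult (sderiv v (smono k)) (smono (unit_idx u)) + ser_mult (smono k) (sderiv v (smono (unit_idx u)))) z
      = ser_eval (ser_mult (sderiv v (smono k)) (smono (unit_idx u))) z + ser_eval (ser_mult (smono k) (sderiv v (smono (unit_idx u)))) z"
      using R by (intro eval_add[OF wle_mult[OF wle_sderiv_smono wk] wle_mult[OF wk wle_sderiv_smono]]) auto
    moreover have "ser_eval (ser_mult (sderiv v (smono k)) (smono (unit_idx u))) z = ser_eval (sderiv v (smono k)) z * pcmp z u"
      using eval_mult[OF wle_sderiv_smono[OF R(1)] wk R(2,1)] by (simp add: eval_smono)
    moreover have "ser_eval (ser_mult (smono k) (sderiv v (smono (unit_idx u)))) z = monomial k z * (if u = v then 1 else 0)"
      by (simp add: sderiv_smono_unit ser_mult_one[unfolded ser_mult_commute[of "smono 0"]] eval_smono ser.mult_zero_right)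
    ultimately show ?thesis by simp
  qed
  have "((\<lambda>z. monomial k z * pcmp z u) has_derivative
     (\<lambda>h. monomial k z * pcmp h u + (\<Sum>v\<in>UNIV. pcmp h v * ser_eval (sderiv v (smono k)) z) * pcmp z u)) (at z)"
    using add unfolding cderiv_def
    by (intro has_derivative_mult bounded_linear.has_derivative[OF bounded_linear_pcmp] has_derivative_ident)
  moreover have "(\<lambda>h. monomial k z * pcmp h u + (\<Sum>v\<in>UNIV. pcmp h v * ser_eval (sderiv v (smono k)) z) * pcmp z u) =
     (\<lambda>h. \<Sum>v\<in>UNIV. pcmp h v * ser_eval (sderiv v (smono (k + unit_idx u))) z)"
  proof
    fix h
    have "(\<Sum>v\<in>UNIV. pcmp h v * (monomial k z * (if u = v then 1 else 0))) =
        (\<Sum>v\<in>UNIV. if v = u then monomial k z * pcmp h v else 0)"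
      by (rule sum.cong) auto
    then show "monomial k z * pcmp h u + (\<Sum>v\<in>UNIV. pcmp h v * ser_eval (sderiv v (smono k)) z) * pcmp z u =
        (\<Sum>v\<in>UNIV. pcmp h v * ser_eval (sderiv v (smono (k + unit_idx u))) z)"
      unfolding ev distrib_left sum.distrib by (simp add: sum_distrib_right mult.assoc)
  qed
  ultimately show ?case by (simp add: cderiv_def monomial_add)
qed

lemma wle_sderiv_shrink:
  assumes F: "wle R F c" and R: "0 < R'" "R' < R"
  obtains e where "\<And>v. wle R' (sderiv v F) e"
proof -
  define s where "s = ln (R / R')"
  have s: "0 < s" using R by (simp add: s_def)
  have "R * exp (- s) = R'" using R by (simp add: s_def exp_minus)
  then have "wle R' (eul F) (c / (exp 1 * s))" using wle_eul[OF F s] R by simp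
  from wle_sderiv[OF this R(1)] show ?thesis by (rule that)
qed

lemma sderiv_diff: "sderiv v (F - G) = sderiv v F - sderiv v G"
  by (metis add_diff_cancel diff_add_cancel sderiv_add)

text \<open>The derivatives of the truncations converge uniformly on \<open>polydisc R1\<close>. The
  intermediate \<open>R2\<close> splits the shrinking: from \<open>R\<close> to \<open>R2\<close>
  the derivatives become bounded, from \<open>R2\<close> to \<open>R1\<close> their tails decay like
  \<open>q ^ (n - 1)\<close>, one order being lost to differentiation.\<close>

lemma cderiv_eval:
  fixes F :: "'n::finite ser"
  assumes F: "wle R F c" and z: "z \<in> polydisc R" and R: "0 < R"
  shows "cderiv (ser_eval F) (\<lambda>v. ser_eval (sderiv v F) z) z"
proof -
  obtain R1 where R1: "0 < R1" "R1 < R" "z \<in> polydisc R1" using polydisc_shrink[OF z R] .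
  define R2 where "R2 = (R1 + R) / 2"
  have R2: "0 < R2" "R2 < R" "R1 < R2" using R1 by (auto simp: R2_def)
  define q where "q = R1 / R2"
  have q: "0 \<le> q" "q < 1" using R1 R2 by (auto simp: q_def)
  obtain e0 where e0: "\<And>v. wle R2 (sderiv v F) e0"
    using wle_sderiv_shrink[OF F R2(1,2)] by blast
  define e where "e = e0"
  have e: "wle R2 (sderiv v (F - trunc n F)) e" and e': "wle R2 (sderiv v (trunc n F)) e" for v n
    unfolding e_def using R2
    by (auto intro!: wle_le[OF e0] simp: sderiv_def ser_apply trunc_apply norm_mult)
  have e0: "0 \<le> e" using wle_nonneg[OF e] .
  let ?f = "\<lambda>n. ser_eval (trunc n F)"
  let ?f' = "\<lambda>n x h. \<Sum>v\<in>UNIV. pcmp h v * ser_eval (sderiv v (trunc n F)) x"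
  let ?g' = "\<lambda>x h. \<Sum>v\<in>UNIV. pcmp h v * ser_eval (sderiv v F) x"
  have fin: "(?f n has_derivative ?f' n x) (at x)" if x: "x \<in> polydisc R" for n x
  proof -
    have eq: "?f n = (\<lambda>z. \<Sum>k\<in>{k. deg k < n}. F k * monomial k z)"
      by (rule ext) (rule eval_trunc)
    have ev: "ser_eval (sderiv v (trunc n F)) x = (\<Sum>k\<in>{k. deg k < n}. F k * ser_eval (sderiv v (smono k)) x)" for v
    proof -
      have "wle R (sscale (F k) (sderiv v (smono k))) (cmod (F k) * (real (deg k) * R ^ deg k / R))" for k
        by (intro wle_sscale wle_sderiv_smono R)
      from eval_sum[OF this x] show ?thesis
        unfolding trunc_def sderiv_sum sderiv_scale using R by (simp add: eval_sscale)
    qed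
    have "((\<lambda>z. \<Sum>k\<in>{k. deg k < n}. F k * monomial k z) has_derivative
       (\<lambda>h. \<Sum>k\<in>{k. deg k < n}. F k * (\<Sum>v\<in>UNIV. pcmp h v * ser_eval (sderiv v (smono k)) x))) (at x)"
      by (intro has_derivative_sum has_derivative_mult_right cderiv_monomial[unfolded cderiv_def])
    moreover have "(\<lambda>h. \<Sum>k\<in>{k. deg k < n}. F k * (\<Sum>v\<in>UNIV. pcmp h v * ser_eval (sderiv v (smono k)) x)) = ?f' n x"
      unfolding ev sum_distrib_left by (rule ext, subst sum.swap) (simp add: mult_ac)
    ultimately show ?thesis unfolding eq by metis
  qed
  have "\<exists>g. \<forall>x\<in>polydisc R1. (\<lambda>n. ?f n x) \<longlonglongrightarrow> g x \<and> (g has_derivative ?g' x) (at x within polydisc R1)"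
  proof (rule has_derivative_sequence[OF convex_polydisc _ _ R1(3)])
    show "(?f n has_derivative ?f' n x) (at x within polydisc R1)" if "x \<in> polydisc R1" for n x
      using fin[of x n] polydisc_mono[OF that] R1 by (auto intro: has_derivative_at_withinI)
    show "(\<lambda>n. ?f n z) \<longlonglongrightarrow> ser_eval F z"
    proof (rule LIMSEQ_I)
      fix r :: real assume r: "0 < r"
      have "(\<lambda>n. c * (R1 / R) ^ n) \<longlonglongrightarrow> c * 0"
        by (intro tendsto_intros LIMSEQ_realpow_zero) (use R1 R in auto)
      then obtain no where no: "\<And>n. no \<le> n \<Longrightarrow> \<bar>c * (R1 / R) ^ n\<bar> < r"
        using r by (auto simp: LIMSEQ_iff)
      have "cmod (?f n z - ser_eval F z) < r" if "no \<le> n" for n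
      proof -
        have "cmod (ser_eval (F - trunc n F) z) \<le> c * (R1 / R) ^ n"
          using R R1 by (intro eval_bound[OF wle_ord[OF wle_tail[OF F] O_ord_trunc]]) auto
        then show ?thesis
          using no[OF that] eval_trunc_diff[OF F z, of n] R by (simp add: norm_minus_commute)
      qed
      then show "\<exists>no. \<forall>n\<ge>no. cmod (?f n z - ser_eval F z) < r" by blast
    qed
    fix \<epsilon> :: real assume eps: "0 < \<epsilon>"
    let ?N = "real (card (UNIV :: ('n + 'n) set))"
    have "(\<lambda>n. ?N * (e * q ^ (n - 1))) \<longlonglongrightarrow> ?N * (e * 0)"
    proof (intro tendsto_mult tendsto_const)
      have "(\<lambda>n. q ^ n) \<longlonglongrightarrow> 0" by (rule LIMSEQ_realpow_zero) (use q in auto)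
      then show "(\<lambda>n. q ^ (n - 1)) \<longlonglongrightarrow> 0" by (subst filterlim_sequentially_Suc[symmetric]) simp
    qed
    then have "\<forall>\<^sub>F n in sequentially. ?N * (e * q ^ (n - 1)) < \<epsilon>"
      using eps by (intro order_tendstoD(2)) auto
    then show "\<forall>\<^sub>F n in sequentially. \<forall>x\<in>polydisc R1. \<forall>h. cmod (?f' n x h - ?g' x h) \<le> \<epsilon> * norm h"
    proof (rule eventually_mono, intro ballI allI)
      fix n and x h :: "'n pt" assume n: "?N * (e * q ^ (n - 1)) < \<epsilon>" and x: "x \<in> polydisc R1"
      have x2: "x \<in> polydisc R2" using x R2 by (intro polydisc_mono[OF x]) simp
      have d: "cmod (ser_eval (sderiv v (trunc n F)) x - ser_eval (sderiv v F) x) \<le> e * q ^ (n - 1)" for v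
      proof -
        have "sderiv v (trunc n F) + sderiv v (F - trunc n F) = sderiv v F"
          by (simp add: sderiv_diff)
        then have "ser_eval (sderiv v F) x = ser_eval (sderiv v (trunc n F)) x + ser_eval (sderiv v (F - trunc n F)) x"
          using eval_add[OF e' e x2, of v n v n] by simp
        moreover have "cmod (ser_eval (sderiv v (F - trunc n F)) x) \<le> e * (R1 / R2) ^ (n - 1)"
          by (rule eval_bound[OF wle_ord[OF e O_ord_sderiv[OF O_ord_trunc]] x]) (use R1 R2 in auto)
        ultimately show ?thesis by (simp add: q_def norm_minus_commute)
      qed
      have "cmod (?f' n x h - ?g' x h) = cmod (\<Sum>v\<in>UNIV. pcmp h v * (ser_eval (sderiv v (trunc n F)) x - ser_eval (sderiv v F) x))"
        by (simp add: sum_subtractf right_diff_distrib)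
      also have "\<dots> \<le> (\<Sum>v\<in>(UNIV :: ('n + 'n) set). norm h * (e * q ^ (n - 1)))"
        by (rule sum_norm_le) (auto simp: norm_mult intro!: mult_mono norm_pcmp_le d[unfolded One_nat_def])
      also have "\<dots> = (?N * (e * q ^ (n - 1))) * norm h" by simp
      also have "\<dots> \<le> \<epsilon> * norm h" by (rule mult_right_mono) (use n in auto)
      finally show "cmod (?f' n x h - ?g' x h) \<le> \<epsilon> * norm h" .
    qed
  qed
  then obtain g where g: "\<And>x. x \<in> polydisc R1 \<Longrightarrow> (\<lambda>n. ?f n x) \<longlonglongrightarrow> g x"
    "\<And>x. x \<in> polydisc R1 \<Longrightarrow> (g has_derivative ?g' x) (at x within polydisc R1)" by blast
  have gF: "ser_eval F x = g x" if x: "x \<in> polydisc R1" for x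
  proof (rule LIMSEQ_unique[OF _ g(1)[OF x]])
    have xR: "x \<in> polydisc R" using x R1 by (intro polydisc_mono[OF x]) simp
    have lim: "(\<lambda>n. c * (R1 / R) ^ n) \<longlonglongrightarrow> c * 0"
      by (intro tendsto_intros LIMSEQ_realpow_zero) (use R1 R in auto)
    have bnd: "cmod (ser_eval F x - ?f n x) \<le> c * (R1 / R) ^ n" for n
      using R R1 eval_trunc_diff[OF F xR, of n]
        eval_bound[OF wle_ord[OF wle_tail[OF F] O_ord_trunc] x, of n] by simp
    have "(\<lambda>n. ser_eval F x - ?f n x) \<longlonglongrightarrow> 0"
      by (rule Lim_null_comparison[OF always_eventually lim[unfolded mult_zero_right]]) (use bnd in blast)
    then show "(\<lambda>n. ?f n x) \<longlonglongrightarrow> ser_eval F x"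
      using tendsto_diff[OF tendsto_const[of "ser_eval F x"], of "\<lambda>n. ser_eval F x - ?f n x" 0] by simp
  qed
  have "(ser_eval F has_derivative ?g' z) (at z within polydisc R1)"
    by (rule has_derivative_transform[OF R1(3) gF g(2)[OF R1(3)]])
  then show ?thesis
    unfolding cderiv_def using at_within_open[OF R1(3) open_polydisc] by metis
qed


section \<open>Symplectic maps given by Lie series\<close>

text \<open>The time-one map of the flow with generating derivation \<open>{X, -}\<close>, given by
  the Lie series of the coordinates instead of a differential equation.\<close>

definition lie_map :: "'n::finite ser \<Rightarrow> 'n pt \<Rightarrow> 'n pt" where
  "lie_map X w = (\<chi> j. ser_eval (lie_exp X (smono (unit_idx (Inl j)))) w,
                  \<chi> j. ser_eval (lie_exp X (smono (unit_idx (Inr j)))) w)"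

lemma pcmp_lie_map: "pcmp (lie_map X w) v = ser_eval (lie_exp X (smono (unit_idx v))) w"
  by (cases v) (simp_all add: lie_map_def)

definition sym_map :: "real \<Rightarrow> real \<Rightarrow> ('n::finite pt \<Rightarrow> 'n pt) \<Rightarrow> bool" where
  "sym_map R' R \<Phi> \<longleftrightarrow> \<Phi> 0 = 0 \<and> inj_on \<Phi> (polydisc R') \<and> \<Phi> ` polydisc R' \<subseteq> polydisc R \<and>
     (\<forall>w\<in>polydisc R'. local_canonical \<Phi> w)"

lemma sym_map_compose:
  assumes "sym_map R2 R1 \<Phi>" "sym_map R3 R2 \<Psi>" shows "sym_map R3 R1 (\<Phi> \<circ> \<Psi>)"
  using assms unfolding sym_map_def
  by (auto simp: image_subset_iff intro!: comp_inj_on local_canonical_compose intro: inj_on_subset)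

lemma sym_map_restrict: "sym_map R2 R1 \<Phi> \<Longrightarrow> R3 \<le> R2 \<Longrightarrow> sym_map R3 R1 \<Phi>"
  unfolding sym_map_def by (meson image_mono inj_on_subset order_trans polydisc_mono subsetI subset_iff)

lemma sym_map_extend: "sym_map R2 R1 \<Phi> \<Longrightarrow> R1 \<le> R0 \<Longrightarrow> sym_map R2 R0 \<Phi>"
  unfolding sym_map_def by (meson order_trans polydisc_mono subsetI)

lemma sym_map_id: "sym_map R R (\<lambda>w. w)"
proof -
  have "cderiv (\<lambda>w. pcmp w u) (\<lambda>v. if v = u then 1 else 0) w" for u and w :: "'a pt"
    unfolding cderiv_def
    using bounded_linear.has_derivative[OF bounded_linear_pcmp has_derivative_ident]
    by (simp add: if_distrib[of "\<lambda>x. _ * x"] cong: if_cong)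
  then show ?thesis unfolding sym_map_def local_canonical_def by (auto simp: o_def)
qed

lemma sym_map_canonical_change:
  fixes \<Phi> :: "'n::finite pt \<Rightarrow> 'n pt"
  assumes "sym_map R' R \<Phi>" "0 < R'" shows "canonical_change (polydisc R') \<Phi>"
  unfolding canonical_change_def
proof (intro conjI allI impI ballI)
  have lc: "local_canonical \<Phi> w" if "w \<in> polydisc R'" for w
    using assms that by (auto simp: sym_map_def)
  show "holo_on (\<lambda>w. fst (\<Phi> w) $ j) (polydisc R')" "holo_on (\<lambda>w. snd (\<Phi> w) $ j) (polydisc R')" for j
    using lc unfolding local_canonical_def holo_on_iff pcmp_simps(1)[symmetric] pcmp_simps(2)[symmetric]
    by blast+
  fix F G :: "'n pt \<Rightarrow> complex" and w :: "'n pt" assume FG: "holo_on F (\<Phi> ` polydisc R') \<and> holo_on G (\<Phi> ` polydisc R')" and w: "w \<in> polydisc R'"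
  then obtain D D' where "cderiv F D (\<Phi> w)" "cderiv G D' (\<Phi> w)"
    unfolding holo_on_iff by blast
  then show "bracket (F \<circ> \<Phi>) (G \<circ> \<Phi>) w = bracket F G (\<Phi> w)"
    using lc[OF w] unfolding local_canonical_def by blast
qed (use assms in \<open>auto simp: sym_map_def open_polydisc polydisc_iff\<close>)

lemma eul_shrink:
  fixes X :: "'n::finite ser"
  assumes "O_ord 3 X" "wle R (eul X) (x * R ^ 2 / nvar TYPE('n))" "0 < R'" "R' \<le> R"
  shows "wle R' (eul X) (x * R' ^ 2 / nvar TYPE('n))"
proof -
  have "O_ord 2 (eul X)" using O_ord_eul[OF assms(1)] by (rule O_ord_le) simp
  from wle_ord[OF assms(2) this assms(3,4)] show ?thesis
    using assms(3,4) by (simp add: power_divide power_mult_distrib)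
qed

lemma one_minus_exp_ge: "0 < d \<Longrightarrow> d \<le> 1 \<Longrightarrow> d / 2 \<le> 1 - exp (- d :: real)"
proof -
  assume d: "0 < d" "d \<le> 1"
  have "exp (- d) \<le> 1 / (1 + d)"
    using exp_ge_add_one_self[of d] d by (simp add: exp_minus inverse_eq_divide divide_left_mono)
  also have "\<dots> \<le> 1 - d / 2"
  proof -
    have "d * d \<le> 1 * d" by (rule mult_right_mono) (use d in auto)
    then have "1 \<le> (1 - d / 2) * (1 + d)" by (simp add: algebra_simps)
    then show ?thesis using d by (simp add: pos_divide_le_eq)
  qed
  finally show ?thesis by simp
qed

context
  fixes X :: "'n::finite ser" and R x d :: real
  assumes X: "O_ord 3 X" and eX: "wle R (eul X) (x * R ^ 2 / nvar TYPE('n))"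
    and x: "0 \<le> x" "x \<le> d / 16" and R: "0 < R" and d: "0 < d" "d \<le> 1"
begin

text \<open>Each coordinate moves by at most \<open>2 * x * R\<close>, while the radii
  \<open>R * exp (- (2 * d))\<close> and \<open>R * exp (- d)\<close> differ by at least
  \<open>R * d / 6\<close>; the bound \<open>x \<le> d / 16\<close> keeps the former below the
  latter.\<close>

lemma lie_map_maps:
  assumes w: "w \<in> polydisc (R * exp (- (2 * d)))"
  shows "lie_map X w \<in> polydisc (R * exp (- d))"
  unfolding polydisc_iff
proof
  fix v :: "'n + 'n"
  let ?x = "smono (unit_idx v)"
  let ?R1 = "R * exp (- d)"
  have w1: "w \<in> polydisc ?R1" by (rule polydisc_mono[OF w]) (use R d in simp)
  have "wle ?R1 (lie_exp X ?x - ?x) (2 * (x * R))"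
    by (rule wle_lie_exp_diff[OF X eX _ _ R d(1)]) (use x R d wle_smono_unit[of R v] in \<open>auto simp: eul_smono_unit\<close>)
  from eval_bound[OF this w1] have 1: "cmod (ser_eval (lie_exp X ?x - ?x) w) \<le> 2 * (x * R)" .
  have "wle ?R1 ?x ?R1" by (rule wle_smono_unit) (use R in simp)
  from eval_add[OF this \<open>wle ?R1 (lie_exp X ?x - ?x) (2 * (x * R))\<close> w1]
  have "ser_eval (lie_exp X ?x) w = pcmp w v + ser_eval (lie_exp X ?x - ?x) w"
    by (simp add: eval_smono)
  then have "cmod (pcmp (lie_map X w) v) \<le> cmod (pcmp w v) + 2 * (x * R)"
    using 1 norm_triangle_ineq[of "pcmp w v" "ser_eval (lie_exp X ?x - ?x) w"] by (simp add: pcmp_lie_map)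
  also have "\<dots> < R * exp (- (2 * d)) + 2 * (x * R)"
    using w by (simp add: polydisc_iff)
  also have "\<dots> \<le> ?R1"
  proof -
    have "exp (1 :: real) \<le> 3" by (rule exp_le)
    then have "1 / 3 \<le> exp (- 1 :: real)" by (simp add: exp_minus inverse_eq_divide field_simps)
    also have "\<dots> \<le> exp (- d)" using d by simp
    finally have "(1 / 3) * (d / 2) \<le> exp (- d) * (1 - exp (- d))"
      by (intro mult_mono one_minus_exp_ge d) (use d in auto)
    also have "\<dots> = exp (- d) - exp (- (2 * d))" by (simp add: algebra_simps flip: exp_add)
    finally have "2 * x \<le> exp (- d) - exp (- (2 * d))" using x d by simp
    then have "2 * x * R \<le> (exp (- d) - exp (- (2 * d))) * R" using R by (intro mult_right_mono) auto
    then show ?thesis by (simp add: algebra_simps)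
  qed
  finally show "cmod (pcmp (lie_map X w) v) < ?R1" .
qed

text \<open>As \<open>lie_exp X\<close> is a ring homomorphism, the identity spreads from
  coordinates to monomials and polynomials; on a tail of order \<open>n\<close> both sides are
  geometrically small.\<close>

lemma eval_lie_exp:
  assumes w: "w \<in> polydisc (R * exp (- (2 * d)))" and F: "wle R F c"
  shows "ser_eval (lie_exp X F) w = ser_eval F (lie_map X w)"
proof -
  \<comment> \<open>Half of \<open>d\<close> buys the factor \<open>q ^ n\<close> on the tail, the
    other half pays for its Lie series, started at the radius \<open>?Rh\<close>.\<close>
  let ?R1 = "R * exp (- d)" and ?Rh = "R * exp (- (d / 2))"
  let ?w' = "lie_map X w"
  have w1: "w \<in> polydisc ?R1" by (rule polydisc_mono[OF w]) (use R d in simp)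
  have w': "?w' \<in> polydisc ?R1" by (rule lie_map_maps[OF w])
  have w'R: "?w' \<in> polydisc R" by (rule polydisc_mono[OF w']) (use R d in simp)
  have L: "wle ?R1 (lie_exp X G) (2 * b)" if "wle R G b" for G b
    by (rule wle_lie_exp[OF X eX _ _ R d(1) that]) (use x d in auto)
  have mono: "ser_eval (lie_exp X (smono k)) w = monomial k ?w'" for k
  proof (induction k rule: midx_induct)
    case zero
    then show ?case by (simp add: lie_exp_one eval_smono)
  next
    case (add k v)
    have "lie_exp X (smono (k + unit_idx v)) = ser_mult (lie_exp X (smono k)) (lie_exp X (smono (unit_idx v)))"
      by (simp only: smono_add[symmetric] lie_exp_mult[OF X])
    moreover have "ser_eval (ser_mult (lie_exp X (smono k)) (lie_exp X (smono (unit_idx v)))) w =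
        ser_eval (lie_exp X (smono k)) w * ser_eval (lie_exp X (smono (unit_idx v))) w"
      by (rule eval_mult[OF L[OF wle_smono] L[OF wle_smono] w1]) (use R in auto)
    ultimately show ?case by (simp add: add monomial_add pcmp_lie_map)
  qed
  have lsum: "lie_exp X (\<Sum>k\<in>I. G k) = (\<Sum>k\<in>I. lie_exp X (G k))" if "finite I" for G and I :: "'n midx set"
    using that
  proof (induction I)
    case empty
    show ?case using lie_exp_sscale[of X 0 0] by simp
  qed (simp add: lie_exp_add)
  have poly: "ser_eval (lie_exp X (trunc n F)) w = ser_eval (trunc n F) ?w'" for n
  proof -
    have sc: "wle R (sscale (F k) (smono k)) (cmod (F k) * R ^ deg k)" for k
      by (intro wle_sscale wle_smono) (use R in simp)
    have "ser_eval (lie_exp X (trunc n F)) w = (\<Sum>k\<in>{k. deg k < n}. ser_eval (lie_exp X (sscale (F k) (smono k))) w)"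
      unfolding trunc_def lsum[OF finite_deg_less]
      by (rule eval_sum[OF L[OF sc] w1]) (use R in simp)
    also have "\<dots> = (\<Sum>k\<in>{k. deg k < n}. ser_eval (sscale (F k) (smono k)) ?w')"
      by (simp add: lie_exp_sscale eval_sscale eval_smono mono)
    also have "\<dots> = ser_eval (trunc n F) ?w'"
      unfolding trunc_def by (rule eval_sum[OF sc w'R, symmetric]) (use R in simp)
    finally show ?thesis .
  qed
  define q where "q = exp (- (d / 2))"
  have q: "0 \<le> q" "q < 1" using d by (auto simp: q_def)
  have c: "0 \<le> c" by (rule wle_nonneg[OF F])
  show ?thesis
  proof (rule eq_from_geometric_bound[OF q])
    fix n
    let ?t = "F - trunc n F"
    have t: "wle R ?t c" by (rule wle_tail[OF F]) (use R in simp)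
    have th: "wle ?Rh ?t (c * q ^ n)"
      using wle_ord[OF t O_ord_trunc, of ?Rh] R d by (simp add: q_def)
    have "wle (?Rh * exp (- (d / 2))) (lie_exp X ?t) (2 * (c * q ^ n))"
      by (rule wle_lie_exp[OF X eul_shrink[OF X eX] _ _ _ _ th]) (use x d R in auto)
    then have 1: "wle ?R1 (lie_exp X ?t) (2 * (c * q ^ n))" by (simp add: mult.assoc flip: exp_add)
    have 2: "cmod (ser_eval ?t ?w') \<le> c * q ^ n"
      by (rule eval_bound[OF th polydisc_mono[OF w']]) (use R d in simp)
    have "lie_exp X F = lie_exp X (trunc n F) + lie_exp X ?t" by (simp flip: lie_exp_add)
    then have "ser_eval (lie_exp X F) w = ser_eval (trunc n F) ?w' + ser_eval (lie_exp X ?t) w"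
      using eval_add[OF L[OF wle_trunc[OF F]] 1 w1, of n] R by (simp add: poly)
    moreover have "ser_eval F ?w' = ser_eval (trunc n F) ?w' + ser_eval ?t ?w'"
      by (rule eval_trunc_diff[OF F w'R]) (use R in simp)
    ultimately have "ser_eval (lie_exp X F) w - ser_eval F ?w' = ser_eval (lie_exp X ?t) w - ser_eval ?t ?w'"
      by simp
    also have "cmod \<dots> \<le> 2 * (c * q ^ n) + c * q ^ n"
      by (rule order_trans[OF norm_triangle_ineq4 add_mono[OF eval_bound[OF 1 w1] 2]])
    finally show "cmod (ser_eval (lie_exp X F) w - ser_eval F ?w') \<le> 3 * c * q ^ n" by simp
  qed
qed

text \<open>\<open>lie_exp X\<close> also preserves the bracket, and the brackets of coordinates are
  constants, which it fixes; so the transformed coordinates satisfy the canonical relations.\<close>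

lemma lie_map_local_canonical:
  assumes w: "w \<in> polydisc (R * exp (- (2 * d)))"
  shows "local_canonical (lie_map X) w"
proof -
  let ?R1 = "R * exp (- d)" and ?R2 = "R * exp (- (2 * d))"
  let ?T = "\<lambda>v. lie_exp X (smono (unit_idx v))"
  have w1: "w \<in> polydisc ?R1" by (rule polydisc_mono[OF w]) (use R d in simp)
  have T: "wle ?R1 (?T v) (2 * R)" for v
    by (rule wle_lie_exp[OF X eX _ _ R d(1) wle_smono_unit]) (use x d R in auto)
  have R2: "0 < ?R2" "?R2 < ?R1" using R d by auto
  have wS: "\<exists>e. \<forall>u. wle ?R2 (sderiv u (?T v)) e" for v
    using wle_sderiv_shrink[OF T R2] by metis
  show ?thesis
  proof (rule local_canonicalI)
    show "cderiv (\<lambda>w. pcmp (lie_map X w) u) (\<lambda>v. ser_eval (sderiv v (?T u)) w) w" for u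
      unfolding pcmp_lie_map by (rule cderiv_eval[OF T w1]) (use R in simp)
    fix a b :: "'n + 'n"
    obtain ea eb where e: "\<And>u. wle ?R2 (sderiv u (?T a)) ea" "\<And>u. wle ?R2 (sderiv u (?T b)) eb"
      using wS by metis
    have m: "wle ?R2 (ser_mult (sderiv v (?T a)) (sderiv (conj_var v) (?T b))) (ea * eb)" for v
      by (intro wle_mult e) (use R in simp)
    have "(\<Sum>v\<in>UNIV. \<i> * sgn_var v * (ser_eval (sderiv v (?T a)) w * ser_eval (sderiv (conj_var v) (?T b)) w)) =
      (\<Sum>v\<in>UNIV. ser_eval (sscale (\<i> * sgn_var v) (ser_mult (sderiv v (?T a)) (sderiv (conj_var v) (?T b)))) w)"
      by (intro sum.cong refl) (simp add: eval_sscale eval_mult[OF e(1) e(2) w R2(1)])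
    also have "\<dots> = ser_eval (ser_bracket (?T a) (?T b)) w"
      unfolding ser_bracket_eq by (rule eval_sum[OF wle_sscale[OF m] w, symmetric]) (use R in simp)
    also have "ser_bracket (?T a) (?T b) = lie_exp X (ser_bracket (smono (unit_idx a)) (smono (unit_idx b)))"
      by (rule lie_exp_bracket[OF X, symmetric])
    also have "ser_bracket (smono (unit_idx a)) (smono (unit_idx b)) =
        sscale (if b = conj_var a then \<i> * sgn_var a else 0) (smono 0)"
    proof -
      have "a = conj_var b \<longleftrightarrow> b = conj_var a" by auto
      then show ?thesis by (auto simp: ser_bracket_coord sderiv_smono_unit)
    qed
    also have "ser_eval (lie_exp X (sscale (if b = conj_var a then \<i> * sgn_var a else 0) (smono 0))) w =
        (if b = conj_var a then \<i> * sgn_var a else 0)"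
      by (simp add: lie_exp_sscale lie_exp_one eval_sscale eval_smono)
    finally show "(\<Sum>v\<in>UNIV. \<i> * sgn_var v * (ser_eval (sderiv v (?T a)) w * ser_eval (sderiv (conj_var v) (?T b)) w)) =
      (if b = conj_var a then \<i> * sgn_var a else 0)" .
  qed
qed

end

text \<open>Injectivity follows because the Lie series of \<open>- X\<close> is the inverse.\<close>

lemma lie_map_sym_map:
  fixes X :: "'n::finite ser"
  assumes X: "O_ord 3 X" and eX: "wle R (eul X) (x * R ^ 2 / nvar TYPE('n))"
    and x: "0 \<le> x" "x \<le> d / 16" and R: "0 < R" and d: "0 < d" "d \<le> 1"
  shows "sym_map (R * exp (- (3 * d))) R (lie_map X)"
  unfolding sym_map_def
proof (intro conjI ballI subsetI)
  let ?R1 = "R * exp (- d)"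
  have sub: "w \<in> polydisc (R * exp (- (2 * d)))" if "w \<in> polydisc (R * exp (- (3 * d)))" for w :: "'n pt"
    by (rule polydisc_mono[OF that]) (use R d in simp)
  show "local_canonical (lie_map X) w" if "w \<in> polydisc (R * exp (- (3 * d)))" for w
    by (rule lie_map_local_canonical[OF X eX x R d sub[OF that]])
  show "w \<in> polydisc R" if "w \<in> lie_map X ` polydisc (R * exp (- (3 * d)))" for w
    using that lie_map_maps[OF X eX x R d sub] R d by (auto intro!: polydisc_mono[of _ ?R1 R])
  show "lie_map X 0 = 0"
    by (rule pt_eqI) (simp add: pcmp_lie_map eval_origin O_ord_lie_exp[OF X O_ord_smono])
  show "inj_on (lie_map X) (polydisc (R * exp (- (3 * d))))"
  proof (rule inj_onI, rule pt_eqI)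
    fix w w' :: "'n pt" and v
    assume w: "w \<in> polydisc (R * exp (- (3 * d)))" "w' \<in> polydisc (R * exp (- (3 * d)))"
      and eq: "lie_map X w = lie_map X w'"
    have X': "O_ord 3 (- X)" using X by (rule O_ord_uminus)
    have eX': "wle R (eul (- X)) (x * R ^ 2 / nvar TYPE('n))"
      by (rule wle_le[OF eX]) (use R in \<open>auto simp: eul_apply ser_apply norm_mult\<close>)
    define G where "G = lie_exp (- X) (smono (unit_idx v))"
    have G: "wle ?R1 G (2 * R)"
      unfolding G_def by (rule wle_lie_exp[OF X' eX' _ _ R d(1) wle_smono_unit]) (use x d R in auto)
    have R1: "0 < ?R1" "?R1 \<le> R" using R d by auto
    have "pcmp u v = ser_eval G (lie_map X u)" if u: "u \<in> polydisc (R * exp (- (3 * d)))" for u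
    proof -
      \<comment> \<open>\<open>G\<close> is bounded at the radius \<open>?R1\<close> only, so the
        composition is applied with base radius \<open>?R1\<close>: a loss \<open>d\<close> for
        \<open>G\<close> and \<open>2 * d\<close> for the map make up \<open>3 * d\<close>.\<close>
      have "u \<in> polydisc (?R1 * exp (- (2 * d)))" using u by (simp add: mult.assoc flip: exp_add)
      from eval_lie_exp[OF X eul_shrink[OF X eX R1] x R1(1) d this G]
      have "ser_eval (lie_exp X G) u = ser_eval G (lie_map X u)" .
      moreover have "lie_exp X G = smono (unit_idx v)"
        using lie_exp_inverse[OF X', of "smono (unit_idx v)"] by (simp add: G_def)
      ultimately show ?thesis by (simp add: eval_smono)
    qed
    then show "pcmp w v = pcmp w' v" using w eq by simp
  qed
qed


section \<open>One normalization step\<close>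

definition res_part :: "real ^ 'n::finite \<Rightarrow> 'n ser \<Rightarrow> 'n ser" where
  "res_part \<omega> F = (\<lambda>k. if kprime k \<in> res_lattice \<omega> then F k else 0)"

lemma res_part_apply: "res_part \<omega> F k = (if kprime k \<in> res_lattice \<omega> then F k else 0)"
  by (simp add: res_part_def)

definition nres_part :: "real ^ 'n::finite \<Rightarrow> 'n ser \<Rightarrow> 'n ser" where
  "nres_part \<omega> F = F - res_part \<omega> F"

lemma nres_part_apply: "nres_part \<omega> F k = (if kprime k \<in> res_lattice \<omega> then 0 else F k)"
  by (simp add: nres_part_def res_part_apply ser_apply)

lemma res_nres_part: "F = res_part \<omega> F + nres_part \<omega> F"
  by (simp add: nres_part_def)

lemma O_ord_res_part: "O_ord a F \<Longrightarrow> O_ord a (res_part \<omega> F)"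
  unfolding O_ord_def res_part_apply by simp

lemma O_ord_nres_part: "O_ord a F \<Longrightarrow> O_ord a (nres_part \<omega> F)"
  unfolding nres_part_def by (intro O_ord_diff O_ord_res_part)

lemma wle_H2: "0 \<le> R \<Longrightarrow> \<exists>c. wle R (H2 \<omega>) c"
proof -
  assume R: "0 \<le> R"
  show ?thesis
    unfolding H2_eq smono_add
    by (rule exI, rule wle_sum[OF wle_sscale[OF wle_smono[OF R]] R])
qed

text \<open>Size of the remainder of a step, in units of the squared new radius. In
  \<open>576 = 36 * 2 * 8\<close> the 8 comes from \<open>e = d / 8\<close>, the 2 from summing the
  Lie series, and 36 covers the change of radius and the Cauchy estimate for
  \<open>eul\<close>.\<close>

definition step_gain :: "'n::finite itself \<Rightarrow> real \<Rightarrow> real \<Rightarrow> real \<Rightarrow> real \<Rightarrow> real" where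
  "step_gain T \<nu> d a z = 576 * nvar T * a / (\<nu> * d) * (z + 8 * a / d)"

text \<open>The remainder collects the interactions of \<open>X\<close> with the resonant and with
  the nonresonant part. The former uses the given bound on \<open>eul\<close> and so costs one
  factor \<open>1 / d\<close> less. The remainder is bounded both plainly and through
  \<open>eul\<close>, because the next step needs the latter for its resonant part.\<close>

lemma normalization_step:
  fixes F :: "'n::finite ser" and \<omega> :: "real ^ 'n"
  assumes \<nu>: "0 < \<nu>" "\<And>q. q \<notin> res_lattice \<omega> \<Longrightarrow> \<nu> \<le> \<bar>freq \<omega> q\<bar>"
    and R: "0 < R" and d: "0 < d" "d \<le> 1" and F: "O_ord 3 F"
    and a: "wle R (nres_part \<omega> F) (a * R ^ 2)" and z: "wle R (eul (res_part \<omega> F)) (z * R ^ 2)"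
    and small: "1024 * nvar TYPE('n) * a \<le> \<nu> * d ^ 2"
  obtains F' \<Phi> where "O_ord 3 F'"
    and "\<And>s t. 3 \<le> s \<Longrightarrow> O_ord s F \<Longrightarrow> O_ord t (res_part \<omega> F) \<Longrightarrow> O_ord (min t (2 * s - 2)) F'"
    and "\<And>r S. kills r S (H2 \<omega> + F) \<Longrightarrow> kills r S (H2 \<omega> + F')"
    and "wle (R * exp (- d)) (F' - res_part \<omega> F) (step_gain TYPE('n) \<nu> d a z * (R * exp (- d)) ^ 2)"
    and "wle (R * exp (- d)) (eul (F' - res_part \<omega> F)) (step_gain TYPE('n) \<nu> d a z / d * (R * exp (- d)) ^ 2)"
    and "sym_map (R * exp (- d)) R \<Phi>"
    and "\<And>w. w \<in> polydisc (R * exp (- d)) \<Longrightarrow> ser_eval (H2 \<omega> + F) (\<Phi> w) = ser_eval (H2 \<omega> + F') w"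
proof -
  let ?n = "nvar TYPE('n)"
  have n: "?n > 0" using nvar_ge[where 'n = 'n] by linarith
  let ?Z = "res_part \<omega> F" and ?P = "nres_part \<omega> F"
  have a0: "0 \<le> a" and z0: "0 \<le> z"
    using wle_nonneg[OF a] wle_nonneg[OF z] R by (simp_all add: zero_le_mult_iff)
  \<comment> \<open>Division by the frequency solves the homological equation; at resonant indices
    the quotient is \<open>0 / 0\<close>, which evaluates to 0.\<close>
  define X where "X = (\<lambda>k. \<i> * ?P k / of_real (freq \<omega> (kprime k)))"
  have XO: "O_ord s X" if "O_ord s F" for s
    unfolding O_ord_def X_def using O_ord_D[OF O_ord_nres_part[OF that]] by simp
  have X3: "O_ord 3 X" by (rule XO[OF F])
  have XH: "ser_bracket X (H2 \<omega>) = - ?P"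
    by (rule ext) (auto simp: ser_bracket_H2_right X_def ser_apply nres_part_apply res_lattice_def)
  have Xw: "wle R X (a * R ^ 2 / \<nu>)"
  proof (rule wle_le[OF wle_sscale[OF a, of "of_real (1 / \<nu>)"], THEN wle_mono])
    fix k
    show "cmod (X k) \<le> cmod (sscale (of_real (1 / \<nu>)) ?P k)"
    proof (cases "kprime k \<in> res_lattice \<omega>")
      case False
      have "cmod (?P k) / \<bar>freq \<omega> (kprime k)\<bar> \<le> cmod (?P k) / \<nu>"
        by (rule divide_left_mono) (use \<nu> False in \<open>auto simp: res_lattice_def\<close>)
      then show ?thesis using \<nu> by (simp add: X_def ser_apply norm_mult norm_divide)
    qed (simp add: X_def nres_part_apply)
  qed (use R \<nu> in \<open>auto simp: norm_divide\<close>)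
  \<comment> \<open>The loss is cut into portions: one for the derivatives of \<open>X\<close>, one
    for the Lie series, one for the derivatives of the remainder; the map takes three beyond the
    first, so at most four of the eight are spent.\<close>
  define e where "e = d / 8"
  have e: "0 < e" "e \<le> 1 / 8" "e \<le> 1" using d by (auto simp: e_def)
  define x where "x = ?n * a / (\<nu> * e)"
  have x0: "0 \<le> x" using n a0 \<nu> e by (simp add: x_def)
  \<comment> \<open>This is \<open>small\<close> exactly:
    \<open>x = 8 * ?n * a / (\<nu> * d)\<close> and \<open>e / 16 = d / 128\<close>, whence
    \<open>1024\<close>.\<close>
  have xe: "x \<le> e / 16"
    using small \<nu> e by (simp add: x_def e_def divide_le_eq power2_eq_square field_simps)
  define Ra where "Ra = R * exp (- e)"
  have Ra: "0 < Ra" "Ra \<le> R" using R e by (auto simp: Ra_def)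
  have "wle Ra (eul X) (a * R ^ 2 / \<nu> / (exp 1 * e))"
    unfolding Ra_def by (rule wle_eul[OF Xw e(1) R])
  then have eX: "wle Ra (eul X) (x * Ra ^ 2 / ?n)"
  proof (rule wle_mono)
    have "1 / exp 1 = exp (- 1 :: real)" by (simp add: exp_minus inverse_eq_divide)
    also have "\<dots> \<le> exp (- (2 * e))" using e by simp
    finally have "1 / exp 1 \<le> exp (- (2 * e))" .
    then have "a * R ^ 2 / (\<nu> * e) * (1 / exp 1) \<le> a * R ^ 2 / (\<nu> * e) * exp (- (2 * e))"
      using a0 \<nu> e by (intro mult_left_mono) auto
    moreover have "exp (- (2 * e)) = exp (- e) ^ 2" by (simp add: power2_eq_square flip: exp_add)
    ultimately show "a * R ^ 2 / \<nu> / (exp 1 * e) \<le> x * Ra ^ 2 / ?n"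
      using n by (simp add: x_def Ra_def power_mult_distrib field_simps)
  qed
  define Rb where "Rb = Ra * exp (- e)"
  have Rb: "0 < Rb" using Ra by (simp add: Rb_def)
  have RbR: "Rb = R * exp (- (2 * e))" by (simp add: Rb_def Ra_def mult.assoc flip: exp_add)
  define R' where "R' = R * exp (- d)"
  have R': "0 < R'" using R by (simp add: R'_def)
  define F' where "F' = lie_exp X (H2 \<omega> + F) - H2 \<omega>"
  have F'Z: "F' - ?Z = (lie_exp X ?Z - ?Z) + (lie_exp X (H2 \<omega> + ?P) - H2 \<omega>)"
    unfolding F'_def by (subst (1) res_nres_part[of F \<omega>]) (simp add: lie_exp_add)
  have xe2: "x \<le> e / 2" using xe e by simp
  note ctx = X3 eX x0 xe2 Ra(1) e(1)
  define Q0 where "Q0 = 2 * x * (z + a / e)"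
  have Q0: "0 \<le> Q0" using x0 z0 a0 e by (simp add: Q0_def)
  have E: "wle Rb (F' - ?Z) (Q0 * R ^ 2)"
  proof -
    have "wle Rb (lie_exp X ?Z - ?Z) (2 * (x * (z * R ^ 2)))"
      unfolding Rb_def by (rule wle_lie_exp_diff[OF ctx wle_mono_R[OF z Ra]])
    moreover have "wle Rb (lie_exp X (H2 \<omega> + ?P) - H2 \<omega>) (2 * (x / e * (a * R ^ 2)))"
      unfolding Rb_def by (rule wle_lie_exp_homological[OF ctx wle_mono_R[OF a Ra] XH])
    ultimately have "wle Rb (F' - ?Z) (2 * (x * (z * R ^ 2)) + 2 * (x / e * (a * R ^ 2)))"
      unfolding F'Z using Rb by (intro wle_add) auto
    then show ?thesis by (rule wle_mono) (simp add: Q0_def algebra_simps)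
  qed
  have RR: "R ^ 2 \<le> 9 * R' ^ 2"
  proof -
    have "exp d \<le> exp 1" using d by simp
    then have "exp d \<le> 3" using exp_le by linarith
    then have "exp d ^ 2 \<le> 3 ^ 2" by (intro power_mono) auto
    then have "R' ^ 2 * exp d ^ 2 \<le> R' ^ 2 * 9" by (intro mult_left_mono) auto
    moreover have "R = R' * exp d" by (simp add: R'_def mult.assoc flip: exp_add)
    ultimately show ?thesis by (simp add: power_mult_distrib mult.commute)
  qed
  have gain: "36 * Q0 = step_gain TYPE('n) \<nu> d a z"
    using d \<nu> by (simp add: Q0_def step_gain_def x_def e_def field_simps)
  show ?thesis
  proof (rule that[of F' "lie_map X"])
    \<comment> \<open>Everything beyond the resonant part contains at least one bracket of
      \<open>X\<close>, which has order \<open>s\<close>, with a part of \<open>F\<close>.\<close>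
    have coef: "O_ord (2 * s - 2) (F' - ?Z)" if s: "3 \<le> s" "O_ord s F" for s
    proof -
      have T: "lie_term X (Suc m) G k = 0" if G: "O_ord s G" and k: "deg k < 2 * s - 2" for G k m
      proof -
        have "O_ord (s + Suc m * (s - 2)) (lie_pow X (Suc m) G)"
          by (rule O_ord_lie_pow_gen[OF XO[OF s(2)] _ G]) (use s in auto)
        then have "lie_pow X (Suc m) G k = 0" by (rule O_ord_D) (use k s in auto)
        then show ?thesis by (simp only: lie_term_def sscale_apply mult_zero_right)
      qed
      show ?thesis unfolding O_ord_def
      proof (intro allI impI)
        fix k :: "'n midx" assume k: "deg k < 2 * s - 2"
        have "(lie_exp X ?Z - ?Z) k = 0"
          unfolding lie_exp_minus_self[OF ctx order_refl]
          by (intro sum.neutral ballI) (simp only: T[OF O_ord_res_part[OF s(2)] k])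
        moreover have "(lie_exp X (H2 \<omega> + ?P) - H2 \<omega>) k = 0"
          unfolding lie_exp_homological[OF ctx XH order_refl]
          by (intro sum.neutral ballI) (simp only: T[OF O_ord_nres_part[OF s(2)] k] mult_zero_right)
        ultimately show "(F' - ?Z) k = 0" unfolding F'Z plus_fun_apply by simp
      qed
    qed
    show ord: "O_ord (min t (2 * s - 2)) F'" if "3 \<le> s" "O_ord s F" "O_ord t ?Z" for s t
      using O_ord_add[OF O_ord_le[OF that(3)] O_ord_le[OF coef[OF that(1,2)]], of "min t (2 * s - 2)"]
      by simp
    show "O_ord 3 F'" by (rule O_ord_le[OF ord[OF _ F O_ord_res_part[OF F]]]) auto
    show "kills r S (H2 \<omega> + F')" if "kills r S (H2 \<omega> + F)" for r S
      using kills_lie_exp[OF X3 that] by (simp add: F'_def)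
    have R'b: "R' \<le> Rb" using R e d unfolding R'_def RbR e_def by simp
    show "wle (R * exp (- d)) (F' - ?Z) (step_gain TYPE('n) \<nu> d a z * (R * exp (- d)) ^ 2)"
      unfolding R'_def[symmetric] gain[symmetric]
    proof (rule wle_mono[OF wle_mono_R[OF E R' R'b]])
      have "Q0 * R ^ 2 \<le> Q0 * (9 * R' ^ 2)" by (rule mult_left_mono[OF RR Q0])
      also have "\<dots> \<le> 36 * Q0 * R' ^ 2" using Q0 by (simp add: mult_right_mono)
      finally show "Q0 * R ^ 2 \<le> 36 * Q0 * R' ^ 2" .
    qed
    have "wle (Rb * exp (- e)) (eul (F' - ?Z)) (Q0 * R ^ 2 / (exp 1 * e))"
      by (rule wle_eul[OF E e(1) Rb])
    moreover have "R' \<le> Rb * exp (- e)"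
      using R e d unfolding R'_def RbR e_def by (simp add: mult.assoc flip: exp_add)
    ultimately have E2: "wle R' (eul (F' - ?Z)) (Q0 * R ^ 2 / (exp 1 * e))"
      using wle_mono_R R' by blast
    show "wle (R * exp (- d)) (eul (F' - ?Z)) (step_gain TYPE('n) \<nu> d a z / d * (R * exp (- d)) ^ 2)"
      unfolding R'_def[symmetric] gain[symmetric]
    proof (rule wle_mono[OF E2])
      have "2 \<le> exp (1 :: real)" using exp_ge_add_one_self[of 1] by simp
      then have "Q0 * R ^ 2 / (exp 1 * e) \<le> Q0 * R ^ 2 / (2 * e)"
        using Q0 e by (intro divide_left_mono mult_right_mono) auto
      also have "\<dots> = 4 * Q0 / d * R ^ 2" using d by (simp add: e_def)
      also have "\<dots> \<le> 4 * Q0 / d * (9 * R' ^ 2)" using Q0 d by (intro mult_left_mono RR) auto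
      finally show "Q0 * R ^ 2 / (exp 1 * e) \<le> 36 * Q0 / d * R' ^ 2" by simp
    qed
    have "sym_map (Ra * exp (- (3 * e))) Ra (lie_map X)"
      by (rule lie_map_sym_map[OF X3 eX x0 xe Ra(1) e(1,3)])
    then show "sym_map (R * exp (- d)) R (lie_map X)"
    proof (rule sym_map_extend[OF sym_map_restrict])
      show "R * exp (- d) \<le> Ra * exp (- (3 * e))"
        using R e d unfolding Ra_def e_def by (simp add: mult.assoc flip: exp_add)
    qed (rule Ra(2))
    fix w :: "'n pt" assume w: "w \<in> polydisc (R * exp (- d))"
    obtain c where c: "wle Ra (H2 \<omega>) c" using wle_H2[of Ra \<omega>] Ra by auto
    have FR: "wle Ra F (z * R ^ 2 + a * R ^ 2)"
      by (subst res_nres_part[of F \<omega>], rule wle_add, rule wle_mono_R[OF wle_of_eul[OF z] Ra],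
          rule O_ord_le[OF O_ord_res_part[OF F]]) (use R Ra wle_mono_R[OF a Ra] in auto)
    have w2: "w \<in> polydisc (Ra * exp (- (2 * e)))"
      by (rule polydisc_mono[OF w]) (use R e d in \<open>simp add: Ra_def e_def mult.assoc flip: exp_add\<close>)
    have "ser_eval (lie_exp X (H2 \<omega> + F)) w = ser_eval (H2 \<omega> + F) (lie_map X w)"
      by (rule eval_lie_exp[OF X3 eX x0 xe Ra(1) e(1,3) w2 wle_add[OF c FR]]) (use Ra in simp)
    then show "ser_eval (H2 \<omega> + F) (lie_map X w) = ser_eval (H2 \<omega> + F') w"
      by (simp add: F'_def)
  qed
qed


section \<open>Removing low-order terms\<close>

definition transforms :: "real ^ 'n::finite \<Rightarrow> real \<Rightarrow> real \<Rightarrow> 'n ser \<Rightarrow> 'n ser \<Rightarrow> bool" where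
  "transforms \<omega> R' R F F' \<longleftrightarrow> (\<exists>\<Phi>. sym_map R' R \<Phi> \<and>
     (\<forall>w\<in>polydisc R'. ser_eval (H2 \<omega> + F) (\<Phi> w) = ser_eval (H2 \<omega> + F') w))"

lemma transforms_refl: "transforms \<omega> R R F F"
  unfolding transforms_def using sym_map_id by blast

lemma transforms_trans:
  assumes "transforms \<omega> R2 R1 F G" "transforms \<omega> R3 R2 G H" shows "transforms \<omega> R3 R1 F H"
proof -
  obtain \<Phi> where P: "sym_map R2 R1 \<Phi>"
    "\<And>w. w \<in> polydisc R2 \<Longrightarrow> ser_eval (H2 \<omega> + F) (\<Phi> w) = ser_eval (H2 \<omega> + G) w"
    using assms(1) unfolding transforms_def by blast
  obtain \<Psi> where Q: "sym_map R3 R2 \<Psi>"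
    "\<And>w. w \<in> polydisc R3 \<Longrightarrow> ser_eval (H2 \<omega> + G) (\<Psi> w) = ser_eval (H2 \<omega> + H) w"
    using assms(2) unfolding transforms_def by blast
  have "\<Psi> w \<in> polydisc R2" if "w \<in> polydisc R3" for w using Q(1) that by (auto simp: sym_map_def)
  then show ?thesis
    unfolding transforms_def using sym_map_compose[OF P(1) Q(1)] P(2) Q(2) by (metis comp_apply)
qed

lemma transforms_restrict: "transforms \<omega> R2 R1 F G \<Longrightarrow> R3 \<le> R2 \<Longrightarrow> transforms \<omega> R3 R1 F G"
  unfolding transforms_def by (meson polydisc_mono sym_map_restrict)

lemma transforms_extend: "transforms \<omega> R2 R1 F G \<Longrightarrow> R1 \<le> R0 \<Longrightarrow> transforms \<omega> R2 R0 F G"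
  unfolding transforms_def by (meson sym_map_extend)

lemma wle_shrink:
  assumes "wle R F (a * R ^ 2)" "O_ord 2 F" "0 < R'" "R' \<le> R"
  shows "wle R' F (a * R' ^ 2)"
  using wle_ord[OF assms(1,2,3,4)] assms(3,4) by (simp add: power_divide)

lemma wle_res_part: "wle R F c \<Longrightarrow> 0 \<le> R \<Longrightarrow> wle R (res_part \<omega> F) c"
  by (rule wle_le) (auto simp: res_part_apply)

lemma wle_nres_part: "wle R F c \<Longrightarrow> 0 \<le> R \<Longrightarrow> wle R (nres_part \<omega> F) c"
  by (rule wle_le) (auto simp: nres_part_apply)

lemma exp_neg_two: "exp (- 2 :: real) \<le> 3 / 16"
proof -
  have "5 / 2 \<le> exp (1 :: real)" using exp_lower_Taylor_quadratic[of 1] by simp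
  then have "(5 / 2) ^ 2 \<le> exp (1 :: real) ^ 2" by (intro power_mono) auto
  also have "exp (1 :: real) ^ 2 = exp 2" by (simp add: power2_eq_square flip: exp_add)
  finally have "16 / 3 \<le> exp (2 :: real)" by (simp add: power2_eq_square)
  then have "exp 2 * exp (- 2) * 3 \<ge> 16 * exp (- 2 :: real)" by simp
  moreover have "exp 2 * exp (- 2 :: real) = 1" by (simp flip: exp_add)
  ultimately show ?thesis by simp
qed

text \<open>Newton iteration: as long as the resonant part vanishes up to degree \<open>2 s - 3\<close>, one step
  takes order \<open>s\<close> to order \<open>2 s - 2\<close>; \<open>s - 2\<close> doubles, so the losses \<open>2\<^sup>-\<^sup>m\<close> of the logarithmic
  radius are summable independently of the target order \<open>r\<close>.\<close>

lemma newton_step: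
  fixes F :: "'n::finite ser" and \<omega> :: "real ^ 'n"
  assumes \<nu>: "0 < \<nu>" "\<And>q. q \<notin> res_lattice \<omega> \<Longrightarrow> \<nu> \<le> \<bar>freq \<omega> q\<bar>"
    and small: "400000 * nvar TYPE('n) * \<eta> \<le> \<nu>" and \<eta>: "0 \<le> \<eta>"
    and R: "0 < R" and F: "O_ord (2 ^ m + 2) F"
    and w: "wle R F (\<eta> / 4 ^ m * R ^ 2)"
    and kl: "kills r (eig_list \<omega> r) (H2 \<omega> + F)" and r: "2 ^ m + 2 < r"
    and d: "d = (1 / 2) ^ m" and R': "R' = R * exp (- d)"
  obtains F' where "O_ord 3 F'" "kills r (eig_list \<omega> r) (H2 \<omega> + F')" "transforms \<omega> R' R F F'"
    "(O_ord r F' \<and> wle R' F' (2 * \<eta> * R' ^ 2)) \<or>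
     (O_ord (2 ^ Suc m + 2) F' \<and> wle R' F' (\<eta> / 4 ^ Suc m * R' ^ 2))"
proof -
  let ?n = "nvar TYPE('n)" and ?s = "2 ^ m + 2 :: nat" and ?Z = "res_part \<omega> F"
  have n: "?n > 0" using nvar_ge[where 'n = 'n] by linarith
  have s3: "3 \<le> ?s" by simp
  have F3: "O_ord 3 F" and F2: "O_ord 2 F" using O_ord_le[OF F] s3 by auto
  have d0: "0 < d" "d \<le> 1" by (simp_all add: d power_le_one)
  define a where "a = \<eta> / 4 ^ m"
  \<comment> \<open>Sizes shrink like the squares of the losses, so \<open>a / d ^ 2\<close>, the
    quantity that governs a step, is the same \<eta> at every stage.\<close>
  have ad: "a = \<eta> * d ^ 2"
    by (simp add: a_def d power_mult[symmetric] mult.commute[of _ 2] power_divide) (simp add: power_mult)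
  have a0: "0 \<le> a" "a \<le> \<eta>" using \<eta> mult_left_mono[of 1 "4 ^ m" \<eta>] by (simp_all add: a_def divide_le_eq)
  \<comment> \<open>Half of the loss turns the bound on \<open>F\<close> into one on
    \<open>eul ?Z\<close>; the other half is left for the step.\<close>
  define Ra where "Ra = R * exp (- (d / 2))"
  have Ra: "0 < Ra" "Ra \<le> R" using R d0 by (auto simp: Ra_def)
  have R'a: "R' = Ra * exp (- (d / 2))" by (simp add: R' Ra_def mult.assoc flip: exp_add)
  have R'0: "0 < R'" "R' \<le> Ra" "R' \<le> R" using R d0 by (auto simp: R' Ra_def)
  have wa: "wle R F (a * R ^ 2)" using w by (simp add: a_def)
  have P: "wle Ra (nres_part \<omega> F) (a * Ra ^ 2)"
    using wle_nres_part[OF wle_shrink[OF wa F2 Ra]] Ra by simp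
  have Z: "wle Ra (eul ?Z) (2 * a / d * Ra ^ 2)"
  proof -
    have "wle Ra (eul ?Z) (a * R ^ 2 / (exp 1 * (d / 2)))"
      unfolding Ra_def by (rule wle_eul[OF wle_res_part[OF wa]]) (use R d0 in auto)
    then show ?thesis
    proof (rule wle_mono)
      have "exp d \<le> exp 1" using d0 by simp
      then have "R ^ 2 / exp 1 \<le> R ^ 2 / exp d" by (intro divide_left_mono) auto
      also have "\<dots> = Ra ^ 2"
        by (simp add: Ra_def power_mult_distrib exp_minus power2_eq_square field_simps flip: exp_add)
      finally have "2 * a / d * (R ^ 2 / exp 1) \<le> 2 * a / d * Ra ^ 2"
        using a0 d0 by (intro mult_left_mono) auto
      then show "a * R ^ 2 / (exp 1 * (d / 2)) \<le> 2 * a / d * Ra ^ 2" by (simp add: field_simps)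
    qed
  qed
  have sm: "1024 * ?n * a \<le> \<nu> * (d / 2) ^ 2"
  proof -
    have "0 \<le> ?n * \<eta>" using n \<eta> by simp
    then have "4096 * ?n * \<eta> \<le> \<nu>" using small by linarith
    then have "4096 * ?n * \<eta> * d ^ 2 \<le> \<nu> * d ^ 2" by (rule mult_right_mono) simp
    then show ?thesis by (simp add: ad power_divide)
  qed
  have d2: "0 < d / 2" "d / 2 \<le> 1" using d0 by auto
  obtain F' \<Phi> where st: "O_ord 3 F'"
    "\<And>s t. 3 \<le> s \<Longrightarrow> O_ord s F \<Longrightarrow> O_ord t ?Z \<Longrightarrow> O_ord (min t (2 * s - 2)) F'"
    "\<And>r S. kills r S (H2 \<omega> + F) \<Longrightarrow> kills r S (H2 \<omega> + F')"
    "wle R' (F' - ?Z) (step_gain TYPE('n) \<nu> (d / 2) a (2 * a / d) * R' ^ 2)"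
    "sym_map R' Ra \<Phi>"
    "\<And>w. w \<in> polydisc R' \<Longrightarrow> ser_eval (H2 \<omega> + F) (\<Phi> w) = ser_eval (H2 \<omega> + F') w"
    using normalization_step[OF \<nu> Ra(1) d2 F3 P Z sm] unfolding R'a by metis
  \<comment> \<open>With \<open>z = 2 * a / d\<close> and loss \<open>d / 2\<close> the remainder is
    \<open>20736 * ?n * \<eta> * a / \<nu>\<close>; \<open>16 * 20736 = 331776\<close> is what
    \<open>400000\<close> covers.\<close>
  have gain: "step_gain TYPE('n) \<nu> (d / 2) a (2 * a / d) \<le> a / 16"
  proof -
    have "step_gain TYPE('n) \<nu> (d / 2) a (2 * a / d) = 20736 * ?n * (a / d ^ 2) * a / \<nu>"
      using d0 \<nu> by (simp add: step_gain_def field_simps power2_eq_square)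
    also have "a / d ^ 2 = \<eta>" using d0 by (simp add: ad)
    also have "20736 * ?n * \<eta> * a / \<nu> \<le> a / 16"
    proof -
      have "0 \<le> ?n * \<eta>" using n \<eta> by simp
      then have "16 * (20736 * ?n * \<eta>) \<le> \<nu>" using small by linarith
      then have "16 * (20736 * ?n * \<eta>) * a \<le> \<nu> * a" by (rule mult_right_mono[OF _ a0(1)])
      then show ?thesis using \<nu> by (simp add: divide_le_eq field_simps)
    qed
    finally show ?thesis .
  qed
  have E: "wle R' (F' - ?Z) (a / 16 * R' ^ 2)"
    by (rule wle_mono[OF st(4)]) (intro mult_right_mono gain, simp)
  define t where "t = min (2 * ?s - 2) r"
  have Zt: "O_ord t ?Z"
    unfolding O_ord_def res_part_apply
    using kills_resonant[OF F s3 kl] by (auto simp: t_def)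
  have F't: "O_ord t F'"
    using st(2)[OF s3 F Zt] by (rule O_ord_le) (simp add: t_def)
  have "wle R ?Z (a * R ^ 2)" by (rule wle_res_part[OF wa]) (use R in simp)
  from wle_ord[OF this Zt R'0(1,3)]
  have Zw: "wle R' ?Z (exp (- d) ^ (t - 2) * a * R' ^ 2)"
  proof (rule wle_mono)
    have t2: "t = (t - 2) + 2" using r by (simp add: t_def)
    have "R' / R = exp (- d)" using R by (simp add: R')
    moreover have "exp (- d) ^ t = exp (- d) ^ (t - 2) * exp (- d) ^ 2" by (metis t2 power_add)
    ultimately have "a * R ^ 2 * (R' / R) ^ t = exp (- d) ^ (t - 2) * a * (R * exp (- d)) ^ 2"
      by (simp only: power_mult_distrib mult_ac)
    then show "a * R ^ 2 * (R' / R) ^ t \<le> exp (- d) ^ (t - 2) * a * R' ^ 2"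
      by (simp only: R' order_refl)
  qed
  have "F' = ?Z + (F' - ?Z)" by simp
  then have F'w: "wle R' F' (exp (- d) ^ (t - 2) * a * R' ^ 2 + a / 16 * R' ^ 2)"
    using wle_add[OF Zw E] R'0 by simp
  have tr: "transforms \<omega> R' R F F'"
    by (rule transforms_extend[OF _ Ra(2)]) (use st(5,6) in \<open>auto simp: transforms_def\<close>)
  have kl': "kills r (eig_list \<omega> r) (H2 \<omega> + F')" by (rule st(3)[OF kl])
  show ?thesis
  proof (cases "2 * ?s - 2 \<le> r")
    case True
    then have t: "t = 2 ^ Suc m + 2" "t - 2 = 2 ^ Suc m" by (simp_all add: t_def)
    \<comment> \<open>The exponent \<open>2 ^ Suc m\<close> times the loss \<open>d\<close> is 2:
      the doubled order makes up for the halved loss. The new size is at most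
      \<open>3 / 16 + 1 / 16 = 1 / 4\<close> of the old one.\<close>
    have "exp (- d) ^ (t - 2) = exp (- 2)"
      by (simp add: t exp_of_nat2_mult[symmetric] d power_mult_distrib[symmetric] flip: power_mult_distrib)
    then have "exp (- d) ^ (t - 2) * a * R' ^ 2 + a / 16 * R' ^ 2 \<le> 3 / 16 * a * R' ^ 2 + a / 16 * R' ^ 2"
      using exp_neg_two a0 by (intro add_mono mult_right_mono) auto
    also have "\<dots> = \<eta> / 4 ^ Suc m * R' ^ 2" by (simp add: a_def)
    finally have "wle R' F' (\<eta> / 4 ^ Suc m * R' ^ 2)" by (rule wle_mono[OF F'w])
    then show ?thesis using that[OF st(1) kl' tr] F't by (simp add: t)
  next
    case False
    then have "O_ord r F'" using F't by (simp add: t_def)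
    moreover have "exp (- d) ^ (t - 2) * a * R' ^ 2 + a / 16 * R' ^ 2 \<le> 1 * a * R' ^ 2 + a * R' ^ 2"
      using a0 d0 by (intro add_mono mult_right_mono power_le_one) auto
    then have "wle R' F' (2 * \<eta> * R' ^ 2)"
    proof (rule wle_mono[OF F'w order_trans])
      have "a * R' ^ 2 \<le> \<eta> * R' ^ 2" using a0 by (intro mult_right_mono) auto
      then show "1 * a * R' ^ 2 + a * R' ^ 2 \<le> 2 * \<eta> * R' ^ 2" by simp
    qed
    ultimately show ?thesis using that[OF st(1) kl' tr] by blast
  qed
qed

text \<open>The losses \<open>(1 / 2) ^ m\<close> sum to less than 2, hence the radius
  \<open>R * exp (- 2)\<close> for every \<open>r\<close>. The disjunction in the induction covers
  the stages after order \<open>r\<close> has been reached, when \<open>F\<close> is merely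
  restricted; \<open>r\<close> stages suffice because \<open>r < 2 ^ r\<close>.\<close>

lemma normalize_to_order:
  fixes F0 :: "'n::finite ser" and \<omega> :: "real ^ 'n"
  assumes \<nu>: "0 < \<nu>" "\<And>q. q \<notin> res_lattice \<omega> \<Longrightarrow> \<nu> \<le> \<bar>freq \<omega> q\<bar>"
    and small: "400000 * nvar TYPE('n) * \<eta> \<le> \<nu>" and \<eta>: "0 \<le> \<eta>"
    and R: "0 < R" and F0: "O_ord 3 F0" and w: "wle R F0 (\<eta> * R ^ 2)"
    and kl: "kills r (eig_list \<omega> r) (H2 \<omega> + F0)" and r: "3 \<le> r"
  obtains F where "O_ord r F" "transforms \<omega> (R * exp (- 2)) R F0 F"
    "wle (R * exp (- 2)) F (2 * \<eta> * (R * exp (- 2)) ^ 2)"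
proof -
  define Rm where "Rm m = R * exp (- (2 - 2 * (1 / 2) ^ m))" for m :: nat
  have Rm0: "0 < Rm m" for m using R by (simp add: Rm_def)
  have RmS: "Rm (Suc m) = Rm m * exp (- ((1 / 2) ^ m))" for m
    by (simp add: Rm_def mult.assoc flip: exp_add)
  have "\<exists>F. O_ord 3 F \<and> kills r (eig_list \<omega> r) (H2 \<omega> + F) \<and> transforms \<omega> (Rm m) R F0 F \<and>
     ((O_ord r F \<and> wle (Rm m) F (2 * \<eta> * Rm m ^ 2)) \<or>
      (O_ord (2 ^ m + 2) F \<and> wle (Rm m) F (\<eta> / 4 ^ m * Rm m ^ 2)))" for m
  proof (induction m)
    case 0
    have "Rm 0 = R" by (simp add: Rm_def)
    then show ?case
      using F0 kl w transforms_refl[of \<omega> R F0] by (intro exI[of _ F0]) (simp add: numeral_3_eq_3)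
  next
    case (Suc m)
    then obtain F where F: "O_ord 3 F" "kills r (eig_list \<omega> r) (H2 \<omega> + F)" "transforms \<omega> (Rm m) R F0 F"
      "(O_ord r F \<and> wle (Rm m) F (2 * \<eta> * Rm m ^ 2)) \<or>
      (O_ord (2 ^ m + 2) F \<and> wle (Rm m) F (\<eta> / 4 ^ m * Rm m ^ 2))" by blast
    have le: "Rm (Suc m) \<le> Rm m" using Rm0[of m] by (simp add: RmS)
    show ?case
    proof (cases "O_ord r F \<and> wle (Rm m) F (2 * \<eta> * Rm m ^ 2)")
      case True
      have "wle (Rm (Suc m)) F (2 * \<eta> * Rm (Suc m) ^ 2)"
        by (rule wle_shrink[OF conjunct2[OF True] O_ord_le[OF F(1)] Rm0 le]) simp
      then show ?thesis using F True transforms_restrict[OF F(3) le] by blast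
    next
      case False
      then have G: "O_ord (2 ^ m + 2) F" "wle (Rm m) F (\<eta> / 4 ^ m * Rm m ^ 2)" using F(4) by auto
      have "2 ^ m + 2 < r"
      proof (rule ccontr)
        assume "\<not> 2 ^ m + 2 < r"
        then have "O_ord r F" using G(1) by (auto intro: O_ord_le)
        moreover have "\<eta> / 4 ^ m * Rm m ^ 2 \<le> 2 * \<eta> * Rm m ^ 2"
        proof (rule mult_right_mono)
          have "\<eta> * 1 \<le> \<eta> * 4 ^ m" by (rule mult_left_mono) (use \<eta> in auto)
          then have "\<eta> / 4 ^ m \<le> \<eta>" by (simp add: divide_le_eq)
          then show "\<eta> / 4 ^ m \<le> 2 * \<eta>" using \<eta> by simp
        qed simp
        ultimately show False using False wle_mono[OF G(2)] by blast
      qed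
      from newton_step[OF \<nu> small \<eta> Rm0 G F(2) this refl RmS]
      obtain F' where "O_ord 3 F'" "kills r (eig_list \<omega> r) (H2 \<omega> + F')" "transforms \<omega> (Rm (Suc m)) (Rm m) F F'"
        "(O_ord r F' \<and> wle (Rm (Suc m)) F' (2 * \<eta> * Rm (Suc m) ^ 2)) \<or>
        (O_ord (2 ^ Suc m + 2) F' \<and> wle (Rm (Suc m)) F' (\<eta> / 4 ^ Suc m * Rm (Suc m) ^ 2))"
        by metis
      then show ?thesis using transforms_trans[OF F(3)] by blast
    qed
  qed
  then obtain F where F: "O_ord 3 F" "transforms \<omega> (Rm r) R F0 F"
     "(O_ord r F \<and> wle (Rm r) F (2 * \<eta> * Rm r ^ 2)) \<or>
      (O_ord (2 ^ r + 2) F \<and> wle (Rm r) F (\<eta> / 4 ^ r * Rm r ^ 2))" by meson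
  have "r < 2 ^ r" by (rule less_exp)
  then have "r \<le> 2 ^ r + 2" by linarith
  then have Fr: "O_ord r F" using F(3) by (meson O_ord_le)
  have "\<eta> / 4 ^ r \<le> 2 * \<eta>"
  proof -
    have "\<eta> * 1 \<le> \<eta> * 4 ^ r" by (rule mult_left_mono) (use \<eta> in auto)
    then have "\<eta> / 4 ^ r \<le> \<eta>" by (simp add: divide_le_eq)
    then show ?thesis using \<eta> by simp
  qed
  then have "\<eta> / 4 ^ r * Rm r ^ 2 \<le> 2 * \<eta> * Rm r ^ 2" by (rule mult_right_mono) simp
  then have Fw: "wle (Rm r) F (2 * \<eta> * Rm r ^ 2)" using F(3) wle_mono by blast
  have le: "R * exp (- 2) \<le> Rm r" using R by (simp add: Rm_def)
  show ?thesis
  proof (rule that[OF Fr transforms_restrict[OF F(2) le]])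
    show "wle (R * exp (- 2)) F (2 * \<eta> * (R * exp (- 2)) ^ 2)"
      by (rule wle_shrink[OF Fw O_ord_le[OF F(1)] _ le]) (use R in auto)
  qed
qed


section \<open>Exponentially small nonresonant terms\<close>

text \<open>The nonresonant part contracts by a factor 4 in each of \<open>K\<close> steps. The resonant part enters
  through its derivative, which is controlled without a Cauchy estimate, so that a loss of order
  \<open>1 / K\<close> per step suffices; the nonresonant part itself is quadratically small and tolerates the
  additional, summable losses \<open>2\<^sup>-\<^sup>i\<close>.\<close>

lemma averaging:
  fixes F0 :: "'n::finite ser" and \<omega> :: "real ^ 'n"
  assumes \<nu>: "0 < \<nu>" "\<And>q. q \<notin> res_lattice \<omega> \<Longrightarrow> \<nu> \<le> \<bar>freq \<omega> q\<bar>"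
    and K: "0 < K" and small: "100000 * nvar TYPE('n) * real K * \<eta> \<le> \<nu>" and \<eta>: "0 \<le> \<eta>"
    and R: "0 < R" and F0: "O_ord r F0" and r: "3 \<le> r" and w: "wle R F0 (\<eta> * R ^ 2)"
  obtains F where "O_ord r F" "transforms \<omega> (R * exp (- 3)) R F0 F"
    "wle (R * exp (- 3)) (nres_part \<omega> F) (\<eta> / 4 ^ K * (R * exp (- 3)) ^ 2)"
    "wle (R * exp (- 3)) (res_part \<omega> F) (4 * \<eta> * (R * exp (- 3)) ^ 2)"
proof -
  let ?n = "nvar TYPE('n)"
  have n: "?n > 0" using nvar_ge[where 'n = 'n] by linarith
  \<comment> \<open>The part \<open>1 / (2 * K)\<close> of a loss serves the resonant interaction,
    the part \<open>(1 / 2) ^ i / 2\<close> the quadratic one. Over \<open>K\<close> steps they add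
    up to less than \<open>3 / 2\<close>; with the initial loss 1 this stays below 3.\<close>
  define di where "di i = (1 / K + (1 / 2) ^ i) / 2" for i :: nat
  define Ri where "Ri i = R * exp (- (1 + i / (2 * K) + (1 - (1 / 2) ^ i)))" for i :: nat
  \<comment> \<open>The start \<open>3 * \<eta>\<close> comes from one Cauchy estimate with loss 1
    and \<open>exp 1 \<le> 3\<close>; all later increments together add at most \<eta>.\<close>
  define zi where "zi i = 3 * \<eta> + \<eta> * (1 - (1 / 2) ^ i)" for i :: nat
  have K1: "1 \<le> real K" using K by simp
  have di: "0 < di i" "di i \<le> 1" "(1 / 2) ^ i / 2 \<le> di i" "1 / (2 * K) \<le> di i" for i
  proof -
    have "1 / real K \<le> 1" using K1 by simp
    moreover have "(1 / 2 :: real) ^ i \<le> 1" by (simp add: power_le_one)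
    ultimately show "di i \<le> 1" by (simp add: di_def)
  qed (use K1 in \<open>simp_all add: di_def add_pos_pos field_simps\<close>)
  have Ri0: "0 < Ri i" for i using R by (simp add: Ri_def)
  have RiS: "Ri (Suc i) = Ri i * exp (- di i)" for i
    using K1 by (simp add: Ri_def di_def mult.assoc field_simps flip: exp_add)
  have zi: "0 \<le> zi i" "zi i \<le> 4 * \<eta>" for i
  proof -
    have "(1 / 2 :: real) ^ i \<le> 1" by (simp add: power_le_one)
    then show "0 \<le> zi i" using \<eta> by (simp add: zi_def)
    have "\<eta> * (1 - (1 / 2) ^ i) \<le> \<eta> * 1" by (rule mult_left_mono) (use \<eta> in auto)
    then show "zi i \<le> 4 * \<eta>" by (simp add: zi_def)
  qed
  have "\<exists>F. O_ord r F \<and> transforms \<omega> (Ri i) R F0 F \<and>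
      wle (Ri i) (nres_part \<omega> F) (\<eta> / 4 ^ i * Ri i ^ 2) \<and>
      wle (Ri i) (eul (res_part \<omega> F)) (zi i * Ri i ^ 2)" for i
  proof (induction i)
    case 0
    have R1: "Ri 0 = R * exp (- 1)" by (simp add: Ri_def)
    have le: "Ri 0 \<le> R" using R by (simp add: R1)
    have F2: "O_ord 2 F0" using F0 r by (auto intro: O_ord_le)
    have "wle (Ri 0) (nres_part \<omega> F0) (\<eta> * Ri 0 ^ 2)"
      using wle_nres_part[OF wle_shrink[OF w F2 Ri0 le]] Ri0[of 0] by simp
    moreover have "wle (Ri 0) (eul (res_part \<omega> F0)) (\<eta> * R ^ 2 / (exp 1 * 1))"
      unfolding R1 by (rule wle_eul[OF wle_res_part[OF w]]) (use R in auto)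
    then have "wle (Ri 0) (eul (res_part \<omega> F0)) (zi 0 * Ri 0 ^ 2)"
    proof (rule wle_mono)
      have "R = Ri 0 * exp 1" by (simp add: R1 mult.assoc flip: exp_add)
      then have "\<eta> * R ^ 2 / (exp 1 * 1) = \<eta> * exp 1 * Ri 0 ^ 2"
        by (simp add: power2_eq_square)
      also have "\<dots> \<le> \<eta> * 3 * Ri 0 ^ 2"
        using \<eta> exp_le by (intro mult_right_mono mult_left_mono) auto
      finally show "\<eta> * R ^ 2 / (exp 1 * 1) \<le> zi 0 * Ri 0 ^ 2" by (simp add: zi_def mult.commute)
    qed
    ultimately show ?case
      using F0 transforms_restrict[OF transforms_refl le] by (intro exI[of _ F0]) simp
  next
    case (Suc i)
    then obtain F where F: "O_ord r F" "transforms \<omega> (Ri i) R F0 F"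
      "wle (Ri i) (nres_part \<omega> F) (\<eta> / 4 ^ i * Ri i ^ 2)"
      "wle (Ri i) (eul (res_part \<omega> F)) (zi i * Ri i ^ 2)" by blast
    let ?d = "di i" and ?a = "\<eta> / 4 ^ i" and ?z = "zi i"
    let ?Q = "step_gain TYPE('n) \<nu> ?d ?a ?z"
    have a0: "0 \<le> ?a" using \<eta> by simp
    have F3: "O_ord 3 F" using F(1) r by (rule O_ord_le)
    have d2: "?a / ?d ^ 2 \<le> 4 * \<eta>"
    proof -
      have "((1 / 2) ^ i / 2) ^ 2 \<le> ?d ^ 2" using di by (intro power_mono) auto
      then have "1 / 4 ^ i \<le> 4 * ?d ^ 2"
        by (simp add: power_divide power_mult[symmetric] mult.commute[of _ 2]) (simp add: power_mult)
      then have "\<eta> * (1 / 4 ^ i) \<le> \<eta> * (4 * ?d ^ 2)" using \<eta> by (intro mult_left_mono) auto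
      then show ?thesis using di(1)[of i] by (simp add: divide_le_eq mult.commute mult.left_commute)
    qed
    have nK: "0 \<le> ?n * \<eta>" "?n * \<eta> * 1 \<le> ?n * \<eta> * K"
      using n \<eta> K1 by (simp, intro mult_left_mono, auto)
    have sm: "1024 * ?n * ?a \<le> \<nu> * ?d ^ 2"
    proof -
      have "1024 * ?n * (?a / ?d ^ 2) \<le> 1024 * ?n * (4 * \<eta>)"
        using n by (intro mult_left_mono d2) auto
      also have "\<dots> \<le> \<nu>" using nK small by (simp add: mult_ac)
      finally show ?thesis using di(1)[of i] by (simp add: divide_le_eq mult_ac)
    qed
    from normalization_step[OF \<nu> Ri0 di(1,2) F3 F(3,4) sm]
    obtain F' \<Phi> where st: "O_ord 3 F'"
      "\<And>s t. 3 \<le> s \<Longrightarrow> O_ord s F \<Longrightarrow> O_ord t (res_part \<omega> F) \<Longrightarrow> O_ord (min t (2 * s - 2)) F'"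
      "wle (Ri (Suc i)) (F' - res_part \<omega> F) (?Q * Ri (Suc i) ^ 2)"
      "wle (Ri (Suc i)) (eul (F' - res_part \<omega> F)) (?Q / ?d * Ri (Suc i) ^ 2)"
      "sym_map (Ri (Suc i)) (Ri i) \<Phi>"
      "\<And>w. w \<in> polydisc (Ri (Suc i)) \<Longrightarrow> ser_eval (H2 \<omega> + F) (\<Phi> w) = ser_eval (H2 \<omega> + F') w"
      unfolding RiS by metis
    \<comment> \<open>The uniform part of the loss gives
      \<open>?z / ?d \<le> 8 * \<eta> * K\<close>, the geometric part gives
      \<open>8 * (?a / ?d ^ 2) \<le> 32 * \<eta>\<close>; \<open>4 * 576 * 40 = 92160\<close> lies
      below \<open>100000\<close>.\<close>
    have gain: "?Q \<le> \<eta> / 4 ^ Suc i"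
    proof -
      have "?Q = ?a * (576 * ?n / \<nu> * (?z / ?d + 8 * (?a / ?d ^ 2)))"
        using \<nu> di(1)[of i] by (simp add: step_gain_def field_simps power2_eq_square)
      also have "\<dots> \<le> ?a * (1 / 4)"
      proof (rule mult_left_mono[OF _ a0])
        have "?z / ?d \<le> 4 * \<eta> * (2 * K)"
        proof -
          have "1 / ?d \<le> 2 * K" using di(1,4)[of i] K1 by (simp add: field_simps)
          then have "?z * (1 / ?d) \<le> 4 * \<eta> * (2 * K)" using zi[of i] di(1)[of i] \<eta> by (intro mult_mono) auto
          then show ?thesis by simp
        qed
        moreover have "\<eta> * 1 \<le> \<eta> * K" using \<eta> K1 by (intro mult_left_mono) auto
        ultimately have "?z / ?d + 8 * (?a / ?d ^ 2) \<le> 40 * (\<eta> * K)" using d2 by linarith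
        then have "576 * ?n / \<nu> * (?z / ?d + 8 * (?a / ?d ^ 2)) \<le> 576 * ?n / \<nu> * (40 * (\<eta> * K))"
          using n \<nu> by (intro mult_left_mono) auto
        also have "\<dots> \<le> 1 / 4"
        proof -
          have "0 \<le> ?n * real K * \<eta>" using n \<eta> by simp
          then have "92160 * (?n * real K * \<eta>) \<le> \<nu>" using small by linarith
          then show ?thesis using \<nu> by (simp add: field_simps)
        qed
        finally show "576 * ?n / \<nu> * (?z / ?d + 8 * (?a / ?d ^ 2)) \<le> 1 / 4" .
      qed
      finally show ?thesis by simp
    qed
    have r2: "min r (2 * r - 2) = r" using r by simp
    have F'r: "O_ord r F'" using st(2)[OF r F(1) O_ord_res_part[OF F(1)]] unfolding r2 .
    have nr: "nres_part \<omega> F' = nres_part \<omega> (F' - res_part \<omega> F)"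
      by (rule ext) (simp add: nres_part_apply res_part_apply ser_apply)
    have N: "wle (Ri (Suc i)) (nres_part \<omega> F') (\<eta> / 4 ^ Suc i * Ri (Suc i) ^ 2)"
      unfolding nr using Ri0[of "Suc i"]
      by (intro wle_nres_part wle_mono[OF st(3)] mult_right_mono gain) auto
    have le: "Ri (Suc i) \<le> Ri i" using Ri0[of i] di(1)[of i] by (simp add: RiS)
    have re: "eul (res_part \<omega> F') = eul (res_part \<omega> F) + eul (res_part \<omega> (F' - res_part \<omega> F))"
      by (rule ext) (simp add: eul_apply res_part_apply ser_apply algebra_simps)
    have "wle (Ri (Suc i)) (eul (res_part \<omega> F')) (?z * Ri (Suc i) ^ 2 + ?Q / ?d * Ri (Suc i) ^ 2)"
      unfolding re
    proof (rule wle_add)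
      show "wle (Ri (Suc i)) (eul (res_part \<omega> F)) (?z * Ri (Suc i) ^ 2)"
        by (rule wle_shrink[OF F(4) O_ord_eul[OF O_ord_res_part[OF O_ord_le[OF F3]]] Ri0 le]) simp
      show "wle (Ri (Suc i)) (eul (res_part \<omega> (F' - res_part \<omega> F))) (?Q / ?d * Ri (Suc i) ^ 2)"
        by (rule wle_le[OF st(4)]) (use Ri0[of "Suc i"] in \<open>auto simp: eul_apply res_part_apply norm_mult\<close>)
    qed (use Ri0[of "Suc i"] in simp)
    \<comment> \<open>The remainder is at most \<open>?a / 4\<close>; dividing it by a loss of at
      least \<open>(1 / 2) ^ i / 2\<close> turns the decay \<open>4 ^ i\<close> into
      \<open>2 ^ i\<close>, which is still summable.\<close>
    moreover have e: "?z + ?Q / ?d \<le> zi (Suc i)"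
    proof -
      have "?Q / ?d \<le> (?a / 4) / ?d" using gain di(1)[of i] by (intro divide_right_mono) auto
      also have "\<dots> \<le> (?a / 4) / ((1 / 2) ^ i / 2)"
        using a0 di by (intro divide_left_mono mult_pos_pos) auto
      also have "\<dots> = \<eta> * ((1 / 2) ^ i / 2)"
      proof -
        have "(4 :: real) ^ i = 2 ^ i * 2 ^ i" by (simp flip: power_mult_distrib)
        then show ?thesis by (simp add: power_divide)
      qed
      finally show ?thesis by (simp add: zi_def algebra_simps)
    qed
    ultimately have Z: "wle (Ri (Suc i)) (eul (res_part \<omega> F')) (zi (Suc i) * Ri (Suc i) ^ 2)"
      using mult_right_mono[OF e, of "Ri (Suc i) ^ 2"] by (elim wle_mono) (simp add: distrib_right)
    have "transforms \<omega> (Ri (Suc i)) (Ri i) F F'"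
      unfolding transforms_def using st(5,6) by blast
    then show ?case using F'r N Z transforms_trans[OF F(2)] by blast
  qed
  then obtain F where F: "O_ord r F" "transforms \<omega> (Ri K) R F0 F"
      "wle (Ri K) (nres_part \<omega> F) (\<eta> / 4 ^ K * Ri K ^ 2)"
      "wle (Ri K) (eul (res_part \<omega> F)) (zi K * Ri K ^ 2)" by meson
  let ?R = "R * exp (- 3)"
  have le: "?R \<le> Ri K"
  proof -
    have "1 + K / (2 * K) + (1 - (1 / 2) ^ K) \<le> (3 :: real)"
    proof -
      have "real K / (2 * K) = 1 / 2" using K by simp
      moreover have "0 \<le> (1 / 2 :: real) ^ K" by simp
      ultimately show ?thesis by linarith
    qed
    then show ?thesis using R unfolding Ri_def by (intro mult_left_mono) auto
  qed
  have R3: "0 < ?R" using R by simp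
  have F2: "O_ord 2 F" and F1: "O_ord 1 F" using F(1) r by (auto intro: O_ord_le)
  show ?thesis
  proof (rule that[OF F(1) transforms_restrict[OF F(2) le]])
    show "wle ?R (nres_part \<omega> F) (\<eta> / 4 ^ K * ?R ^ 2)"
      by (rule wle_shrink[OF F(3) O_ord_nres_part[OF F2] R3 le])
    have "wle ?R (eul (res_part \<omega> F)) (zi K * ?R ^ 2)"
      by (rule wle_shrink[OF F(4) O_ord_eul[OF O_ord_res_part[OF F2]] R3 le])
    then have "wle ?R (res_part \<omega> F) (zi K * ?R ^ 2)"
      by (rule wle_of_eul[OF _ O_ord_res_part[OF F1]]) (use R3 in simp)
    then show "wle ?R (res_part \<omega> F) (4 * \<eta> * ?R ^ 2)"
      by (rule wle_mono) (intro mult_right_mono zi, simp)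
  qed
qed


section \<open>Small denominators\<close>

lemma finite_int_norm1: "finite {k :: int ^ 'n. int_norm1 k \<le> int s}"
proof (rule finite_imageD)
  show "finite (vec_nth ` {k :: int ^ 'n. int_norm1 k \<le> int s})"
  proof (rule finite_subset)
    show "vec_nth ` {k :: int ^ 'n. int_norm1 k \<le> int s} \<subseteq> PiE UNIV (\<lambda>_. {- int s..int s})"
    proof (rule image_subsetI)
      fix k :: "int ^ 'n" assume "k \<in> {k. int_norm1 k \<le> int s}"
      then have "\<bar>k $ j\<bar> \<le> int s" for j
        unfolding int_norm1_def using member_le_sum[of j UNIV "\<lambda>j. \<bar>k $ j\<bar>"] by fastforce
      then show "vec_nth k \<in> PiE UNIV (\<lambda>_. {- int s..int s})"
        by (auto simp: abs_le_iff minus_le_iff)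
    qed
    show "finite (PiE (UNIV :: 'n set) (\<lambda>_. {- int s..int s}))" by (rule finite_PiE) auto
  qed
  show "inj_on vec_nth {k :: int ^ 'n. int_norm1 k \<le> int s}"
    by (rule inj_onI) (simp add: vec_eq_iff)
qed

text \<open>All frequencies are multiples of \<open>\<lambda> / p\<close>, so there is a smallest nonzero one, and its
  inverse is the eventual value of \<open>Omega \<omega>\<close>.\<close>

lemma frequency_gap:
  fixes \<omega> :: "real ^ 'n"
  assumes "0 < p" "0 < lam" "\<And>j. \<omega> $ j = lam * real_of_int (q $ j) / real_of_int p"
    and nr: "k0 \<notin> res_lattice \<omega>"
  obtains \<nu> where "lam / real_of_int p \<le> \<nu>" "\<And>k. k \<notin> res_lattice \<omega> \<Longrightarrow> \<nu> \<le> \<bar>freq \<omega> k\<bar>"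
    "\<forall>\<^sub>F s in sequentially. Omega \<omega> s = 1 / \<nu>"
proof -
  define c where "c = lam / real_of_int p"
  have c: "0 < c" using assms by (simp add: c_def)
  define m where "m k = (\<Sum>j\<in>UNIV. q $ j * k $ j)" for k
  have fr: "freq \<omega> k = c * real_of_int (m k)" for k
    by (simp add: freq_def assms(3) c_def m_def sum_distrib_left mult.assoc)
  have nri: "k \<notin> res_lattice \<omega> \<longleftrightarrow> m k \<noteq> 0" for k
    using c by (simp add: res_lattice_def fr)
  define k1 where "k1 = arg_min (\<lambda>k. nat \<bar>m k\<bar>) (\<lambda>k. k \<notin> res_lattice \<omega>)"
  have k1: "k1 \<notin> res_lattice \<omega>" "\<And>k. k \<notin> res_lattice \<omega> \<Longrightarrow> nat \<bar>m k1\<bar> \<le> nat \<bar>m k\<bar>"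
    unfolding k1_def
    using arg_min_nat_lemma[of "\<lambda>k. k \<notin> res_lattice \<omega>", OF nr, of "\<lambda>k. nat \<bar>m k\<bar>"] by auto
  define \<nu> where "\<nu> = \<bar>freq \<omega> k1\<bar>"
  have le: "\<nu> \<le> \<bar>freq \<omega> k\<bar>" if "k \<notin> res_lattice \<omega>" for k
  proof -
    have "\<bar>m k1\<bar> \<le> \<bar>m k\<bar>" using k1(2)[OF that] by linarith
    then have "real_of_int \<bar>m k1\<bar> \<le> real_of_int \<bar>m k\<bar>" by (simp only: of_int_le_iff)
    then show ?thesis using c by (simp add: \<nu>_def fr abs_mult)
  qed
  have "1 \<le> \<bar>m k1\<bar>" using k1(1) nri by (metis abs_ge_zero abs_le_zero_iff int_one_le_iff_zero_less le_less linorder_not_less)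
  then have "1 \<le> real_of_int \<bar>m k1\<bar>" by linarith
  then have c\<nu>: "c \<le> \<nu>" using c by (simp add: \<nu>_def fr abs_mult)
  have "Omega \<omega> s = 1 / \<nu>" if s: "nat (int_norm1 k1) \<le> s" for s
    unfolding Omega_def
  proof (rule Max_eqI)
    let ?A = "{1 / \<bar>freq \<omega> q\<bar> |q. q \<notin> res_lattice \<omega> \<and> int_norm1 q \<le> int s}"
    have "?A \<subseteq> (\<lambda>q. 1 / \<bar>freq \<omega> q\<bar>) ` {k. int_norm1 k \<le> int s}" by auto
    then show "finite ?A" by (rule finite_subset) (intro finite_imageI finite_int_norm1)
    show "1 / \<nu> \<in> ?A" unfolding \<nu>_def using k1(1) s by (intro CollectI exI[of _ k1]) auto
    fix y assume "y \<in> ?A"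
    then obtain k where "y = 1 / \<bar>freq \<omega> k\<bar>" "k \<notin> res_lattice \<omega>" by blast
    then show "y \<le> 1 / \<nu>" using le[of k] c\<nu> c by (auto intro!: divide_left_mono mult_pos_pos)
  qed
  then have "\<forall>\<^sub>F s in sequentially. Omega \<omega> s = 1 / \<nu>"
    by (rule eventually_sequentiallyI)
  then show ?thesis using that[of \<nu>] c\<nu> le by (simp add: c_def)
qed

text \<open>The value 1 only matters if there are no nonresonant frequencies, and then every positive
  number bounds them from below.\<close>

definition gap_of :: "(nat \<Rightarrow> real) \<Rightarrow> real" where
  "gap_of Om = (if \<exists>y>0. \<forall>\<^sub>F s in sequentially. Om s = 1 / y
     then SOME y. 0 < y \<and> (\<forall>\<^sub>F s in sequentially. Om s = 1 / y) else 1)"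

lemma gap_of_pos: "0 < gap_of Om"
proof (cases "\<exists>y>0. \<forall>\<^sub>F s in sequentially. Om s = 1 / y")
  case True
  from someI_ex[OF this] show ?thesis using True by (simp add: gap_of_def)
next
  case False
  then show ?thesis by (simp only: gap_of_def if_False zero_less_one)
qed

lemma gap_of_eq:
  assumes "0 < \<nu>" "\<forall>\<^sub>F s in sequentially. Om s = 1 / \<nu>" shows "gap_of Om = \<nu>"
proof -
  have ex: "\<exists>y>0. \<forall>\<^sub>F s in sequentially. Om s = 1 / y" using assms by blast
  from someI_ex[OF this] have y: "0 < gap_of Om" "\<forall>\<^sub>F s in sequentially. Om s = 1 / gap_of Om"
    using ex by (simp_all add: gap_of_def)
  have "\<forall>\<^sub>F s :: nat in sequentially. 1 / gap_of Om = 1 / \<nu>"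
    using eventually_conj[OF y(2) assms(2)] by (rule eventually_mono) auto
  then have "1 / gap_of Om = 1 / \<nu>" by simp
  then show ?thesis by simp
qed


section \<open>The main estimate\<close>

text \<open>At radius \<open>\<theta> * \<rho> / 4\<close>, with \<theta> the minimum in the
  formula, a series of order 3 bounded by \<open>B\<close> has size \<open>B * \<theta> ^ 3\<close>,
  which is \<open>eta0\<close> times the squared radius. The second entry of the minimum ensures
  \<open>400000 * nvar * eta0 \<le> \<nu>\<close>; note
  \<open>6400000 = 16 * 400000\<close>.\<close>

definition eta0 :: "'n::finite itself \<Rightarrow> real \<Rightarrow> real \<Rightarrow> real \<Rightarrow> real" where
  "eta0 T \<rho> B \<nu> = 16 * B * min 1 (\<nu> * \<rho> ^ 2 / (6400000 * nvar T * B)) / \<rho> ^ 2"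

definition rad1 :: "'n::finite itself \<Rightarrow> real \<Rightarrow> real \<Rightarrow> real \<Rightarrow> real" where
  "rad1 T \<rho> B \<nu> = min 1 (\<nu> * \<rho> ^ 2 / (6400000 * nvar T * B)) * \<rho> / 4 * exp (- 2)"

text \<open>\<open>1 / (\<nu> + 2)\<close> compensates the number of averaging steps, at most
  \<open>\<nu> * \<delta> + 2\<close>; \<open>exp (- 3)\<close> is the loss of
  \<open>averaging\<close>; the last 2 leaves room between the closed ball and the open
  polydisc.\<close>

definition const_z :: "'n::finite itself \<Rightarrow> real \<Rightarrow> real \<Rightarrow> real \<Rightarrow> real" where
  "const_z T \<rho> B \<nu> = rad1 T \<rho> B \<nu> / (\<nu> + 2) * exp (- 3) / 2"

text \<open>\<open>8 = 4 * 2\<close>: the resonant bound of \<open>averaging\<close> times the final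
  bound of \<open>normalize_to_order\<close>.\<close>

definition const_H :: "'n::finite itself \<Rightarrow> real \<Rightarrow> real \<Rightarrow> real \<Rightarrow> real" where
  "const_H T \<rho> B \<nu> = 8 * eta0 T \<rho> B \<nu> * rad1 T \<rho> B \<nu> ^ 2"

lemma one_add_power_ge:
  fixes x :: real assumes x: "0 \<le> x" and m: "1 \<le> m" shows "1 + x ^ m \<le> (1 + x) ^ m"
  using m
proof (induction m rule: nat_induct_at_least)
  case (Suc m)
  have "1 + x ^ Suc m \<le> (1 + x ^ m) * (1 + x)" using x by (simp add: algebra_simps)
  also have "\<dots> \<le> (1 + x) ^ m * (1 + x)" using Suc x by (intro mult_right_mono) auto
  finally show ?case by (simp add: mult.commute)
qed simp

lemma const_pos:
  assumes "0 < \<rho>" "0 < B" "0 < \<nu>"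
  shows "0 < eta0 TYPE('n::finite) \<rho> B \<nu>" "0 < rad1 TYPE('n) \<rho> B \<nu>"
    "0 < const_z TYPE('n) \<rho> B \<nu>" "0 < const_H TYPE('n) \<rho> B \<nu>"
proof -
  have n: "nvar TYPE('n) > 0" using nvar_ge[where 'n = 'n] by linarith
  have t: "0 < min 1 (\<nu> * \<rho> ^ 2 / (6400000 * nvar TYPE('n) * B))" using assms n by simp
  show e: "0 < eta0 TYPE('n) \<rho> B \<nu>" unfolding eta0_def
    by (intro divide_pos_pos mult_pos_pos t) (use assms in auto)
  show r: "0 < rad1 TYPE('n) \<rho> B \<nu>" unfolding rad1_def
    by (intro divide_pos_pos mult_pos_pos t) (use assms in auto)
  show "0 < const_z TYPE('n) \<rho> B \<nu>" using assms r by (simp add: const_z_def)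
  show "0 < const_H TYPE('n) \<rho> B \<nu>" using e r by (simp add: const_H_def)
qed

lemma main_estimate:
  fixes \<omega> :: "real ^ 'n::finite" and H N :: "'n ser"
  assumes \<nu>: "0 < \<nu>" "\<And>q. q \<notin> res_lattice \<omega> \<Longrightarrow> \<nu> \<le> \<bar>freq \<omega> q\<bar>"
    and \<rho>: "0 < \<rho>" and B: "0 < B" and H: "O_ord 3 H" "wle (\<rho> / 4) H B"
    and nf: "is_normal_form \<omega> H N" and N: "O_ord r N" and r: "3 \<le> r" and \<delta>: "0 \<le> \<delta>"
    and Rf: "Rf = 2 * const_z TYPE('n) \<rho> B \<nu> / (1 + \<delta> powr (1 / (real r - 2)))"
    and C: "C = const_H TYPE('n) \<rho> B \<nu> / (1 + \<delta> powr (real r / (real r - 2)))"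
  obtains G where "O_ord r G" "transforms \<omega> Rf \<rho> H G"
    "wle Rf (res_part \<omega> G) C" "wle Rf (nres_part \<omega> G) (exp (- \<nu> * \<delta>) * C)"
proof -
  let ?n = "nvar TYPE('n)"
  have n: "?n > 0" using nvar_ge[where 'n = 'n] by linarith
  define \<theta> where "\<theta> = min 1 (\<nu> * \<rho> ^ 2 / (6400000 * ?n * B))"
  have \<theta>: "0 < \<theta>" "\<theta> \<le> 1" "\<theta> \<le> \<nu> * \<rho> ^ 2 / (6400000 * ?n * B)"
    using \<nu> \<rho> n B by (auto simp: \<theta>_def)
  define R0 where "R0 = \<theta> * \<rho> / 4"
  define \<eta> where "\<eta> = eta0 TYPE('n) \<rho> B \<nu>"
  have \<eta>e: "\<eta> = 16 * B * \<theta> / \<rho> ^ 2" by (simp add: \<eta>_def eta0_def \<theta>_def)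
  have \<eta>0: "0 < \<eta>" unfolding \<eta>_def by (rule const_pos(1)[OF \<rho> B \<nu>(1)])
  define R1 where "R1 = R0 * exp (- 2)"
  have R1e: "R1 = rad1 TYPE('n) \<rho> B \<nu>" by (simp add: R1_def R0_def rad1_def \<theta>_def)
  have R0: "0 < R0" "R0 \<le> \<rho> / 4" using \<theta> \<rho> by (simp_all add: R0_def mult_left_le_one_le)
  have R1: "0 < R1" using R0 by (simp add: R1_def)
  have "wle R0 H (B * (R0 / (\<rho> / 4)) ^ 3)" by (rule wle_ord[OF H(2,1) R0])
  moreover have "B * (R0 / (\<rho> / 4)) ^ 3 = \<eta> * R0 ^ 2"
    using \<rho> by (simp add: R0_def \<eta>e power2_eq_square power3_eq_cube)
  ultimately have H0: "wle R0 H (\<eta> * R0 ^ 2)" by simp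
  have small: "400000 * ?n * \<eta> \<le> \<nu>"
  proof -
    have "400000 * ?n * \<eta> = \<theta> * (6400000 * ?n * B) / \<rho> ^ 2" by (simp add: \<eta>e)
    also have "\<dots> \<le> \<nu> * \<rho> ^ 2 / \<rho> ^ 2"
      using \<theta>(3) n B by (intro divide_right_mono) (auto simp: le_divide_eq)
    finally show ?thesis using \<rho> by simp
  qed
  obtain F1 where F1: "O_ord r F1" "transforms \<omega> R1 R0 H F1" "wle R1 F1 (2 * \<eta> * R1 ^ 2)"
    using normalize_to_order[OF \<nu> small less_imp_le[OF \<eta>0] R0(1) H(1) H0 kills_flow[OF nf N r] r]
    unfolding R1_def by metis
  define x where "x = \<delta> powr (1 / (real r - 2))"
  have x0: "0 \<le> x" by (simp add: x_def)
  have rr: "real (r - 2) = real r - 2" using r by simp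
  have xr: "x ^ (r - 2) = \<delta>"
  proof (cases "\<delta> = 0")
    case True
    then show ?thesis using r by (simp add: x_def)
  next
    case False
    then have "x ^ (r - 2) = x powr (real (r - 2))" using \<delta> by (simp add: x_def powr_realpow)
    also have "\<dots> = \<delta>" using r \<delta> False by (simp add: x_def powr_powr rr)
    finally show ?thesis .
  qed
  have xr2: "\<delta> powr (real r / (real r - 2)) = x ^ 2 * \<delta>"
  proof (cases "\<delta> = 0")
    case False
    have "real r / (real r - 2) = 1 / (real r - 2) * 2 + 1" using r by (simp add: field_simps)
    then have "\<delta> powr (real r / (real r - 2)) = \<delta> powr (1 / (real r - 2) * 2) * \<delta>"
      using \<delta> False by (simp add: powr_add)
    also have "\<delta> powr (1 / (real r - 2) * 2) = x ^ 2"
      using \<delta> False by (simp only: powr_powr[symmetric] x_def) (simp add: powr_numeral)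
    finally show ?thesis .
  qed simp
  have xge: "1 + \<delta> \<le> (1 + x) ^ (r - 2)"
    using one_add_power_ge[OF x0, of "r - 2"] r by (simp add: xr)
  define \<beta> where "\<beta> = 1 / (\<nu> + 2)"
  have \<beta>: "0 < \<beta>" "\<beta> \<le> 1" using \<nu> by (simp_all add: \<beta>_def)
  define \<epsilon> where "\<epsilon> = \<beta> * R1 / (1 + x)"
  have \<epsilon>0: "0 < \<epsilon>" using \<beta> R1 x0 by (simp add: \<epsilon>_def)
  have "\<beta> * R1 \<le> 1 * R1" by (rule mult_right_mono) (use \<beta> R1 in auto)
  also have "\<dots> \<le> R1 * (1 + x)" using R1 x0 by (simp add: distrib_left)
  finally have \<epsilon>R: "\<epsilon> \<le> R1" using x0 by (simp add: \<epsilon>_def divide_le_eq)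
  \<comment> \<open>The size relative to the squared radius scales by
    \<open>(\<epsilon> / R1) ^ (r - 2)\<close>, and
    \<open>(1 + x) ^ (r - 2) \<ge> 1 + \<delta>\<close>. Only one of the \<open>r - 2\<close>
    factors \<beta> is kept, so that the bound is uniform in \<open>r\<close>.\<close>
  define h where "h = 2 * \<eta> * \<beta> / (1 + \<delta>)"
  have h0: "0 \<le> h" using \<eta>0 \<beta> \<delta> by (simp add: h_def)
  have Fe: "wle \<epsilon> F1 (h * \<epsilon> ^ 2)"
  proof (rule wle_mono[OF wle_ord[OF F1(3,1) \<epsilon>0 \<epsilon>R]])
    have r2: "r = 2 + (r - 2)" using r by simp
    have "(\<epsilon> / R1) ^ (r - 2) = \<beta> ^ (r - 2) / (1 + x) ^ (r - 2)"
      using R1 by (simp add: \<epsilon>_def power_divide)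
    also have "\<dots> \<le> \<beta> ^ 1 / (1 + \<delta>)"
      using \<beta> \<delta> xge r by (intro frac_le power_decreasing) auto
    finally have "(\<epsilon> / R1) ^ (r - 2) \<le> \<beta> / (1 + \<delta>)" by simp
    then have le: "2 * \<eta> * \<epsilon> ^ 2 * (\<epsilon> / R1) ^ (r - 2) \<le> 2 * \<eta> * \<epsilon> ^ 2 * (\<beta> / (1 + \<delta>))"
      using \<eta>0 by (intro mult_left_mono) auto
    have "(\<epsilon> / R1) ^ r = (\<epsilon> / R1) ^ 2 * (\<epsilon> / R1) ^ (r - 2)" by (metis r2 power_add)
    moreover have "R1 ^ 2 * (\<epsilon> / R1) ^ 2 = \<epsilon> ^ 2" using R1 by (simp add: power_divide)
    ultimately have "2 * \<eta> * R1 ^ 2 * (\<epsilon> / R1) ^ r = 2 * \<eta> * \<epsilon> ^ 2 * (\<epsilon> / R1) ^ (r - 2)"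
      by (metis mult.assoc)
    also note le
    also have "2 * \<eta> * \<epsilon> ^ 2 * (\<beta> / (1 + \<delta>)) = h * \<epsilon> ^ 2" by (simp add: h_def)
    finally show "2 * \<eta> * R1 ^ 2 * (\<epsilon> / R1) ^ r \<le> h * \<epsilon> ^ 2" .
  qed
  \<comment> \<open>\<open>K\<close> is at least \<open>\<nu> * \<delta>\<close> and 4 exceeds
    \<open>exp 1\<close>, so the contraction by \<open>4 ^ K\<close> beats
    \<open>exp (\<nu> * \<delta>)\<close>; the added 1 keeps \<open>K\<close> positive at
    \<open>\<delta> = 0\<close>.\<close>
  define K where "K = nat \<lceil>\<nu> * \<delta>\<rceil> + 1"
  have K0: "0 < K" by (simp add: K_def)
  have \<nu>\<delta>: "0 \<le> \<nu> * \<delta>" using \<nu> \<delta> by simp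
  have "real K = of_int \<lceil>\<nu> * \<delta>\<rceil> + 1" using \<nu>\<delta> by (simp add: K_def)
  then have Kle: "real K \<le> \<nu> * \<delta> + 2" "\<nu> * \<delta> \<le> real K"
    using of_int_ceiling_le_add_one[of "\<nu> * \<delta>"] le_of_int_ceiling[of "\<nu> * \<delta>"] by linarith+
  have smallK: "100000 * ?n * real K * h \<le> \<nu>"
  proof -
    have "real K \<le> (\<nu> + 2) * (1 + \<delta>)" using Kle \<nu> \<delta> by (simp add: algebra_simps)
    then have "real K * h \<le> (\<nu> + 2) * (1 + \<delta>) * h" by (rule mult_right_mono[OF _ h0])
    also have "\<dots> = 2 * \<eta>"
    proof -
      have "1 + \<delta> \<noteq> 0" "\<nu> + 2 \<noteq> 0" using \<delta> \<nu> by auto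
      then show ?thesis by (simp add: h_def \<beta>_def)
    qed
    finally have "100000 * ?n * (real K * h) \<le> 100000 * ?n * (2 * \<eta>)"
      using n by (intro mult_left_mono) auto
    also have "\<dots> \<le> 400000 * ?n * \<eta>" using n \<eta>0 by simp
    also note small
    finally show ?thesis by (simp only: mult.assoc)
  qed
  obtain G where G: "O_ord r G" "transforms \<omega> (\<epsilon> * exp (- 3)) \<epsilon> F1 G"
    "wle (\<epsilon> * exp (- 3)) (nres_part \<omega> G) (h / 4 ^ K * (\<epsilon> * exp (- 3)) ^ 2)"
    "wle (\<epsilon> * exp (- 3)) (res_part \<omega> G) (4 * h * (\<epsilon> * exp (- 3)) ^ 2)"
    using averaging[OF \<nu> K0 smallK h0 \<epsilon>0 F1(1) r Fe] by metis
  have two: "2 * (t / 2) = t" for t :: real by simp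
  have Rfe: "Rf = \<epsilon> * exp (- 3)"
    unfolding Rf const_z_def two by (simp add: \<epsilon>_def \<beta>_def R1e x_def)
  \<comment> \<open>The relative size supplies \<open>1 + \<delta>\<close> and the squared radius
    \<open>(1 + x) ^ 2\<close>; their product dominates \<open>1 + x ^ 2 * \<delta>\<close>, and
    \<open>x ^ 2 * \<delta>\<close> is \<delta> to the power \<open>r / (r - 2)\<close>.\<close>
  have h\<epsilon>: "4 * h * Rf ^ 2 \<le> C"
  proof -
    have "Rf ^ 2 \<le> (R1 / (1 + x)) ^ 2"
    proof (rule power_mono)
      have "\<beta> * exp (- 3) \<le> 1" using \<beta> by (intro mult_le_one) auto
      then have "R1 * (\<beta> * exp (- 3)) / (1 + x) \<le> R1 * 1 / (1 + x)"
        using R1 x0 by (intro divide_right_mono mult_left_mono) auto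
      then show "Rf \<le> R1 / (1 + x)" by (simp add: Rfe \<epsilon>_def mult_ac)
    qed (use \<epsilon>0 in \<open>simp add: Rfe\<close>)
    moreover have "h \<le> 2 * \<eta> / (1 + \<delta>)"
      unfolding h_def using \<beta> \<eta>0 \<delta> by (intro divide_right_mono) auto
    ultimately have "4 * h * Rf ^ 2 \<le> 4 * (2 * \<eta> / (1 + \<delta>)) * (R1 / (1 + x)) ^ 2"
      using \<eta>0 \<delta> h0 by (intro mult_mono) auto
    also have "\<dots> = 8 * \<eta> * R1 ^ 2 / ((1 + \<delta>) * (1 + x) ^ 2)" by (simp add: power_divide)
    also have "\<dots> \<le> 8 * \<eta> * R1 ^ 2 / (1 + x ^ 2 * \<delta>)"
    proof (rule divide_left_mono)
      have "(1 + \<delta>) * (1 + x) ^ 2 = 1 + x ^ 2 * \<delta> + (2 * x + x ^ 2 + \<delta> + 2 * x * \<delta>)"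
        by (simp add: power2_eq_square algebra_simps)
      then show "1 + x ^ 2 * \<delta> \<le> (1 + \<delta>) * (1 + x) ^ 2" using x0 \<delta> by simp
      have "0 < 1 + x ^ 2 * \<delta>" using \<delta> by (simp add: add_pos_nonneg)
      moreover have "0 < (1 + \<delta>) * (1 + x) ^ 2" using x0 \<delta> by simp
      ultimately show "0 < (1 + \<delta>) * (1 + x) ^ 2 * (1 + x ^ 2 * \<delta>)" by (rule mult_pos_pos[rotated])
    qed (use \<eta>0 in simp)
    finally show ?thesis by (simp add: C const_H_def \<eta>_def R1e xr2)
  qed
  have R\<rho>: "R0 \<le> \<rho>" using R0 \<rho> by simp
  show ?thesis
  proof (rule that[OF G(1)])
    show "transforms \<omega> Rf \<rho> H G"
      unfolding Rfe
      by (rule transforms_trans[OF transforms_extend[OF F1(2) R\<rho>] transforms_extend[OF G(2) \<epsilon>R]])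
    show "wle Rf (res_part \<omega> G) C"
      using wle_mono[OF G(4)[folded Rfe] h\<epsilon>] .
    show "wle Rf (nres_part \<omega> G) (exp (- \<nu> * \<delta>) * C)"
    proof (rule wle_mono[OF G(3)[folded Rfe]])
      have "exp (1 :: real) \<le> 4" using exp_le by linarith
      then have "exp 1 ^ K \<le> (4 :: real) ^ K" by (intro power_mono) auto
      then have "exp (real K) \<le> (4 :: real) ^ K" by (simp flip: exp_of_nat_mult)
      moreover have "exp (\<nu> * \<delta>) \<le> exp (real K)" using Kle by simp
      ultimately have "exp (\<nu> * \<delta>) \<le> (4 :: real) ^ K" by linarith
      then have "1 / 4 ^ K \<le> 1 / exp (\<nu> * \<delta>)" by (intro divide_left_mono) auto
      then have e: "1 / 4 ^ K \<le> exp (- \<nu> * \<delta>)" by (simp add: exp_minus inverse_eq_divide)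
      have "h / 4 ^ K * Rf ^ 2 = 1 / 4 ^ K * (h * Rf ^ 2)" by simp
      also have "\<dots> \<le> exp (- \<nu> * \<delta>) * C"
      proof (rule mult_mono[OF e])
        have "0 \<le> h * Rf ^ 2" using h0 by simp
        then show "h * Rf ^ 2 \<le> C" using h\<epsilon> by linarith
      qed (use h0 in auto)
      finally show "h / 4 ^ K * Rf ^ 2 \<le> exp (- \<nu> * \<delta>) * C" .
    qed
  qed
qed

lemma norm_pcmp_le_pt_norm1: "cmod (pcmp w v) \<le> pt_norm1 w"
proof -
  have "pt_norm1 w = (\<Sum>v\<in>UNIV. cmod (pcmp w v))"
    by (simp add: pt_norm1_def sum_UNIV_Plus sum.distrib)
  then show ?thesis using member_le_sum[of v UNIV "\<lambda>v. cmod (pcmp w v)"] by simp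
qed


theorem corollary5p1:
  shows "\<exists>C_z C_H :: real \<Rightarrow> real \<Rightarrow> (nat \<Rightarrow> real) \<Rightarrow> real.
    (\<forall>\<rho> M Om. 0 < C_z \<rho> M Om \<and> 0 < C_H \<rho> M Om) \<and>
    (\<forall>(\<omega> :: real ^ 'n) (\<rho> :: real) (Hhat :: 'n ser) (N :: 'n ser) (r :: nat)
      (q :: int ^ 'n) (p :: int) (lam :: real).
      3 \<le> r \<longrightarrow>
      0 < \<rho> \<longrightarrow>
      ab_rank (res_lattice \<omega>) = CARD('n) - 1 \<longrightarrow>
      Hhat \<in> A_space \<rho> \<inter> F_diamond \<longrightarrow>
      is_normal_form \<omega> Hhat N \<longrightarrow>
      O_ord r N \<longrightarrow>
      0 < p \<longrightarrow>
      0 < lam \<longrightarrow>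
      Gcd (insert p (range (\<lambda>j. \<bar>q $ j\<bar>))) = 1 \<longrightarrow>
      (\<forall>j. \<omega> $ j = lam * real_of_int (q $ j) / real_of_int p) \<longrightarrow>
      (let Cz = C_z \<rho> (A_norm \<rho> Hhat) (Omega \<omega>);
           CH = C_H \<rho> (A_norm \<rho> Hhat) (Omega \<omega>)
       in \<forall>\<delta>\<ge>0. \<exists>(U :: 'n pt set) \<Phi> G G0 Gs.
            {w. pt_norm1 w \<le> Cz / (1 + \<delta> powr (1 / (real r - 2)))} \<subseteq> U \<and>
            canonical_change U \<Phi> \<and>
            \<Phi> ` U \<subseteq> polydisc \<rho> \<and>
            converges_on G0 U \<and> converges_on Gs U \<and>
            G = G0 + Gs \<and>
            O_ord r G \<and>
            G0 \<in> N_diamond \<omega> \<and>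
            (\<forall>w\<in>U. ser_eval (H2 \<omega> + Hhat) (\<Phi> w) = ser_eval (H2 \<omega> + G) w) \<and>
            (\<forall>w. pt_norm1 w \<le> Cz / (1 + \<delta> powr (1 / (real r - 2))) \<longrightarrow>
               cmod (ser_eval G0 w) \<le> CH / (1 + \<delta> powr (real r / (real r - 2))) \<and>
               cmod (ser_eval Gs w) \<le>
                 exp (- lam * \<delta> / real_of_int p) * (CH / (1 + \<delta> powr (real r / (real r - 2)))))))"
proof -
  \<comment> \<open>The constants must be positive for arbitrary arguments, also for those that are
    not a radius or a norm; hence the absolute value and the summand 1 here, and the default value
    in \<open>pos\<close>.\<close>
  define b where "b M = \<bar>M\<bar> * 4 ^ CARD('n) + 1" for M :: real
  have b: "0 < b M" for M by (simp add: b_def add_nonneg_pos)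
  define pos where "pos \<rho> = (if 0 < \<rho> then \<rho> else 1)" for \<rho> :: real
  have pos: "0 < pos \<rho>" for \<rho> by (simp add: pos_def)
  let ?Cz = "\<lambda>\<rho> M Om. const_z TYPE('n) (pos \<rho>) (b M) (gap_of Om)"
  let ?CH = "\<lambda>\<rho> M Om. const_H TYPE('n) (pos \<rho>) (b M) (gap_of Om)"
  show ?thesis
    unfolding Let_def
  proof (rule exI[of _ ?Cz], rule exI[of _ ?CH], intro conjI allI impI, goal_cases)
    case (1 \<rho> M Om)
    show ?case by (rule const_pos(3)[OF pos b gap_of_pos])
  next
    case (2 \<rho> M Om)
    show ?case by (rule const_pos(4)[OF pos b gap_of_pos])
  next
    case (3 \<omega> \<rho> H N r q p lam \<delta>)
    define M where "M = A_norm \<rho> H"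
    define \<nu> where "\<nu> = gap_of (Omega \<omega>)"
    have \<nu>0: "0 < \<nu>" unfolding \<nu>_def by (rule gap_of_pos)
    \<comment> \<open>The gap read off from \<open>Omega\<close> is meaningful as soon as one
      nonresonant vector exists; the bound by \<open>lam / p\<close> converts the rate \<nu> into
      the claimed one.\<close>
    have nonres: "lam / real_of_int p \<le> \<nu> \<and> (\<forall>k. k \<notin> res_lattice \<omega> \<longrightarrow> \<nu> \<le> \<bar>freq \<omega> k\<bar>)"
      if k0: "k0 \<notin> res_lattice \<omega>" for k0
    proof -
      from frequency_gap[OF 3(7,8) _ k0, of q] 3(10)
      obtain \<nu>' where n': "lam / real_of_int p \<le> \<nu>'" "\<And>k. k \<notin> res_lattice \<omega> \<Longrightarrow> \<nu>' \<le> \<bar>freq \<omega> k\<bar>"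
        "\<forall>\<^sub>F s in sequentially. Omega \<omega> s = 1 / \<nu>'" by metis
      have "0 < lam / real_of_int p" using 3(7,8) by simp
      then have "0 < \<nu>'" using n'(1) by linarith
      from gap_of_eq[OF this n'(3)] show ?thesis using n'(1,2) by (simp add: \<nu>_def)
    qed
    have \<nu>: "\<nu> \<le> \<bar>freq \<omega> k\<bar>" if "k \<notin> res_lattice \<omega>" for k
      using nonres[OF that] that by blast
    have \<rho>: "pos \<rho> = \<rho>" using 3(2) by (simp add: pos_def)
    have HA: "H \<in> A_space \<rho>" and H3: "O_ord 3 H" using 3(4) by (auto simp: F_diamond_iff)
    have Hw: "wle (\<rho> / 4) H (b M)"
      by (rule wle_mono[OF wle_A_space[OF HA 3(2)]])
         (simp add: b_def M_def mult_right_mono add_increasing2)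
    \<comment> \<open>Twice the claimed radius, so that the closed ball of the
      \<open>l1\<close>-norm lies in the open polydisc.\<close>
    define Rf where "Rf = 2 * const_z TYPE('n) \<rho> (b M) \<nu> / (1 + \<delta> powr (1 / (real r - 2)))"
    define C where "C = const_H TYPE('n) \<rho> (b M) \<nu> / (1 + \<delta> powr (real r / (real r - 2)))"
    obtain G where G: "O_ord r G" "transforms \<omega> Rf \<rho> H G"
      "wle Rf (res_part \<omega> G) C" "wle Rf (nres_part \<omega> G) (exp (- \<nu> * \<delta>) * C)"
      using main_estimate[OF \<nu>0 \<nu> 3(2) b H3 Hw 3(5,6,1,11) Rf_def C_def] by metis
    obtain \<Phi> where \<Phi>: "sym_map Rf \<rho> \<Phi>"
      "\<And>w. w \<in> polydisc Rf \<Longrightarrow> ser_eval (H2 \<omega> + H) (\<Phi> w) = ser_eval (H2 \<omega> + G) w"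
      using G(2) unfolding transforms_def by blast
    have x0: "0 < 1 + \<delta> powr (1 / (real r - 2))" by (simp add: add_pos_nonneg)
    have cz: "0 < const_z TYPE('n) \<rho> (b M) \<nu>" by (rule const_pos(3)[OF 3(2) b \<nu>0])
    have Rf0: "0 < Rf" using cz x0 by (simp add: Rf_def)
    have ball: "w \<in> polydisc Rf"
      if "pt_norm1 w \<le> const_z TYPE('n) \<rho> (b M) \<nu> / (1 + \<delta> powr (1 / (real r - 2)))" for w
      unfolding polydisc_iff
    proof
      fix v
      have "const_z TYPE('n) \<rho> (b M) \<nu> / (1 + \<delta> powr (1 / (real r - 2))) < Rf"
        using cz x0 unfolding Rf_def by (intro divide_strict_right_mono) auto
      then show "cmod (pcmp w v) < Rf" using norm_pcmp_le_pt_norm1[of w v] that by linarith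
    qed
    have C0: "0 \<le> C" by (rule wle_nonneg[OF G(3)])
    \<comment> \<open>If every frequency is resonant, \<nu> is not tied to \<open>lam / p\<close>,
      but then the nonresonant part is zero.\<close>
    have Gs: "cmod (ser_eval (nres_part \<omega> G) w) \<le> exp (- lam * \<delta> / real_of_int p) * C"
      if w: "w \<in> polydisc Rf" for w
    proof (cases "\<exists>k0. k0 \<notin> res_lattice \<omega>")
      case True
      then have "lam / real_of_int p \<le> \<nu>" using nonres by blast
      then have "lam / real_of_int p * \<delta> \<le> \<nu> * \<delta>" using 3(11) by (rule mult_right_mono)
      then have "exp (- \<nu> * \<delta>) \<le> exp (- lam * \<delta> / real_of_int p)" by simp
      then have "exp (- \<nu> * \<delta>) * C \<le> exp (- lam * \<delta> / real_of_int p) * C"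
        by (rule mult_right_mono[OF _ C0])
      then show ?thesis using eval_bound[OF G(4) w] by linarith
    next
      case False
      then have "nres_part \<omega> G = 0" by (intro ext) (simp add: nres_part_apply ser_apply)
      then show ?thesis using C0 by simp
    qed
    have conv: "converges_on F (polydisc Rf)" if "wle Rf F c" for F c
      unfolding converges_on_def using eval_summable[OF that] by blast
    have N: "res_part \<omega> G \<in> N_diamond \<omega>"
    proof -
      have "O_ord 3 (res_part \<omega> G)" using O_ord_res_part[OF G(1)] 3(1) by (rule O_ord_le)
      then show ?thesis by (auto simp: N_diamond_def F_diamond_iff res_part_apply)
    qed
    show ?case
      unfolding M_def[symmetric] \<nu>_def[symmetric] \<rho> C_def[symmetric]
    proof (rule exI[of _ "polydisc Rf"], rule exI[of _ \<Phi>], rule exI[of _ G],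
        rule exI[of _ "res_part \<omega> G"], rule exI[of _ "nres_part \<omega> G"], intro conjI ballI allI impI)
      show "{w. pt_norm1 w \<le> const_z TYPE('n) \<rho> (b M) \<nu> / (1 + \<delta> powr (1 / (real r - 2)))} \<subseteq> polydisc Rf"
        using ball by blast
      show "canonical_change (polydisc Rf) \<Phi>" by (rule sym_map_canonical_change[OF \<Phi>(1) Rf0])
      show "\<Phi> ` polydisc Rf \<subseteq> polydisc \<rho>" using \<Phi>(1) by (simp add: sym_map_def)
      show "G = res_part \<omega> G + nres_part \<omega> G" by (rule res_nres_part)
      show "cmod (ser_eval (res_part \<omega> G) w) \<le> C"
        if "pt_norm1 w \<le> const_z TYPE('n) \<rho> (b M) \<nu> / (1 + \<delta> powr (1 / (real r - 2)))" for w
        by (rule eval_bound[OF G(3) ball[OF that]])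
      show "cmod (ser_eval (nres_part \<omega> G) w) \<le> exp (- lam * \<delta> / real_of_int p) * C"
        if "pt_norm1 w \<le> const_z TYPE('n) \<rho> (b M) \<nu> / (1 + \<delta> powr (1 / (real r - 2)))" for w
        by (rule Gs[OF ball[OF that]])
    qed (use conv G N \<Phi>(2) in auto)
  qed
qed

end
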